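(* Let $A$ be a right $G$-$\underline H$-comodule algebra over a Hopf $G$-coalgebra $\underline H$. Then $(A\otimes\underline H,(1_A\otimes1_{H_\alpha})_{\alpha\in G})$ is a Galois $G$-$A$-coring if and only if $A$ is a $G$-$\underline H$-Galois extension of $A^0=A^{\mathrm{co}\,A\otimes\underline H}$.
   Context: $G$ is a group with unit $e$, $k$ a commutative ring, $\otimes=\otimes_k$. A $G$-coalgebra is a family $\underline H=(H_\alpha)_{\alpha\in G}$ of $k$-modules with $k$-linear maps $\Delta_{\alpha,\beta}:H_{\alpha\beta}\to H_\alpha\otimes H_\beta$, $\Delta_{\alpha,\beta}(h)=h_{(1,\alpha)}\otimes h_{(2,\beta)}$, and $\epsilon:H_e\to k$ satisfying $(\Delta_{\alpha,\beta}\otimes H_\gamma)\Delta_{\alpha\beta,\gamma}=(H_\alpha\otimes\Delta_{\beta,\gamma})\Delta_{\alpha,\beta\gamma}$ and $(H_\alpha\otimes\epsilon)\Delta_{\alpha,e}=H_\alpha=(\epsilon\otimes H_\alpha)\Delta_{e,\alpha}$. A Hopf $G$-coalgebra is a $G$-coalgebra in which every $H_\alpha$ is a $k$-algebra, all $\Delta_{\alpha,\beta}$ and $\epsilon$ are algebra maps, and there are maps $S_\alpha:H_{\alpha^{-1}}\to H_\alpha$ with $S_\alpha(h_{(1,\alpha^{-1})})h_{(2,\alpha)}=h_{(1,\alpha)}S_\alpha(h_{(2,\alpha^{-1})})=\epsilon(h)1_{H_\alpha}$ for $h\in H_e$. A right $G$-$\underline H$-comodule algebra is a $k$-algebra $A$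 with $k$-linear maps $\rho_\alpha:A\to A\otimes H_\alpha$, $\rho_\alpha(a)=a_{[0]}\otimes a_{[1,\alpha]}$, satisfying $(A\otimes\Delta_{\alpha,\beta})\rho_{\alpha\beta}=(\rho_\alpha\otimes H_\beta)\rho_\beta$, $(A\otimes\epsilon)\rho_e=A$, $\rho_\alpha(ab)=a_{[0]}b_{[0]}\otimes a_{[1,\alpha]}b_{[1,\alpha]}$, $\rho_\alpha(1_A)=1_A\otimes1_{H_\alpha}$. Put $A^0=\{a\in A\mid\rho_\alpha(a)=a\otimes1_{H_\alpha}\ \forall\alpha\in G\}$. A $G$-$A$-coring is a family $(\mathcal C_\alpha)_{\alpha\in G}$ of $A$-bimodules with bimodule maps $\Delta_{\alpha,\beta}:\mathcal C_{\alpha\beta}\to\mathcal C_\alpha\otimes_A\mathcal C_\beta$ and $\varepsilon:\mathcal C_e\to A$ satisfying the same coassociativity and counit identities over $\otimes_A$; morphisms are families of bimodule maps compatible with all $\Delta_{\alpha,\beta}$ and with $\varepsilon$. $A\otimes\underline H=(A\otimes H_\alpha)_\alpha$ is a $G$-$A$-coring with $a'(b\otimes h)a=a'ba_{[0]}\otimes ha_{[1,\alpha]}$ for $h\in H_\alpha$, $\Delta_{\alpha,\beta}(a\otimes h)=(a\otimes h_{(1,\alpha)})\otimes_A(1_A\otimes h_{(2,\beta)})$, $\varepsilon=A\otimes\epsilon$. A grouplike family of a $G$-$A$-coring $\underline{\mathcal C}$ is $(x_\alpha)_\alpha\in\prod_\alpha\mathcal C_\alpha$ with $\Delta_{\alpha,\beta}(x_{\alpha\beta})=x_\alpha\otimes_Ax_\beta$,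 $\varepsilon(x_e)=1$; $T=A^{\mathrm{co}\,\underline{\mathcal C}}=\{a\mid ax_\alpha=x_\alpha a\ \forall\alpha\}$. $(\underline{\mathcal C},\underline x)$ is Galois if $\mathrm{can}_\alpha(\mu_\alpha(a\otimes_Tb))=ax_\alpha b$ defines an isomorphism of $G$-$A$-corings $(A\otimes_TA)\langle G\rangle\to\underline{\mathcal C}$, where $(A\otimes_TA)\langle G\rangle=(\mu_\alpha(A\otimes_TA))_\alpha$ (copies indexed by $\alpha$), $\Delta_{\alpha,\beta}(\mu_{\alpha\beta}(a\otimes b))=\mu_\alpha(a\otimes1)\otimes_A\mu_\beta(1\otimes b)$, $\varepsilon(\mu_e(a\otimes b))=ab$. The family $(1_A\otimes1_{H_\alpha})_\alpha$ is grouplike in $A\otimes\underline H$. $A$ is a $G$-$\underline H$-Galois extension of $A^0$ if for every $\alpha\in G$ the canonical map $A\otimes_{A^0}A\to A\otimes H_\alpha$, $a\otimes b\mapsto ab_{[0]}\otimes b_{[1,\alpha]}$, is bijective. *)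

theory Defs
  imports "HOL-Algebra.Algebra"
begin

section \<open>Bimodules and tensor products\<close>

text \<open>As for \<^type>\<open>module\<close> in HOL-Algebra, the record extends \<^type>\<open>ring\<close> but only the additive part of
  the underlying structure is relevant.\<close>

record ('r, 's, 'm) bimodule = "'m ring" +
  lact :: "'r \<Rightarrow> 'm \<Rightarrow> 'm"
  ract :: "'m \<Rightarrow> 's \<Rightarrow> 'm"

locale bimodule = R: ring R + S: ring S + M: abelian_group M
  for R :: "('r, 'x) ring_scheme" and S :: "('s, 'y) ring_scheme"
    and M :: "('r, 's, 'm) bimodule" +
  assumes lact_closed:
      "\<lbrakk>r \<in> carrier R; m \<in> carrier M\<rbrakk> \<Longrightarrow> lact M r m \<in> carrier M"
    and ract_closed:
      "\<lbrakk>s \<in> carrier S; m \<in> carrier M\<rbrakk> \<Longrightarrow> ract M m s \<in> carrier M"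
    and lact_l_distr:
      "\<lbrakk>r \<in> carrier R; r' \<in> carrier R; m \<in> carrier M\<rbrakk>
        \<Longrightarrow> lact M (r \<oplus>\<^bsub>R\<^esub> r') m = lact M r m \<oplus>\<^bsub>M\<^esub> lact M r' m"
    and lact_r_distr:
      "\<lbrakk>r \<in> carrier R; m \<in> carrier M; m' \<in> carrier M\<rbrakk>
        \<Longrightarrow> lact M r (m \<oplus>\<^bsub>M\<^esub> m') = lact M r m \<oplus>\<^bsub>M\<^esub> lact M r m'"
    and lact_assoc:
      "\<lbrakk>r \<in> carrier R; r' \<in> carrier R; m \<in> carrier M\<rbrakk>
        \<Longrightarrow> lact M (r \<otimes>\<^bsub>R\<^esub> r') m = lact M r (lact M r' m)"
    and lact_one: "m \<in> carrier M \<Longrightarrow> lact M \<one>\<^bsub>R\<^esub> m = m"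
    and ract_r_distr:
      "\<lbrakk>s \<in> carrier S; s' \<in> carrier S; m \<in> carrier M\<rbrakk>
        \<Longrightarrow> ract M m (s \<oplus>\<^bsub>S\<^esub> s') = ract M m s \<oplus>\<^bsub>M\<^esub> ract M m s'"
    and ract_l_distr:
      "\<lbrakk>s \<in> carrier S; m \<in> carrier M; m' \<in> carrier M\<rbrakk>
        \<Longrightarrow> ract M (m \<oplus>\<^bsub>M\<^esub> m') s = ract M m s \<oplus>\<^bsub>M\<^esub> ract M m' s"
    and ract_assoc:
      "\<lbrakk>s \<in> carrier S; s' \<in> carrier S; m \<in> carrier M\<rbrakk>
        \<Longrightarrow> ract M m (s \<otimes>\<^bsub>S\<^esub> s') = ract M (ract M m s) s'"
    and ract_one: "m \<in> carrier M \<Longrightarrow> ract M m \<one>\<^bsub>S\<^esub> = m"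
    and lact_ract:
      "\<lbrakk>r \<in> carrier R; s \<in> carrier S; m \<in> carrier M\<rbrakk>
        \<Longrightarrow> ract M (lact M r m) s = lact M r (ract M m s)"

definition bimodule_hom ::
  "('r, 'x) ring_scheme \<Rightarrow> ('s, 'y) ring_scheme \<Rightarrow> ('r, 's, 'm) bimodule \<Rightarrow> ('r, 's, 'n) bimodule
    \<Rightarrow> ('m \<Rightarrow> 'n) set"
  where "bimodule_hom R S M N =
    {f \<in> carrier M \<rightarrow> carrier N.
      (\<forall>m\<in>carrier M. \<forall>m'\<in>carrier M. f (m \<oplus>\<^bsub>M\<^esub> m') = f m \<oplus>\<^bsub>N\<^esub> f m') \<and>
      (\<forall>r\<in>carrier R. \<forall>m\<in>carrier M. f (lact M r m) = lact N r (f m)) \<and>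
      (\<forall>s\<in>carrier S. \<forall>m\<in>carrier M. f (ract M m s) = ract N (f m) s)}"

definition regular_bimodule :: "('r, 'x) ring_scheme \<Rightarrow> ('r, 'r, 'r) bimodule"
  where "regular_bimodule R =
    \<lparr>carrier = carrier R, monoid.mult = monoid.mult R, one = \<one>\<^bsub>R\<^esub>, ring.zero = \<zero>\<^bsub>R\<^esub>, add = add R,
     lact = monoid.mult R, ract = monoid.mult R\<rparr>"

definition symmetric_bimodule :: "('k, 'm, 'x) module_scheme \<Rightarrow> ('k, 'k, 'm) bimodule"
  where "symmetric_bimodule M =
    \<lparr>carrier = carrier M, monoid.mult = monoid.mult M, one = \<one>\<^bsub>M\<^esub>, ring.zero = \<zero>\<^bsub>M\<^esub>, add = add M,
     lact = smult M, ract = (\<lambda>m r. r \<odot>\<^bsub>M\<^esub> m)\<rparr>"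

text \<open>The tensor product of a right module \<open>M\<close> and a left module \<open>N\<close> over a ring with underlying
  set \<open>B\<close>: the free abelian group on \<open>M \<times> N\<close> modulo the usual relations. It only depends on the
  right action on \<open>M\<close> and the left action on \<open>N\<close> of the elements of \<open>B\<close>, so that \<open>B\<close> may be a
  subring of the rings acting on \<open>M\<close> and \<open>N\<close>.\<close>

definition tensor_relations ::
  "'b set \<Rightarrow> ('r, 'b, 'm) bimodule \<Rightarrow> ('b, 's, 'n) bimodule \<Rightarrow> ('m \<times> 'n \<Rightarrow>\<^sub>0 int) set"
  where "tensor_relations B M N =
      {frag_of (m \<oplus>\<^bsub>M\<^esub> m', n) - frag_of (m, n) - frag_of (m', n) | m m' n.
        m \<in> carrier M \<and> m' \<in> carrier M \<and> n \<in> carrier N}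
    \<union> {frag_of (m, n \<oplus>\<^bsub>N\<^esub> n') - frag_of (m, n) - frag_of (m, n') | m n n'.
        m \<in> carrier M \<and> n \<in> carrier N \<and> n' \<in> carrier N}
    \<union> {frag_of (ract M m b, n) - frag_of (m, lact N b n) | m b n.
        m \<in> carrier M \<and> b \<in> B \<and> n \<in> carrier N}"

definition tensor_null ::
  "'b set \<Rightarrow> ('r, 'b, 'm) bimodule \<Rightarrow> ('b, 's, 'n) bimodule \<Rightarrow> ('m \<times> 'n \<Rightarrow>\<^sub>0 int) set"
  where "tensor_null B M N =
    generate (free_Abelian_group (carrier M \<times> carrier N)) (tensor_relations B M N)"

definition tensor_group ::
  "'b set \<Rightarrow> ('r, 'b, 'm) bimodule \<Rightarrow> ('b, 's, 'n) bimodule \<Rightarrow> ('m \<times> 'n \<Rightarrow>\<^sub>0 int) set monoid"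
  where "tensor_group B M N =
    free_Abelian_group (carrier M \<times> carrier N) Mod tensor_null B M N"

definition pure_tensor ::
  "'b set \<Rightarrow> ('r, 'b, 'm) bimodule \<Rightarrow> ('b, 's, 'n) bimodule \<Rightarrow> 'm \<Rightarrow> 'n \<Rightarrow> ('m \<times> 'n \<Rightarrow>\<^sub>0 int) set"
  where "pure_tensor B M N m n =
    tensor_null B M N #>\<^bsub>free_Abelian_group (carrier M \<times> carrier N)\<^esub> frag_of (m, n)"

text \<open>For a biadditive and balanced map \<open>f\<close> from \<open>M \<times> N\<close> to an abelian group \<open>P\<close>, written
  multiplicatively, \<open>tensor_lift P f\<close> is the group homomorphism on the tensor product with
  \<open>m \<otimes> n \<mapsto> f m n\<close>: it evaluates the extension of \<open>f\<close> to the free abelian group on an arbitrary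
  representative.\<close>

definition tensor_lift ::
  "('p, 'x) monoid_scheme \<Rightarrow> ('m \<Rightarrow> 'n \<Rightarrow> 'p) \<Rightarrow> ('m \<times> 'n \<Rightarrow>\<^sub>0 int) set \<Rightarrow> 'p"
  where "tensor_lift P f u =
    the_elem ((\<lambda>c. finprod P (\<lambda>(m, n). f m n [^]\<^bsub>P\<^esub> Poly_Mapping.lookup c (m, n))
                (Poly_Mapping.keys c)) ` u)"

definition tensor_map ::
  "'b set \<Rightarrow> ('r, 'b, 'm') bimodule \<Rightarrow> ('b, 's, 'n') bimodule \<Rightarrow> ('m \<Rightarrow> 'm') \<Rightarrow> ('n \<Rightarrow> 'n')
    \<Rightarrow> ('m \<times> 'n \<Rightarrow>\<^sub>0 int) set \<Rightarrow> ('m' \<times> 'n' \<Rightarrow>\<^sub>0 int) set"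
  where "tensor_map B M' N' f g =
    tensor_lift (tensor_group B M' N') (\<lambda>m n. pure_tensor B M' N' (f m) (g n))"

definition tensor ::
  "'b set \<Rightarrow> ('r, 'b, 'm) bimodule \<Rightarrow> ('b, 's, 'n) bimodule
    \<Rightarrow> ('r, 's, ('m \<times> 'n \<Rightarrow>\<^sub>0 int) set) bimodule"
  where "tensor B M N =
    \<lparr>carrier = carrier (tensor_group B M N), monoid.mult = undefined, one = undefined,
     ring.zero = \<one>\<^bsub>tensor_group B M N\<^esub>, add = monoid.mult (tensor_group B M N),
     lact = (\<lambda>r. tensor_map B M N (lact M r) (\<lambda>n. n)),
     ract = (\<lambda>u s. tensor_map B M N (\<lambda>m. m) (\<lambda>n. ract N n s) u)\<rparr>"

text \<open>The associativity isomorphism \<open>(L \<otimes>\<^sub>B M) \<otimes>\<^sub>C N \<rightarrow> L \<otimes>\<^sub>B (M \<otimes>\<^sub>C N)\<close>.\<close>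

definition tensor_assoc ::
  "'b set \<Rightarrow> 'c set \<Rightarrow> ('r, 'b, 'l) bimodule \<Rightarrow> ('b, 'c, 'm) bimodule \<Rightarrow> ('c, 's, 'n) bimodule
    \<Rightarrow> (('l \<times> 'm \<Rightarrow>\<^sub>0 int) set \<times> 'n \<Rightarrow>\<^sub>0 int) set \<Rightarrow> ('l \<times> ('m \<times> 'n \<Rightarrow>\<^sub>0 int) set \<Rightarrow>\<^sub>0 int) set"
  where "tensor_assoc B C L M N =
    (let P = tensor_group B L (tensor C M N) in
      tensor_lift P (\<lambda>u n.
        tensor_lift P (\<lambda>l m. pure_tensor B L (tensor C M N) l (pure_tensor C M N m n)) u))"

text \<open>The canonical maps \<open>M \<otimes>\<^sub>R R \<rightarrow> M\<close> and \<open>R \<otimes>\<^sub>R M \<rightarrow> M\<close>.\<close>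

definition tensor_unit_right :: "('r, 's, 'm) bimodule \<Rightarrow> ('m \<times> 's \<Rightarrow>\<^sub>0 int) set \<Rightarrow> 'm"
  where "tensor_unit_right M = tensor_lift (add_monoid M) (ract M)"

definition tensor_unit_left :: "('r, 's, 'm) bimodule \<Rightarrow> ('r \<times> 'm \<Rightarrow>\<^sub>0 int) set \<Rightarrow> 'm"
  where "tensor_unit_left M = tensor_lift (add_monoid M) (lact M)"


section \<open>Group corings\<close>

locale group_coring = G: group G + A: ring A
  for G :: "('g, 'x) monoid_scheme" and A :: "('a, 'y) ring_scheme"
    and C :: "'g \<Rightarrow> ('a, 'a, 'c) bimodule"
    and \<Delta> :: "'g \<Rightarrow> 'g \<Rightarrow> 'c \<Rightarrow> ('c \<times> 'c \<Rightarrow>\<^sub>0 int) set"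
    and \<epsilon> :: "'c \<Rightarrow> 'a" +
  assumes component_bimodule: "\<alpha> \<in> carrier G \<Longrightarrow> bimodule A A (C \<alpha>)"
    and comult_hom:
      "\<lbrakk>\<alpha> \<in> carrier G; \<beta> \<in> carrier G\<rbrakk>
        \<Longrightarrow> \<Delta> \<alpha> \<beta> \<in> bimodule_hom A A (C (\<alpha> \<otimes>\<^bsub>G\<^esub> \<beta>)) (tensor (carrier A) (C \<alpha>) (C \<beta>))"
    and counit_hom: "\<epsilon> \<in> bimodule_hom A A (C \<one>\<^bsub>G\<^esub>) (regular_bimodule A)"
    and coassoc:
      "\<lbrakk>\<alpha> \<in> carrier G; \<beta> \<in> carrier G; \<gamma> \<in> carrier G; c \<in> carrier (C (\<alpha> \<otimes>\<^bsub>G\<^esub> \<beta> \<otimes>\<^bsub>G\<^esub> \<gamma>))\<rbrakk>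
        \<Longrightarrow> tensor_assoc (carrier A) (carrier A) (C \<alpha>) (C \<beta>) (C \<gamma>)
              (tensor_map (carrier A) (tensor (carrier A) (C \<alpha>) (C \<beta>)) (C \<gamma>)
                (\<Delta> \<alpha> \<beta>) (\<lambda>c. c) (\<Delta> (\<alpha> \<otimes>\<^bsub>G\<^esub> \<beta>) \<gamma> c))
          = tensor_map (carrier A) (C \<alpha>) (tensor (carrier A) (C \<beta>) (C \<gamma>))
              (\<lambda>c. c) (\<Delta> \<beta> \<gamma>) (\<Delta> \<alpha> (\<beta> \<otimes>\<^bsub>G\<^esub> \<gamma>) c)"
    and counit_right:
      "\<lbrakk>\<alpha> \<in> carrier G; c \<in> carrier (C \<alpha>)\<rbrakk>
        \<Longrightarrow> tensor_unit_right (C \<alpha>)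
              (tensor_map (carrier A) (C \<alpha>) (regular_bimodule A) (\<lambda>c. c) \<epsilon> (\<Delta> \<alpha> \<one>\<^bsub>G\<^esub> c)) = c"
    and counit_left:
      "\<lbrakk>\<alpha> \<in> carrier G; c \<in> carrier (C \<alpha>)\<rbrakk>
        \<Longrightarrow> tensor_unit_left (C \<alpha>)
              (tensor_map (carrier A) (regular_bimodule A) (C \<alpha>) \<epsilon> (\<lambda>c. c) (\<Delta> \<one>\<^bsub>G\<^esub> \<alpha> c)) = c"

definition group_coring_hom ::
  "('g, 'x) monoid_scheme \<Rightarrow> ('a, 'y) ring_scheme
    \<Rightarrow> ('g \<Rightarrow> ('a, 'a, 'c) bimodule) \<Rightarrow> ('g \<Rightarrow> 'g \<Rightarrow> 'c \<Rightarrow> ('c \<times> 'c \<Rightarrow>\<^sub>0 int) set) \<Rightarrow> ('c \<Rightarrow> 'a)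
    \<Rightarrow> ('g \<Rightarrow> ('a, 'a, 'd) bimodule) \<Rightarrow> ('g \<Rightarrow> 'g \<Rightarrow> 'd \<Rightarrow> ('d \<times> 'd \<Rightarrow>\<^sub>0 int) set) \<Rightarrow> ('d \<Rightarrow> 'a)
    \<Rightarrow> ('g \<Rightarrow> 'c \<Rightarrow> 'd) set"
  where "group_coring_hom G A C \<Delta> \<epsilon> D \<Delta>' \<epsilon>' =
    {f. (\<forall>\<alpha>\<in>carrier G. f \<alpha> \<in> bimodule_hom A A (C \<alpha>) (D \<alpha>)) \<and>
        (\<forall>\<alpha>\<in>carrier G. \<forall>\<beta>\<in>carrier G. \<forall>c\<in>carrier (C (\<alpha> \<otimes>\<^bsub>G\<^esub> \<beta>)).
          \<Delta>' \<alpha> \<beta> (f (\<alpha> \<otimes>\<^bsub>G\<^esub> \<beta>) c)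
            = tensor_map (carrier A) (D \<alpha>) (D \<beta>) (f \<alpha>) (f \<beta>) (\<Delta> \<alpha> \<beta> c)) \<and>
        (\<forall>c\<in>carrier (C \<one>\<^bsub>G\<^esub>). \<epsilon>' (f \<one>\<^bsub>G\<^esub> c) = \<epsilon> c)}"

definition group_coring_iso ::
  "('g, 'x) monoid_scheme \<Rightarrow> ('a, 'y) ring_scheme
    \<Rightarrow> ('g \<Rightarrow> ('a, 'a, 'c) bimodule) \<Rightarrow> ('g \<Rightarrow> 'g \<Rightarrow> 'c \<Rightarrow> ('c \<times> 'c \<Rightarrow>\<^sub>0 int) set) \<Rightarrow> ('c \<Rightarrow> 'a)
    \<Rightarrow> ('g \<Rightarrow> ('a, 'a, 'd) bimodule) \<Rightarrow> ('g \<Rightarrow> 'g \<Rightarrow> 'd \<Rightarrow> ('d \<times> 'd \<Rightarrow>\<^sub>0 int) set) \<Rightarrow> ('d \<Rightarrow> 'a)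
    \<Rightarrow> ('g \<Rightarrow> 'c \<Rightarrow> 'd) set"
  where "group_coring_iso G A C \<Delta> \<epsilon> D \<Delta>' \<epsilon>' =
    {f \<in> group_coring_hom G A C \<Delta> \<epsilon> D \<Delta>' \<epsilon>'.
      \<exists>g\<in>group_coring_hom G A D \<Delta>' \<epsilon>' C \<Delta> \<epsilon>. \<forall>\<alpha>\<in>carrier G.
        (\<forall>c\<in>carrier (C \<alpha>). g \<alpha> (f \<alpha> c) = c) \<and> (\<forall>d\<in>carrier (D \<alpha>). f \<alpha> (g \<alpha> d) = d)}"

definition grouplike_family ::
  "('g, 'x) monoid_scheme \<Rightarrow> ('a, 'y) ring_scheme
    \<Rightarrow> ('g \<Rightarrow> ('a, 'a, 'c) bimodule) \<Rightarrow> ('g \<Rightarrow> 'g \<Rightarrow> 'c \<Rightarrow> ('c \<times> 'c \<Rightarrow>\<^sub>0 int) set) \<Rightarrow> ('c \<Rightarrow> 'a)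
    \<Rightarrow> ('g \<Rightarrow> 'c) \<Rightarrow> bool"
  where "grouplike_family G A C \<Delta> \<epsilon> x \<longleftrightarrow>
    (\<forall>\<alpha>\<in>carrier G. x \<alpha> \<in> carrier (C \<alpha>)) \<and>
    (\<forall>\<alpha>\<in>carrier G. \<forall>\<beta>\<in>carrier G.
      \<Delta> \<alpha> \<beta> (x (\<alpha> \<otimes>\<^bsub>G\<^esub> \<beta>)) = pure_tensor (carrier A) (C \<alpha>) (C \<beta>) (x \<alpha>) (x \<beta>)) \<and>
    \<epsilon> (x \<one>\<^bsub>G\<^esub>) = \<one>\<^bsub>A\<^esub>"

definition coring_coinvariants ::
  "('g, 'x) monoid_scheme \<Rightarrow> ('a, 'y) ring_scheme \<Rightarrow> ('g \<Rightarrow> ('a, 'a, 'c) bimodule)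
    \<Rightarrow> ('g \<Rightarrow> 'c) \<Rightarrow> 'a set"
  where "coring_coinvariants G A C x =
    {a \<in> carrier A. \<forall>\<alpha>\<in>carrier G. lact (C \<alpha>) a (x \<alpha>) = ract (C \<alpha>) (x \<alpha>) a}"

text \<open>The coring \<open>(A \<otimes>\<^sub>T A)\<langle>G\<rangle>\<close>. The copies \<open>\<mu>\<^sub>\<alpha>(A \<otimes>\<^sub>T A)\<close> are the members of a constant
  family; the index is carried by the family and \<open>\<mu>\<^sub>\<alpha>\<close> is the identity.\<close>

definition canonical_coring ::
  "('a, 'y) ring_scheme \<Rightarrow> 'a set \<Rightarrow> 'g \<Rightarrow> ('a, 'a, ('a \<times> 'a \<Rightarrow>\<^sub>0 int) set) bimodule"
  where "canonical_coring A T \<alpha> = tensor T (regular_bimodule A) (regular_bimodule A)"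

definition canonical_comult ::
  "('a, 'y) ring_scheme \<Rightarrow> 'a set \<Rightarrow> 'g \<Rightarrow> 'g \<Rightarrow> ('a \<times> 'a \<Rightarrow>\<^sub>0 int) set
    \<Rightarrow> (('a \<times> 'a \<Rightarrow>\<^sub>0 int) set \<times> ('a \<times> 'a \<Rightarrow>\<^sub>0 int) set \<Rightarrow>\<^sub>0 int) set"
  where "canonical_comult A T \<alpha> \<beta> =
    (let t = pure_tensor T (regular_bimodule A) (regular_bimodule A) in
      tensor_lift
        (tensor_group (carrier A) (canonical_coring A T \<alpha>) (canonical_coring A T \<beta>))
        (\<lambda>a b. pure_tensor (carrier A) (canonical_coring A T \<alpha>) (canonical_coring A T \<beta>)
                 (t a \<one>\<^bsub>A\<^esub>) (t \<one>\<^bsub>A\<^esub> b)))"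

definition canonical_counit ::
  "('a, 'y) ring_scheme \<Rightarrow> ('a \<times> 'a \<Rightarrow>\<^sub>0 int) set \<Rightarrow> 'a"
  where "canonical_counit A = tensor_lift (add_monoid A) (monoid.mult A)"

definition coring_can ::
  "('g \<Rightarrow> ('a, 'a, 'c) bimodule) \<Rightarrow> ('g \<Rightarrow> 'c) \<Rightarrow> 'g \<Rightarrow> ('a \<times> 'a \<Rightarrow>\<^sub>0 int) set \<Rightarrow> 'c"
  where "coring_can C x \<alpha> =
    tensor_lift (add_monoid (C \<alpha>)) (\<lambda>a b. ract (C \<alpha>) (lact (C \<alpha>) a (x \<alpha>)) b)"

definition galois_group_coring ::
  "('g, 'x) monoid_scheme \<Rightarrow> ('a, 'y) ring_scheme
    \<Rightarrow> ('g \<Rightarrow> ('a, 'a, 'c) bimodule) \<Rightarrow> ('g \<Rightarrow> 'g \<Rightarrow> 'c \<Rightarrow> ('c \<times> 'c \<Rightarrow>\<^sub>0 int) set) \<Rightarrow> ('c \<Rightarrow> 'a)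
    \<Rightarrow> ('g \<Rightarrow> 'c) \<Rightarrow> bool"
  where "galois_group_coring G A C \<Delta> \<epsilon> x \<longleftrightarrow>
    group_coring G A C \<Delta> \<epsilon> \<and> grouplike_family G A C \<Delta> \<epsilon> x \<and>
    (let T = coring_coinvariants G A C x in
      coring_can C x \<in> group_coring_iso G A
        (canonical_coring A T) (canonical_comult A T) (canonical_counit A) C \<Delta> \<epsilon>)"


section \<open>Hopf group coalgebras and comodule algebras\<close>

text \<open>The locale \<open>algebra\<close> of HOL-Algebra requires a commutative multiplication.\<close>

locale k_algebra = module K A + A: ring A
  for K :: "('k, 'x) ring_scheme" and A :: "('k, 'a) module" +
  assumes smult_mult_left:
      "\<lbrakk>r \<in> carrier K; a \<in> carrier A; b \<in> carrier A\<rbrakk>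
        \<Longrightarrow> (r \<odot>\<^bsub>A\<^esub> a) \<otimes>\<^bsub>A\<^esub> b = r \<odot>\<^bsub>A\<^esub> (a \<otimes>\<^bsub>A\<^esub> b)"
    and smult_mult_right:
      "\<lbrakk>r \<in> carrier K; a \<in> carrier A; b \<in> carrier A\<rbrakk>
        \<Longrightarrow> a \<otimes>\<^bsub>A\<^esub> (r \<odot>\<^bsub>A\<^esub> b) = r \<odot>\<^bsub>A\<^esub> (a \<otimes>\<^bsub>A\<^esub> b)"

abbreviation linear_maps ::
  "('k, 'x) ring_scheme \<Rightarrow> ('k, 'm) module \<Rightarrow> ('k, 'n) module \<Rightarrow> ('m \<Rightarrow> 'n) set"
  where "linear_maps K M N \<equiv> bimodule_hom K K (symmetric_bimodule M) (symmetric_bimodule N)"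

abbreviation k_tensor ::
  "('k, 'x) ring_scheme \<Rightarrow> ('k, 'm) module \<Rightarrow> ('k, 'n) module
    \<Rightarrow> ('k, 'k, ('m \<times> 'n \<Rightarrow>\<^sub>0 int) set) bimodule"
  where "k_tensor K M N \<equiv> tensor (carrier K) (symmetric_bimodule M) (symmetric_bimodule N)"

abbreviation k_tensor_group ::
  "('k, 'x) ring_scheme \<Rightarrow> ('k, 'm) module \<Rightarrow> ('k, 'n) module
    \<Rightarrow> ('m \<times> 'n \<Rightarrow>\<^sub>0 int) set monoid"
  where "k_tensor_group K M N \<equiv>
    tensor_group (carrier K) (symmetric_bimodule M) (symmetric_bimodule N)"

abbreviation k_pure_tensor ::
  "('k, 'x) ring_scheme \<Rightarrow> ('k, 'm) module \<Rightarrow> ('k, 'n) module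
    \<Rightarrow> 'm \<Rightarrow> 'n \<Rightarrow> ('m \<times> 'n \<Rightarrow>\<^sub>0 int) set"
  where "k_pure_tensor K M N \<equiv>
    pure_tensor (carrier K) (symmetric_bimodule M) (symmetric_bimodule N)"

text \<open>The multiplication \<open>(m \<otimes> n) (m' \<otimes> n') = m m' \<otimes> n n'\<close> of the tensor product of two algebras.\<close>

definition k_tensor_mult ::
  "('k, 'x) ring_scheme \<Rightarrow> ('k, 'm) module \<Rightarrow> ('k, 'n) module
    \<Rightarrow> ('m \<times> 'n \<Rightarrow>\<^sub>0 int) set \<Rightarrow> ('m \<times> 'n \<Rightarrow>\<^sub>0 int) set \<Rightarrow> ('m \<times> 'n \<Rightarrow>\<^sub>0 int) set"
  where "k_tensor_mult K M N u v =
    tensor_lift (k_tensor_group K M N) (\<lambda>m n.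
      tensor_lift (k_tensor_group K M N) (\<lambda>m' n'.
        k_pure_tensor K M N (m \<otimes>\<^bsub>M\<^esub> m') (n \<otimes>\<^bsub>N\<^esub> n')) v) u"

text \<open>A \<open>G\<close>-coalgebra over \<open>K\<close> is a family of \<open>K\<close>-modules with the structure of a \<open>G\<close>-\<open>K\<close>-coring,
  the modules being regarded as bimodules with equal left and right action.\<close>

locale group_coalgebra = K: cring K +
  group_coring G K "\<lambda>\<alpha>. symmetric_bimodule (H \<alpha>)" \<Delta> \<epsilon>
  for G :: "('g, 'x) monoid_scheme" and K :: "('k, 'y) ring_scheme"
    and H :: "'g \<Rightarrow> ('k, 'h) module"
    and \<Delta> :: "'g \<Rightarrow> 'g \<Rightarrow> 'h \<Rightarrow> ('h \<times> 'h \<Rightarrow>\<^sub>0 int) set"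
    and \<epsilon> :: "'h \<Rightarrow> 'k" +
  assumes component_module: "\<alpha> \<in> carrier G \<Longrightarrow> module K (H \<alpha>)"

locale hopf_group_coalgebra = group_coalgebra G K H \<Delta> \<epsilon>
  for G :: "('g, 'x) monoid_scheme" and K :: "('k, 'y) ring_scheme"
    and H :: "'g \<Rightarrow> ('k, 'h) module"
    and \<Delta> :: "'g \<Rightarrow> 'g \<Rightarrow> 'h \<Rightarrow> ('h \<times> 'h \<Rightarrow>\<^sub>0 int) set"
    and \<epsilon> :: "'h \<Rightarrow> 'k"
    and S :: "'g \<Rightarrow> 'h \<Rightarrow> 'h" +
  assumes component_algebra: "\<alpha> \<in> carrier G \<Longrightarrow> k_algebra K (H \<alpha>)"
    and comult_mult:
      "\<lbrakk>\<alpha> \<in> carrier G; \<beta> \<in> carrier G;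
        h \<in> carrier (H (\<alpha> \<otimes>\<^bsub>G\<^esub> \<beta>)); h' \<in> carrier (H (\<alpha> \<otimes>\<^bsub>G\<^esub> \<beta>))\<rbrakk>
        \<Longrightarrow> \<Delta> \<alpha> \<beta> (h \<otimes>\<^bsub>H (\<alpha> \<otimes>\<^bsub>G\<^esub> \<beta>)\<^esub> h')
              = k_tensor_mult K (H \<alpha>) (H \<beta>) (\<Delta> \<alpha> \<beta> h) (\<Delta> \<alpha> \<beta> h')"
    and comult_one:
      "\<lbrakk>\<alpha> \<in> carrier G; \<beta> \<in> carrier G\<rbrakk>
        \<Longrightarrow> \<Delta> \<alpha> \<beta> \<one>\<^bsub>H (\<alpha> \<otimes>\<^bsub>G\<^esub> \<beta>)\<^esub> = k_pure_tensor K (H \<alpha>) (H \<beta>) \<one>\<^bsub>H \<alpha>\<^esub> \<one>\<^bsub>H \<beta>\<^esub>"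
    and counit_mult:
      "\<lbrakk>h \<in> carrier (H \<one>\<^bsub>G\<^esub>); h' \<in> carrier (H \<one>\<^bsub>G\<^esub>)\<rbrakk>
        \<Longrightarrow> \<epsilon> (h \<otimes>\<^bsub>H \<one>\<^bsub>G\<^esub>\<^esub> h') = \<epsilon> h \<otimes>\<^bsub>K\<^esub> \<epsilon> h'"
    and counit_one: "\<epsilon> \<one>\<^bsub>H \<one>\<^bsub>G\<^esub>\<^esub> = \<one>\<^bsub>K\<^esub>"
    and antipode_linear:
      "\<alpha> \<in> carrier G \<Longrightarrow> S \<alpha> \<in> linear_maps K (H (inv\<^bsub>G\<^esub> \<alpha>)) (H \<alpha>)"
    and antipode_left:
      "\<lbrakk>\<alpha> \<in> carrier G; h \<in> carrier (H \<one>\<^bsub>G\<^esub>)\<rbrakk>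
        \<Longrightarrow> tensor_lift (add_monoid (H \<alpha>)) (\<lambda>h\<^sub>1 h\<^sub>2. S \<alpha> h\<^sub>1 \<otimes>\<^bsub>H \<alpha>\<^esub> h\<^sub>2) (\<Delta> (inv\<^bsub>G\<^esub> \<alpha>) \<alpha> h)
              = \<epsilon> h \<odot>\<^bsub>H \<alpha>\<^esub> \<one>\<^bsub>H \<alpha>\<^esub>"
    and antipode_right:
      "\<lbrakk>\<alpha> \<in> carrier G; h \<in> carrier (H \<one>\<^bsub>G\<^esub>)\<rbrakk>
        \<Longrightarrow> tensor_lift (add_monoid (H \<alpha>)) (\<lambda>h\<^sub>1 h\<^sub>2. h\<^sub>1 \<otimes>\<^bsub>H \<alpha>\<^esub> S \<alpha> h\<^sub>2) (\<Delta> \<alpha> (inv\<^bsub>G\<^esub> \<alpha>) h)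
              = \<epsilon> h \<odot>\<^bsub>H \<alpha>\<^esub> \<one>\<^bsub>H \<alpha>\<^esub>"

locale group_comodule_algebra = A: k_algebra K A
  for G :: "('g, 'x) monoid_scheme" and K :: "('k, 'y) ring_scheme"
    and H :: "'g \<Rightarrow> ('k, 'h) module"
    and \<Delta> :: "'g \<Rightarrow> 'g \<Rightarrow> 'h \<Rightarrow> ('h \<times> 'h \<Rightarrow>\<^sub>0 int) set"
    and \<epsilon> :: "'h \<Rightarrow> 'k"
    and A :: "('k, 'a) module"
    and \<rho> :: "'g \<Rightarrow> 'a \<Rightarrow> ('a \<times> 'h \<Rightarrow>\<^sub>0 int) set" +
  assumes coact_linear:
      "\<alpha> \<in> carrier G \<Longrightarrow> \<rho> \<alpha> \<in> bimodule_hom K K (symmetric_bimodule A) (k_tensor K A (H \<alpha>))"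
    and coact_coassoc:
      "\<lbrakk>\<alpha> \<in> carrier G; \<beta> \<in> carrier G; a \<in> carrier A\<rbrakk>
        \<Longrightarrow> tensor_map (carrier K) (symmetric_bimodule A) (k_tensor K (H \<alpha>) (H \<beta>))
              (\<lambda>a. a) (\<Delta> \<alpha> \<beta>) (\<rho> (\<alpha> \<otimes>\<^bsub>G\<^esub> \<beta>) a)
          = tensor_assoc (carrier K) (carrier K)
              (symmetric_bimodule A) (symmetric_bimodule (H \<alpha>)) (symmetric_bimodule (H \<beta>))
              (tensor_map (carrier K) (k_tensor K A (H \<alpha>)) (symmetric_bimodule (H \<beta>))
                (\<rho> \<alpha>) (\<lambda>h. h) (\<rho> \<beta> a))"
    and coact_counit:
      "a \<in> carrier A \<Longrightarrow>
        tensor_unit_right (symmetric_bimodule A)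
          (tensor_map (carrier K) (symmetric_bimodule A) (regular_bimodule K) (\<lambda>a. a) \<epsilon>
            (\<rho> \<one>\<^bsub>G\<^esub> a)) = a"
    and coact_mult:
      "\<lbrakk>\<alpha> \<in> carrier G; a \<in> carrier A; b \<in> carrier A\<rbrakk>
        \<Longrightarrow> \<rho> \<alpha> (a \<otimes>\<^bsub>A\<^esub> b) = k_tensor_mult K A (H \<alpha>) (\<rho> \<alpha> a) (\<rho> \<alpha> b)"
    and coact_one:
      "\<alpha> \<in> carrier G \<Longrightarrow> \<rho> \<alpha> \<one>\<^bsub>A\<^esub> = k_pure_tensor K A (H \<alpha>) \<one>\<^bsub>A\<^esub> \<one>\<^bsub>H \<alpha>\<^esub>"

definition comodule_coinvariants ::
  "('g, 'x) monoid_scheme \<Rightarrow> ('k, 'y) ring_scheme \<Rightarrow> ('g \<Rightarrow> ('k, 'h) module) \<Rightarrow> ('k, 'a) module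
    \<Rightarrow> ('g \<Rightarrow> 'a \<Rightarrow> ('a \<times> 'h \<Rightarrow>\<^sub>0 int) set) \<Rightarrow> 'a set"
  where "comodule_coinvariants G K H A \<rho> =
    {a \<in> carrier A. \<forall>\<alpha>\<in>carrier G. \<rho> \<alpha> a = k_pure_tensor K A (H \<alpha>) a \<one>\<^bsub>H \<alpha>\<^esub>}"

text \<open>\<open>a \<otimes> b \<mapsto> a b\<^sub>[\<^sub>0\<^sub>] \<otimes> b\<^sub>[\<^sub>1\<^sub>,\<^sub>\<alpha>\<^sub>]\<close>\<close>

definition hopf_galois_can ::
  "('k, 'y) ring_scheme \<Rightarrow> ('g \<Rightarrow> ('k, 'h) module) \<Rightarrow> ('k, 'a) module
    \<Rightarrow> ('g \<Rightarrow> 'a \<Rightarrow> ('a \<times> 'h \<Rightarrow>\<^sub>0 int) set) \<Rightarrow> 'g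
    \<Rightarrow> ('a \<times> 'a \<Rightarrow>\<^sub>0 int) set \<Rightarrow> ('a \<times> 'h \<Rightarrow>\<^sub>0 int) set"
  where "hopf_galois_can K H A \<rho> \<alpha> =
    tensor_lift (k_tensor_group K A (H \<alpha>)) (\<lambda>a b.
      tensor_lift (k_tensor_group K A (H \<alpha>)) (\<lambda>b\<^sub>0 b\<^sub>1.
        k_pure_tensor K A (H \<alpha>) (a \<otimes>\<^bsub>A\<^esub> b\<^sub>0) b\<^sub>1) (\<rho> \<alpha> b))"

definition hopf_galois_extension ::
  "('g, 'x) monoid_scheme \<Rightarrow> ('k, 'y) ring_scheme \<Rightarrow> ('g \<Rightarrow> ('k, 'h) module) \<Rightarrow> ('k, 'a) module
    \<Rightarrow> ('g \<Rightarrow> 'a \<Rightarrow> ('a \<times> 'h \<Rightarrow>\<^sub>0 int) set) \<Rightarrow> bool"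
  where "hopf_galois_extension G K H A \<rho> \<longleftrightarrow>
    (\<forall>\<alpha>\<in>carrier G.
      bij_betw (hopf_galois_can K H A \<rho> \<alpha>)
        (carrier (tensor (comodule_coinvariants G K H A \<rho>)
                    (regular_bimodule A) (regular_bimodule A)))
        (carrier (k_tensor K A (H \<alpha>))))"


section \<open>The group coring of a comodule algebra\<close>

text \<open>The right action \<open>(b \<otimes> h) a = b a\<^sub>[\<^sub>0\<^sub>] \<otimes> h a\<^sub>[\<^sub>1\<^sub>,\<^sub>\<alpha>\<^sub>]\<close> is multiplication by
  \<open>\<rho>\<^sub>\<alpha>(a)\<close> in the algebra \<open>A \<otimes> H\<^sub>\<alpha>\<close>.\<close>

definition comodule_coring ::
  "('k, 'y) ring_scheme \<Rightarrow> ('g \<Rightarrow> ('k, 'h) module) \<Rightarrow> ('k, 'a) module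
    \<Rightarrow> ('g \<Rightarrow> 'a \<Rightarrow> ('a \<times> 'h \<Rightarrow>\<^sub>0 int) set) \<Rightarrow> 'g
    \<Rightarrow> ('a, 'a, ('a \<times> 'h \<Rightarrow>\<^sub>0 int) set) bimodule"
  where "comodule_coring K H A \<rho> \<alpha> =
    \<lparr>carrier = carrier (k_tensor K A (H \<alpha>)), monoid.mult = undefined, one = undefined,
     ring.zero = \<zero>\<^bsub>k_tensor K A (H \<alpha>)\<^esub>, add = add (k_tensor K A (H \<alpha>)),
     lact = (\<lambda>a. tensor_lift (k_tensor_group K A (H \<alpha>))
                   (\<lambda>b h. k_pure_tensor K A (H \<alpha>) (a \<otimes>\<^bsub>A\<^esub> b) h)),
     ract = (\<lambda>u a. k_tensor_mult K A (H \<alpha>) u (\<rho> \<alpha> a))\<rparr>"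

definition comodule_comult ::
  "('k, 'y) ring_scheme \<Rightarrow> ('g \<Rightarrow> ('k, 'h) module)
    \<Rightarrow> ('g \<Rightarrow> 'g \<Rightarrow> 'h \<Rightarrow> ('h \<times> 'h \<Rightarrow>\<^sub>0 int) set) \<Rightarrow> ('k, 'a) module
    \<Rightarrow> ('g \<Rightarrow> 'a \<Rightarrow> ('a \<times> 'h \<Rightarrow>\<^sub>0 int) set) \<Rightarrow> 'g \<Rightarrow> 'g
    \<Rightarrow> ('a \<times> 'h \<Rightarrow>\<^sub>0 int) set
    \<Rightarrow> (('a \<times> 'h \<Rightarrow>\<^sub>0 int) set \<times> ('a \<times> 'h \<Rightarrow>\<^sub>0 int) set \<Rightarrow>\<^sub>0 int) set"
  where "comodule_comult K H \<Delta> A \<rho> \<alpha> \<beta> =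
    (let C = comodule_coring K H A \<rho>; P = tensor_group (carrier A) (C \<alpha>) (C \<beta>) in
      tensor_lift P (\<lambda>a h.
        tensor_lift P (\<lambda>h\<^sub>1 h\<^sub>2.
          pure_tensor (carrier A) (C \<alpha>) (C \<beta>)
            (k_pure_tensor K A (H \<alpha>) a h\<^sub>1) (k_pure_tensor K A (H \<beta>) \<one>\<^bsub>A\<^esub> h\<^sub>2))
          (\<Delta> \<alpha> \<beta> h)))"

definition comodule_counit ::
  "('h \<Rightarrow> 'k) \<Rightarrow> ('k, 'a) module \<Rightarrow> ('a \<times> 'h \<Rightarrow>\<^sub>0 int) set \<Rightarrow> 'a"
  where "comodule_counit \<epsilon> A = tensor_lift (add_monoid A) (\<lambda>a h. \<epsilon> h \<odot>\<^bsub>A\<^esub> a)"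

definition comodule_grouplike ::
  "('k, 'y) ring_scheme \<Rightarrow> ('g \<Rightarrow> ('k, 'h) module) \<Rightarrow> ('k, 'a) module
    \<Rightarrow> 'g \<Rightarrow> ('a \<times> 'h \<Rightarrow>\<^sub>0 int) set"
  where "comodule_grouplike K H A \<alpha> = k_pure_tensor K A (H \<alpha>) \<one>\<^bsub>A\<^esub> \<one>\<^bsub>H \<alpha>\<^esub>"

end

theory Submission
  imports Defs
begin

text \<open>
  Why the theorem holds. In the coring \<open>A \<otimes> H\<close> with \<open>x\<^sub>\<alpha> = 1 \<otimes> 1\<close> one has \<open>a x\<^sub>\<alpha> = a \<otimes> 1\<close> and
  \<open>x\<^sub>\<alpha> a = \<rho>\<^sub>\<alpha>(a)\<close>. Hence the elements commuting with all \<open>x\<^sub>\<alpha>\<close> are the coinvariants of the coaction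
  (\<open>coinvariants_eq\<close>), and \<open>a x\<^sub>\<alpha> b = (a \<otimes> 1) \<rho>\<^sub>\<alpha>(b) = a b\<^sub>[\<^sub>0\<^sub>] \<otimes> b\<^sub>[\<^sub>1\<^sub>,\<^sub>\<alpha>\<^sub>]\<close>, so that the canonical map
  of the coring in degree \<open>\<alpha>\<close> is the canonical map of the Hopf-Galois extension
  (\<open>hopf_galois_can_eq\<close>). What separates the two notions is that a Galois coring requires an
  isomorphism of group corings where a Galois extension only requires bijections. For every group
  coring with a grouplike family this gap closes (\<open>galois_iff_bij_can\<close>): the comultiplication and the
  counit are bimodule maps with known values on the grouplike elements, which forces the canonical
  maps to be a morphism of corings, and the inverse of a bijective morphism is again one.

  It remains to see that \<open>A \<otimes> H\<close> is a group coring at all (\<open>comodule_group_coring\<close>).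
  Each component is a bimodule because \<open>A \<otimes> H\<^sub>\<alpha>\<close> is an algebra and \<open>a \<mapsto> a \<otimes> 1\<close> and \<open>\<rho>\<^sub>\<alpha>\<close> are ring
  homomorphisms into it. The comultiplication is that of \<open>H\<close> followed by
  \<open>\<Theta>\<^sub>a : h \<otimes> h' \<mapsto> (a \<otimes> h) \<otimes>\<^sub>A (1 \<otimes> h')\<close>; coassociativity and the counit laws are carried over from \<open>H\<close>
  along such maps, and right linearity combines the multiplicativity of the comultiplication of \<open>H\<close>
  with the coassociativity of the coaction.

  All identities are between additive maps on tensor products and are checked on pure tensors.
  The elements \<open>\<rho>\<^sub>\<alpha>(a)\<close> and \<open>\<Delta>\<^sub>\<alpha>\<^sub>,\<^sub>\<beta>(h)\<close> are not pure; an identity that contains one of them is first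
  proved with an arbitrary tensor in its place, where additivity reduces it to pure tensors, and
  only then specialised. This takes the place of calculations in Sweedler notation.
\<close>

section \<open>Additive maps\<close>

lemma abelian_group_hom_intro:
  assumes "abelian_group V" "abelian_group Y"
    and "\<And>x. x \<in> carrier V \<Longrightarrow> f x \<in> carrier Y"
    and "\<And>x x'. \<lbrakk>x \<in> carrier V; x' \<in> carrier V\<rbrakk> \<Longrightarrow> f (x \<oplus>\<^bsub>V\<^esub> x') = f x \<oplus>\<^bsub>Y\<^esub> f x'"
  shows "abelian_group_hom V Y f"
  using assms
  by (intro abelian_group_homI group_hom.intro group_hom_axioms.intro)
     (auto simp: hom_def abelian_group.a_group)

lemma abelian_group_hom_id: "abelian_group V \<Longrightarrow> abelian_group_hom V V (\<lambda>x. x)"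
  by (rule abelian_group_hom_intro) auto

lemma abelian_group_hom_compose:
  assumes "abelian_group_hom Y Z g" "abelian_group_hom V Y f"
  shows "abelian_group_hom V Z (\<lambda>x. g (f x))"
proof -
  interpret g: abelian_group_hom Y Z g by fact
  interpret f: abelian_group_hom V Y f by fact
  show ?thesis
    by (rule abelian_group_hom_intro) (auto intro: g.H.abelian_group_axioms f.G.abelian_group_axioms)
qed

lemma abelian_group_hom_cong:
  assumes "abelian_group_hom V Y f" "\<And>x. x \<in> carrier V \<Longrightarrow> g x = f x"
  shows "abelian_group_hom V Y g"
proof -
  interpret f: abelian_group_hom V Y f by fact
  show ?thesis
    by (rule abelian_group_hom_intro)
       (auto simp: assms(2) intro: f.G.abelian_group_axioms f.H.abelian_group_axioms)
qed

lemma abelian_group_hom_add: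
  assumes "abelian_group_hom V Y f" "abelian_group_hom V Y g"
  shows "abelian_group_hom V Y (\<lambda>x. f x \<oplus>\<^bsub>Y\<^esub> g x)"
proof -
  interpret f: abelian_group_hom V Y f by fact
  interpret g: abelian_group_hom V Y g by fact
  show ?thesis
    by (rule abelian_group_hom_intro)
       (auto simp: f.H.a_ac intro: f.G.abelian_group_axioms f.H.abelian_group_axioms)
qed

text \<open>Being an abelian group and being additive depend only on the additive part of a record.\<close>

lemma abelian_group_cong:
  assumes "abelian_group M" "carrier M' = carrier M" "add M' = add M" "\<zero>\<^bsub>M'\<^esub> = \<zero>\<^bsub>M\<^esub>"
  shows "abelian_group M'"
proof -
  interpret abelian_group M by fact
  show ?thesis
    by (rule abelian_groupI) (auto simp: assms(2-) a_ac intro: add.l_inv_ex)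
qed

lemma abelian_group_hom_change:
  assumes "abelian_group_hom V Y f"
    and "carrier V' = carrier V" "add V' = add V" "\<zero>\<^bsub>V'\<^esub> = \<zero>\<^bsub>V\<^esub>"
    and "carrier Y' = carrier Y" "add Y' = add Y" "\<zero>\<^bsub>Y'\<^esub> = \<zero>\<^bsub>Y\<^esub>"
  shows "abelian_group_hom V' Y' f"
proof -
  interpret f: abelian_group_hom V Y f by fact
  have "abelian_group V'" by (rule abelian_group_cong[OF f.G.abelian_group_axioms assms(2-4)])
  moreover have "abelian_group Y'" by (rule abelian_group_cong[OF f.H.abelian_group_axioms assms(5-7)])
  ultimately show ?thesis
    by (rule abelian_group_hom_intro) (simp_all add: assms(2-))
qed

section \<open>The universal property of the tensor product\<close>

text \<open>The extension of \<open>f\<close> to the free abelian group, in the closed form that \<^const>\<open>tensor_lift\<close>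
  evaluates. Enlarging the index set of the product by points of multiplicity zero does not change
  it, so the products for two elements and for their sum can be taken over a common index set.\<close>

lemma (in comm_group) finprod_keys_hom:
  fixes f :: "'c \<Rightarrow> 'a"
  assumes f: "f \<in> S \<rightarrow> carrier G"
  shows "(\<lambda>c. finprod G (\<lambda>x. f x [^] Poly_Mapping.lookup c x) (Poly_Mapping.keys c))
    \<in> hom (free_Abelian_group S) G"
proof (rule homI)
  let ?h = "\<lambda>c. finprod G (\<lambda>x. f x [^] Poly_Mapping.lookup c x) (Poly_Mapping.keys c)"
  have ext: "?h c = finprod G (\<lambda>x. f x [^] Poly_Mapping.lookup c x) U"
    if "Poly_Mapping.keys c \<subseteq> U" "U \<subseteq> S" "finite U" for c :: "'c \<Rightarrow>\<^sub>0 int" and U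
    using that f by (intro finprod_mono_neutral_cong_left) (auto simp: in_keys_iff)
  fix c d assume "c \<in> carrier (free_Abelian_group S)" "d \<in> carrier (free_Abelian_group S)"
  then have cd: "Poly_Mapping.keys c \<subseteq> S" "Poly_Mapping.keys d \<subseteq> S" by auto
  define U where "U = Poly_Mapping.keys c \<union> Poly_Mapping.keys d"
  have U: "U \<subseteq> S" "finite U" "Poly_Mapping.keys c \<subseteq> U" "Poly_Mapping.keys d \<subseteq> U"
    "Poly_Mapping.keys (c + d) \<subseteq> U"
    using cd keys_add[of c d] by (auto simp: U_def)
  have fU: "f \<in> U \<rightarrow> carrier G" using f U(1) by auto
  have "?h (c + d) = finprod G (\<lambda>x. f x [^] Poly_Mapping.lookup c x \<otimes> f x [^] Poly_Mapping.lookup d x) U"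
    unfolding ext[OF U(5,1,2)]
    using fU by (intro finprod_cong) (auto simp: lookup_add int_pow_mult simp_implies_def Pi_iff)
  also have "\<dots> = ?h c \<otimes> ?h d"
    unfolding ext[OF U(3,1,2)] ext[OF U(4,1,2)]
    using fU by (intro finprod_multf) auto
  finally show "?h (c \<otimes>\<^bsub>free_Abelian_group S\<^esub> d) = ?h c \<otimes> ?h d" by simp
qed (use f in \<open>auto intro!: finprod_closed\<close>)

lemma (in comm_group) finprod_keys_frag_of:
  assumes "f x \<in> carrier G"
  shows "finprod G (\<lambda>y. f y [^] Poly_Mapping.lookup (frag_of x) y) (Poly_Mapping.keys (frag_of x)) = f x"
  using assms by simp

locale tensor_pair = M: abelian_group M + N: abelian_group N
  for B :: "'b set" and M :: "('r, 'b, 'm) bimodule" and N :: "('b, 's, 'n) bimodule" +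
  assumes ract_scalar: "\<lbrakk>m \<in> carrier M; b \<in> B\<rbrakk> \<Longrightarrow> ract M m b \<in> carrier M"
    and lact_scalar: "\<lbrakk>b \<in> B; n \<in> carrier N\<rbrakk> \<Longrightarrow> lact N b n \<in> carrier N"

text \<open>Both variables are required to be additive in the bundled sense of
  \<^locale>\<open>abelian_group_hom\<close>, so that additivity is propagated by composition without side
  conditions on carriers.\<close>

locale balanced_map = tensor_pair B M N + Y: abelian_group Y
  for B :: "'b set" and M :: "('r, 'b, 'm) bimodule" and N :: "('b, 's, 'n) bimodule"
    and Y :: "('y, 'z) ring_scheme" and f :: "'m \<Rightarrow> 'n \<Rightarrow> 'y" +
  assumes hom_left: "n \<in> carrier N \<Longrightarrow> abelian_group_hom M Y (\<lambda>m. f m n)"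
    and hom_right: "m \<in> carrier M \<Longrightarrow> abelian_group_hom N Y (f m)"
    and balanced: "\<lbrakk>m \<in> carrier M; b \<in> B; n \<in> carrier N\<rbrakk> \<Longrightarrow> f (ract M m b) n = f m (lact N b n)"

lemma balanced_mapI:
  assumes "tensor_pair B M N" "abelian_group Y"
    and "\<And>n. n \<in> carrier N \<Longrightarrow> abelian_group_hom M Y (\<lambda>m. f m n)"
    and "\<And>m. m \<in> carrier M \<Longrightarrow> abelian_group_hom N Y (f m)"
    and "\<And>m b n. \<lbrakk>m \<in> carrier M; b \<in> B; n \<in> carrier N\<rbrakk> \<Longrightarrow> f (ract M m b) n = f m (lact N b n)"
  shows "balanced_map B M N Y f"
  using assms by (intro balanced_map.intro balanced_map_axioms.intro) auto

lemma (in balanced_map) closed: "\<lbrakk>m \<in> carrier M; n \<in> carrier N\<rbrakk> \<Longrightarrow> f m n \<in> carrier Y"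
  using abelian_group_hom.hom_closed[OF hom_right] .

lemma balanced_map_cong:
  assumes f: "balanced_map B M N Y f"
    and eq: "\<And>m n. \<lbrakk>m \<in> carrier M; n \<in> carrier N\<rbrakk> \<Longrightarrow> g m n = f m n"
  shows "balanced_map B M N Y g"
proof -
  interpret f: balanced_map B M N Y f by fact
  show ?thesis
    by (rule balanced_mapI)
       (auto simp: eq f.balanced f.ract_scalar f.lact_scalar
         intro: f.tensor_pair_axioms f.Y.abelian_group_axioms abelian_group_hom_cong[OF f.hom_left]
           abelian_group_hom_cong[OF f.hom_right])
qed

lemma tensor_simps:
  "carrier (tensor B M N) = carrier (tensor_group B M N)"
  "add (tensor B M N) = monoid.mult (tensor_group B M N)"
  "\<zero>\<^bsub>tensor B M N\<^esub> = \<one>\<^bsub>tensor_group B M N\<^esub>"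
  by (simp_all add: tensor_def)

text \<open>The value of \<^const>\<open>tensor_lift\<close> depends only on the group operation of its target. This makes
  the multiplicative and the additive presentation of a tensor product interchangeable, and likewise
  different module structures on one abelian group.\<close>

lemma tensor_lift_cong_group:
  assumes "carrier G = carrier G'" "monoid.mult G = monoid.mult G'" "\<one>\<^bsub>G\<^esub> = \<one>\<^bsub>G'\<^esub>"
  shows "tensor_lift G f u = tensor_lift G' f u"
proof -
  have p: "x [^]\<^bsub>G\<^esub> (k::int) = x [^]\<^bsub>G'\<^esub> k" for x k
    using assms by (simp add: int_pow_def nat_pow_def m_inv_def Let_def)
  show ?thesis
    unfolding tensor_lift_def finprod_def p using assms by simp
qed

lemma tensor_lift_tensor_group:
  "tensor_lift (tensor_group B M N) = tensor_lift (add_monoid (tensor B M N))"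
  by (intro ext tensor_lift_cong_group) (simp_all add: tensor_simps)

context tensor_pair
begin

abbreviation F where "F \<equiv> free_Abelian_group (carrier M \<times> carrier N)"

lemma frag_diff_carrier:
  "c \<in> carrier F \<Longrightarrow> d \<in> carrier F \<Longrightarrow> c - d \<in> carrier F"
  using keys_diff[of c d] by auto

lemma frag_add_carrier:
  "c \<in> carrier F \<Longrightarrow> d \<in> carrier F \<Longrightarrow> c + d \<in> carrier F"
  using keys_add[of c d] by auto

lemma relations_subset: "tensor_relations B M N \<subseteq> carrier F"
  unfolding tensor_relations_def
  by (auto simp del: carrier_free_Abelian_group_iff intro!: frag_diff_carrier ract_scalar lact_scalar)

lemma null_subgroup: "subgroup (tensor_null B M N) F"
  unfolding tensor_null_def
  by (rule group.generate_is_subgroup) (simp_all only: group_free_Abelian_group relations_subset)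

lemma null_normal: "tensor_null B M N \<lhd> F"
  by (rule comm_group.subgroup_imp_normal[OF abelian_free_Abelian_group null_subgroup])

lemma relations_null: "r \<in> tensor_relations B M N \<Longrightarrow> r \<in> tensor_null B M N"
  unfolding tensor_null_def by (rule generate.incl)

lemma tensor_group_comm: "comm_group (tensor_group B M N)"
  unfolding tensor_group_def
  by (rule comm_group.abelian_FactGroup[OF abelian_free_Abelian_group null_subgroup])

lemma tensor_abelian: "abelian_group (tensor B M N)"
proof (rule comm_group_abelian_groupI)
  interpret T: comm_group "tensor_group B M N" by (rule tensor_group_comm)
  show "comm_group (add_monoid (tensor B M N))"
    by (rule comm_groupI) (auto simp: tensor_simps T.m_ac intro: T.l_inv_ex)
qed

abbreviation cls where "cls c \<equiv> tensor_null B M N #>\<^bsub>F\<^esub> c"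

lemma cls_add:
  "\<lbrakk>c \<in> carrier F; d \<in> carrier F\<rbrakk> \<Longrightarrow> cls c \<oplus>\<^bsub>tensor B M N\<^esub> cls d = cls (c + d)"
  using normal.rcos_sum[OF null_normal, of c d]
  by (simp add: tensor_simps tensor_group_def FactGroup_def del: carrier_free_Abelian_group_iff)

lemma carrier_tensor: "carrier (tensor B M N) = cls ` carrier F"
  by (auto simp: tensor_simps tensor_group_def FactGroup_def RCOSETS_def
    simp del: carrier_free_Abelian_group_iff)

lemma cls_eq: 
  assumes "c \<in> carrier F" "d \<in> carrier F" "c - d \<in> tensor_null B M N"
  shows "cls c = cls d"
proof -
  have "c = (c - d) \<otimes>\<^bsub>F\<^esub> d" by simp
  then have "c \<in> cls d" using assms(3) unfolding r_coset_def by blast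
  then show ?thesis
    using group.repr_independence[OF group_free_Abelian_group _ assms(2) null_subgroup] by blast
qed

lemma cls_hom: "(\<lambda>c. cls c) \<in> hom F (add_monoid (tensor B M N))"
  by (rule homI) (auto simp: carrier_tensor cls_add simp del: carrier_free_Abelian_group_iff)

lemma pure_closed: "\<lbrakk>m \<in> carrier M; n \<in> carrier N\<rbrakk> \<Longrightarrow> pure_tensor B M N m n \<in> carrier (tensor B M N)"
  unfolding pure_tensor_def carrier_tensor by simp

lemma pure_balanced: "balanced_map B M N (tensor B M N) (pure_tensor B M N)"
proof (rule balanced_mapI[OF tensor_pair_axioms tensor_abelian])
  fix n assume n: "n \<in> carrier N"
  show "abelian_group_hom M (tensor B M N) (\<lambda>m. pure_tensor B M N m n)"
  proof (rule abelian_group_hom_intro[OF M.abelian_group_axioms tensor_abelian])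
    fix m m' assume m: "m \<in> carrier M" "m' \<in> carrier M"
    have r: "frag_of (m \<oplus>\<^bsub>M\<^esub> m', n) - frag_of (m, n) - frag_of (m', n) \<in> tensor_null B M N"
      by (rule relations_null) (use m n in \<open>auto simp: tensor_relations_def\<close>)
    have "cls (frag_of (m \<oplus>\<^bsub>M\<^esub> m', n)) = cls (frag_of (m, n) + frag_of (m', n))"
      by (rule cls_eq[OF _ frag_add_carrier]) (use m n r in \<open>auto simp: diff_diff_eq\<close>)
    also have "\<dots> = cls (frag_of (m, n)) \<oplus>\<^bsub>tensor B M N\<^esub> cls (frag_of (m', n))"
      by (rule cls_add[symmetric]) (use m n in auto)
    finally show "pure_tensor B M N (m \<oplus>\<^bsub>M\<^esub> m') n
        = pure_tensor B M N m n \<oplus>\<^bsub>tensor B M N\<^esub> pure_tensor B M N m' n"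
      unfolding pure_tensor_def .
  qed (use n pure_closed in auto)
next
  fix m assume m: "m \<in> carrier M"
  show "abelian_group_hom N (tensor B M N) (pure_tensor B M N m)"
  proof (rule abelian_group_hom_intro[OF N.abelian_group_axioms tensor_abelian])
    fix n n' assume n: "n \<in> carrier N" "n' \<in> carrier N"
    have r: "frag_of (m, n \<oplus>\<^bsub>N\<^esub> n') - frag_of (m, n) - frag_of (m, n') \<in> tensor_null B M N"
      by (rule relations_null) (use m n in \<open>auto simp: tensor_relations_def\<close>)
    have "cls (frag_of (m, n \<oplus>\<^bsub>N\<^esub> n')) = cls (frag_of (m, n) + frag_of (m, n'))"
      by (rule cls_eq[OF _ frag_add_carrier]) (use m n r in \<open>auto simp: diff_diff_eq\<close>)
    also have "\<dots> = cls (frag_of (m, n)) \<oplus>\<^bsub>tensor B M N\<^esub> cls (frag_of (m, n'))"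
      by (rule cls_add[symmetric]) (use m n in auto)
    finally show "pure_tensor B M N m (n \<oplus>\<^bsub>N\<^esub> n')
        = pure_tensor B M N m n \<oplus>\<^bsub>tensor B M N\<^esub> pure_tensor B M N m n'"
      unfolding pure_tensor_def .
  qed (use m pure_closed in auto)
next
  fix m b n assume mbn: "m \<in> carrier M" "b \<in> B" "n \<in> carrier N"
  have r: "frag_of (ract M m b, n) - frag_of (m, lact N b n) \<in> tensor_null B M N"
    by (rule relations_null) (use mbn in \<open>auto simp: tensor_relations_def\<close>)
  show "pure_tensor B M N (ract M m b) n = pure_tensor B M N m (lact N b n)"
    unfolding pure_tensor_def
    by (rule cls_eq) (use mbn r ract_scalar lact_scalar in auto)
qed

text \<open>The uniqueness half of the universal property: the cosets of the generators of the free
  abelian group are the pure tensors.\<close>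

lemma tensor_hom_eqI:
  assumes f: "abelian_group_hom (tensor B M N) Y f" and g: "abelian_group_hom (tensor B M N) Y g"
    and eq: "\<And>m n. \<lbrakk>m \<in> carrier M; n \<in> carrier N\<rbrakk>
      \<Longrightarrow> f (pure_tensor B M N m n) = g (pure_tensor B M N m n)"
    and u: "u \<in> carrier (tensor B M N)"
  shows "f u = g u"
proof -
  interpret f: abelian_group_hom "tensor B M N" Y f by fact
  interpret g: abelian_group_hom "tensor B M N" Y g by fact
  have gh: "group_hom F (add_monoid Y) (\<lambda>c. k (cls c))"
    if "abelian_group_hom (tensor B M N) Y k" for k
  proof -
    interpret k: abelian_group_hom "tensor B M N" Y k by fact
    show ?thesis
      using cls_hom by (intro group_hom.intro group_hom_axioms.intro)
        (auto simp: f.H.a_group hom_def Pi_iff simp del: carrier_free_Abelian_group_iff)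
  qed
  interpret fF: group_hom F "add_monoid Y" "\<lambda>c. f (cls c)" by (rule gh[OF f])
  interpret gF: group_hom F "add_monoid Y" "\<lambda>c. g (cls c)" by (rule gh[OF g])
  obtain c where c: "c \<in> carrier F" "u = cls c" using u carrier_tensor by blast
  have "Poly_Mapping.keys c \<subseteq> carrier M \<times> carrier N" using c(1) by simp
  then have "f (cls c) = g (cls c)"
  proof (rule free_Abelian_group_induct)
    show "f (cls 0) = g (cls 0)" using fF.hom_one gF.hom_one by simp
  next
    fix x y :: "'m \<times> 'n \<Rightarrow>\<^sub>0 int"
    assume k: "Poly_Mapping.keys x \<subseteq> carrier M \<times> carrier N" "Poly_Mapping.keys y \<subseteq> carrier M \<times> carrier N"
      and IH: "f (cls x) = g (cls x)" "f (cls y) = g (cls y)"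
    have xy: "x - y = x \<otimes>\<^bsub>F\<^esub> inv\<^bsub>F\<^esub> y" using k(2) by simp
    have mem: "x \<in> carrier F" "y \<in> carrier F" using k by auto
    have mem': "inv\<^bsub>F\<^esub> y \<in> carrier F" by (rule fF.G.inv_closed[OF mem(2)])
    show "f (cls (x - y)) = g (cls (x - y))"
      unfolding xy fF.hom_mult[OF mem(1) mem'] gF.hom_mult[OF mem(1) mem']
        fF.hom_inv[OF mem(2)] gF.hom_inv[OF mem(2)] IH ..
  next
    fix a assume "a \<in> carrier M \<times> carrier N"
    then show "f (cls (frag_of a)) = g (cls (frag_of a))"
      using eq[of "fst a" "snd a"] by (auto simp: pure_tensor_def)
  qed
  then show ?thesis using c by simp
qed

end

context balanced_map
begin

text \<open>The existence half of the universal property. The extension of \<open>f\<close> to the free abelian group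
  kills the defining relations because \<open>f\<close> is balanced, hence the subgroup generated by them, and is
  therefore constant on the cosets that form the tensor product.\<close>

lemma lift:
  "abelian_group_hom (tensor B M N) Y (tensor_lift (add_monoid Y) f)"
  "\<lbrakk>m \<in> carrier M; n \<in> carrier N\<rbrakk> \<Longrightarrow> tensor_lift (add_monoid Y) f (pure_tensor B M N m n) = f m n"
proof -
  define P where "P = add_monoid Y"
  have P: "carrier P = carrier Y" "monoid.mult P = add Y" by (simp_all add: P_def)
  interpret P: comm_group P unfolding P_def by (rule Y.a_comm_group)
  interpret T: abelian_group "tensor B M N" by (rule tensor_abelian)
  define e where "e c = finprod P (\<lambda>(m, n). f m n [^]\<^bsub>P\<^esub> Poly_Mapping.lookup c (m, n))
                (Poly_Mapping.keys c)"
    for c :: "'m \<times> 'n \<Rightarrow>\<^sub>0 int"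
  have e': "e c = finprod P (\<lambda>x. (\<lambda>(m, n). f m n) x [^]\<^bsub>P\<^esub> Poly_Mapping.lookup c x)
                (Poly_Mapping.keys c)" for c
    unfolding e_def by (rule arg_cong[where f = "\<lambda>g. finprod P g _"]) auto
  have "e \<in> hom F P"
    unfolding e' by (rule P.finprod_keys_hom) (auto simp: closed P)
  then interpret e: group_hom F P e
    by (intro group_hom.intro group_hom_axioms.intro) (auto simp: P.is_group)
  have e_of: "e (frag_of (m, n)) = f m n" if "m \<in> carrier M" "n \<in> carrier N" for m n
    unfolding e' by (subst P.finprod_keys_frag_of) (use that closed P in auto)
  have e_diff: "e (c - d) = e c \<otimes>\<^bsub>P\<^esub> inv\<^bsub>P\<^esub> e d" if "c \<in> carrier F" "d \<in> carrier F" for c d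
  proof -
    have "c - d = c \<otimes>\<^bsub>F\<^esub> inv\<^bsub>F\<^esub> d" using that by simp
    then show ?thesis using that e.hom_mult e.hom_inv e.G.inv_closed by metis
  qed
  have e_null: "e r = \<one>\<^bsub>P\<^esub>" if "r \<in> tensor_null B M N" for r
  proof -
    have cancel: "a \<otimes>\<^bsub>P\<^esub> inv\<^bsub>P\<^esub> b \<otimes>\<^bsub>P\<^esub> inv\<^bsub>P\<^esub> c = \<one>\<^bsub>P\<^esub>"
      if "a = b \<otimes>\<^bsub>P\<^esub> c" "b \<in> carrier P" "c \<in> carrier P" for a b c
      
    proof -
      have "inv\<^bsub>P\<^esub> b \<otimes>\<^bsub>P\<^esub> inv\<^bsub>P\<^esub> c = inv\<^bsub>P\<^esub> a"
        using that by (simp add: P.inv_mult_group[symmetric] P.m_comm)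
      moreover have "a \<in> carrier P" using that by simp
      ultimately show ?thesis using that(2,3) by (simp add: P.m_assoc)
    qed
    have "e x = \<one>\<^bsub>P\<^esub>" if x: "x \<in> tensor_relations B M N" for x
    proof -
      have ofF: "frag_of (m, n) \<in> carrier F" if "m \<in> carrier M" "n \<in> carrier N" for m n
        using that by simp
      consider (l) m m' n where "m \<in> carrier M" "m' \<in> carrier M" "n \<in> carrier N"
          "x = frag_of (m \<oplus>\<^bsub>M\<^esub> m', n) - frag_of (m, n) - frag_of (m', n)"
        | (r) m n n' where "m \<in> carrier M" "n \<in> carrier N" "n' \<in> carrier N"
          "x = frag_of (m, n \<oplus>\<^bsub>N\<^esub> n') - frag_of (m, n) - frag_of (m, n')"
        | (b) m b n where "m \<in> carrier M" "b \<in> B" "n \<in> carrier N"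
          "x = frag_of (ract M m b, n) - frag_of (m, lact N b n)"
        using x unfolding tensor_relations_def by (elim UnE CollectE exE conjE) metis+
      then show ?thesis
      proof cases
        case l
        have "e x = f (m \<oplus>\<^bsub>M\<^esub> m') n \<otimes>\<^bsub>P\<^esub> inv\<^bsub>P\<^esub> f m n \<otimes>\<^bsub>P\<^esub> inv\<^bsub>P\<^esub> f m' n"
          unfolding l(4) using l(1-3) 
          by (simp only: e_diff frag_diff_carrier ofF e_of M.a_closed)
        also have "\<dots> = \<one>\<^bsub>P\<^esub>"
          by (rule cancel) (use l closed abelian_group_hom.hom_add[OF hom_left[OF l(3)] l(1,2)] in \<open>simp_all add: P\<close>)
        finally show ?thesis .
      next
        case r
        have "e x = f m (n \<oplus>\<^bsub>N\<^esub> n') \<otimes>\<^bsub>P\<^esub> inv\<^bsub>P\<^esub> f m n \<otimes>\<^bsub>P\<^esub> inv\<^bsub>P\<^esub> f m n'"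
          unfolding r(4) using r(1-3) 
          by (simp only: e_diff frag_diff_carrier ofF e_of N.a_closed)
        also have "\<dots> = \<one>\<^bsub>P\<^esub>"
          by (rule cancel) (use r closed abelian_group_hom.hom_add[OF hom_right[OF r(1)] r(2,3)] in \<open>simp_all add: P\<close>)
        finally show ?thesis .
      next
        case b
        have "e x = f (ract M m b) n \<otimes>\<^bsub>P\<^esub> inv\<^bsub>P\<^esub> f m (lact N b n)"
          unfolding b(4) using b(1-3) 
          by (simp only: e_diff ofF e_of ract_scalar lact_scalar)
        also have "\<dots> = \<one>\<^bsub>P\<^esub>"
          unfolding balanced[OF b(1-3)] by (rule P.r_inv) (use b closed lact_scalar in \<open>auto simp: P\<close>)
        finally show ?thesis .
      qed
    qed
    then have "tensor_relations B M N \<subseteq> kernel F P e"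
      using relations_subset by (auto simp: kernel_def simp del: carrier_free_Abelian_group_iff)
    then have "tensor_null B M N \<subseteq> kernel F P e"
      unfolding tensor_null_def by (rule e.G.generate_subgroup_incl[OF _ e.subgroup_kernel])
    then show ?thesis using that by (auto simp: kernel_def)
  qed
  \<comment> \<open>The image of a coset under \<open>e\<close> is a singleton, so \<^const>\<open>the_elem\<close> in \<^const>\<open>tensor_lift\<close> is meaningful.\<close>
  have lift: "tensor_lift P f (cls c) = e c" if c: "c \<in> carrier F" for c
  proof -
    have "e d = e c" if d: "d \<in> cls c" for d
    proof -
      obtain r where r: "r \<in> tensor_null B M N" "d = r \<otimes>\<^bsub>F\<^esub> c"
        using d unfolding r_coset_def by blast
      have "r \<in> carrier F" using r(1) null_subgroup subgroup.subset by blast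
      then have "e d = e r \<otimes>\<^bsub>P\<^esub> e c" unfolding r(2) by (rule e.hom_mult[OF _ c])
      then show ?thesis using e_null[OF r(1)] e.hom_closed[OF c] by simp
    qed
    moreover have "c \<in> cls c" 
      using group.rcos_self[OF group_free_Abelian_group c null_subgroup] .
    ultimately have "e ` cls c = {e c}" by blast
    then show ?thesis unfolding tensor_lift_def e_def by simp
  qed
  show "abelian_group_hom (tensor B M N) Y (tensor_lift (add_monoid Y) f)"
    unfolding P_def[symmetric]
  proof (rule abelian_group_hom_intro[OF tensor_abelian Y.abelian_group_axioms])
    fix u v assume "u \<in> carrier (tensor B M N)" "v \<in> carrier (tensor B M N)"
    then obtain c d where cd: "c \<in> carrier F" "u = cls c" "d \<in> carrier F" "v = cls d"
      unfolding carrier_tensor by blast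
    show "tensor_lift P f u \<in> carrier Y" using e.hom_closed cd lift by (simp add: P)
    show "tensor_lift P f (u \<oplus>\<^bsub>tensor B M N\<^esub> v) = tensor_lift P f u \<oplus>\<^bsub>Y\<^esub> tensor_lift P f v"
      using e.hom_mult[OF cd(1,3)]
      by (simp only: cd cls_add lift frag_add_carrier mult_free_Abelian_group P)
  qed
  show "tensor_lift (add_monoid Y) f (pure_tensor B M N m n) = f m n"
    if "m \<in> carrier M" "n \<in> carrier N"
    unfolding P_def[symmetric] pure_tensor_def using that by (subst lift) (auto simp: e_of)
qed

lemmas lift_hom = lift(1) and lift_pure = lift(2)

end

text \<open>For nested lifts: the lift of \<open>F x\<close> is additive in the parameter \<open>x\<close> as soon as this holds on
  pure tensors, because both sides of the additivity equation are additive in \<open>u\<close>.\<close>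

lemma tensor_lift_param_hom:
  assumes V: "abelian_group V" and tp: "tensor_pair B M N"
    and bal: "\<And>x. x \<in> carrier V \<Longrightarrow> balanced_map B M N Y (F x)"
    and hom: "\<And>m n. \<lbrakk>m \<in> carrier M; n \<in> carrier N\<rbrakk> \<Longrightarrow> abelian_group_hom V Y (\<lambda>x. F x m n)"
    and u: "u \<in> carrier (tensor B M N)"
  shows "abelian_group_hom V Y (\<lambda>x. tensor_lift (add_monoid Y) (F x) u)"
proof -
  interpret V: abelian_group V by fact
  interpret tensor_pair B M N by fact
  have lh: "abelian_group_hom (tensor B M N) Y (tensor_lift (add_monoid Y) (F x))"
    if "x \<in> carrier V" for x
    using balanced_map.lift_hom[OF bal[OF that]] .
  have Y: "abelian_group Y" using lh[OF V.zero_closed] by (rule abelian_group_hom.axioms(2))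
  show ?thesis
  proof (rule abelian_group_hom_intro[OF V Y])
    fix x assume "x \<in> carrier V"
    then show "tensor_lift (add_monoid Y) (F x) u \<in> carrier Y"
      using abelian_group_hom.hom_closed[OF lh u] by blast
  next
    fix x x' assume x: "x \<in> carrier V" "x' \<in> carrier V"
    show "tensor_lift (add_monoid Y) (F (x \<oplus>\<^bsub>V\<^esub> x')) u
        = tensor_lift (add_monoid Y) (F x) u \<oplus>\<^bsub>Y\<^esub> tensor_lift (add_monoid Y) (F x') u"
    proof (rule tensor_hom_eqI[OF lh[OF V.a_closed[OF x]] abelian_group_hom_add[OF lh[OF x(1)] lh[OF x(2)]] _ u])
      fix m n assume mn: "m \<in> carrier M" "n \<in> carrier N"
      show "tensor_lift (add_monoid Y) (F (x \<oplus>\<^bsub>V\<^esub> x')) (pure_tensor B M N m n)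
        = tensor_lift (add_monoid Y) (F x) (pure_tensor B M N m n)
          \<oplus>\<^bsub>Y\<^esub> tensor_lift (add_monoid Y) (F x') (pure_tensor B M N m n)"
        using abelian_group_hom.hom_add[OF hom[OF mn] x]
        by (simp add: balanced_map.lift_pure[OF bal] mn x)
    qed
  qed
qed

section \<open>Tensor products of bimodules\<close>

text \<open>The source and the target share only the ring acting on one side. This is the generality that
  \<^const>\<open>tensor_map\<close> needs: the left multiplications of a bimodule, which define the left action on a
  tensor product, are right linear but in general not left linear.\<close>

definition right_linear :: "'b set \<Rightarrow> ('r, 'b, 'm) bimodule \<Rightarrow> ('t, 'b, 'n) bimodule \<Rightarrow> ('m \<Rightarrow> 'n) \<Rightarrow> bool"
  where "right_linear B M N f \<longleftrightarrow> abelian_group_hom M N f \<and>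
    (\<forall>m\<in>carrier M. \<forall>b\<in>B. f (ract M m b) = ract N (f m) b)"

definition left_linear :: "'b set \<Rightarrow> ('b, 's, 'm) bimodule \<Rightarrow> ('b, 't, 'n) bimodule \<Rightarrow> ('m \<Rightarrow> 'n) \<Rightarrow> bool"
  where "left_linear B M N f \<longleftrightarrow> abelian_group_hom M N f \<and>
    (\<forall>b\<in>B. \<forall>m\<in>carrier M. f (lact M b m) = lact N b (f m))"

lemma tensor_map_balanced:
  assumes M: "tensor_pair B M N" and M': "tensor_pair B M' N'"
    and f: "right_linear B M M' f" and g: "left_linear B N N' g"
  shows "balanced_map B M N (tensor B M' N') (\<lambda>m n. pure_tensor B M' N' (f m) (g n))"
proof -
  interpret M: tensor_pair B M N by fact
  interpret M': tensor_pair B M' N' by fact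
  interpret P: balanced_map B M' N' "tensor B M' N'" "pure_tensor B M' N'"
    by (rule M'.pure_balanced)
  interpret f: abelian_group_hom M M' f using f by (simp add: right_linear_def)
  interpret g: abelian_group_hom N N' g using g by (simp add: left_linear_def)
  show ?thesis
  proof (rule balanced_mapI[OF M P.Y.abelian_group_axioms])
    show "abelian_group_hom M (tensor B M' N') (\<lambda>m. pure_tensor B M' N' (f m) (g n))"
      if "n \<in> carrier N" for n
      by (rule abelian_group_hom_compose[OF P.hom_left f.is_abelian_group_hom]) (simp add: that)
    show "abelian_group_hom N (tensor B M' N') (\<lambda>n. pure_tensor B M' N' (f m) (g n))"
      if "m \<in> carrier M" for m
      by (rule abelian_group_hom_compose[OF P.hom_right g.is_abelian_group_hom]) (simp add: that)
    show "pure_tensor B M' N' (f (ract M m b)) (g n) = pure_tensor B M' N' (f m) (g (lact N b n))"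
      if "m \<in> carrier M" "b \<in> B" "n \<in> carrier N" for m b n
      using that f g by (simp add: right_linear_def left_linear_def P.balanced)
  qed
qed

lemma tensor_map_hom:
  assumes "tensor_pair B M N" "tensor_pair B M' N'" "right_linear B M M' f" "left_linear B N N' g"
  shows "abelian_group_hom (tensor B M N) (tensor B M' N') (tensor_map B M' N' f g)"
  unfolding tensor_map_def tensor_lift_tensor_group
  by (rule balanced_map.lift_hom[OF tensor_map_balanced[OF assms]])

lemma tensor_map_pure:
  assumes "tensor_pair B M N" "tensor_pair B M' N'" "right_linear B M M' f" "left_linear B N N' g"
    and "m \<in> carrier M" "n \<in> carrier N"
  shows "tensor_map B M' N' f g (pure_tensor B M N m n) = pure_tensor B M' N' (f m) (g n)"
  unfolding tensor_map_def tensor_lift_tensor_group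
  using assms(5,6) by (rule balanced_map.lift_pure[OF tensor_map_balanced[OF assms(1-4)]])

lemma tensor_map_inverse:
  assumes C: "tensor_pair B M N" and D: "tensor_pair B M' N'"
    and f: "right_linear B M M' f" and g: "left_linear B N N' g"
    and f': "right_linear B M' M f'" and g': "left_linear B N' N g'"
    and inv: "\<And>m. m \<in> carrier M \<Longrightarrow> f' (f m) = m" "\<And>n. n \<in> carrier N \<Longrightarrow> g' (g n) = n"
    and u: "u \<in> carrier (tensor B M N)"
  shows "tensor_map B M N f' g' (tensor_map B M' N' f g u) = u"
proof -
  interpret C: tensor_pair B M N by fact
  interpret f: abelian_group_hom M M' f using f by (simp add: right_linear_def)
  interpret g: abelian_group_hom N N' g using g by (simp add: left_linear_def)
  show ?thesis
    by (rule C.tensor_hom_eqI[OF abelian_group_hom_compose[OF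
          tensor_map_hom[OF D C f' g'] tensor_map_hom[OF C D f g]] abelian_group_hom_id _ u])
       (auto simp: tensor_map_pure[OF C D f g] tensor_map_pure[OF D C f' g'] inv intro: C.tensor_abelian)
qed

context bimodule
begin

lemma lact_hom: "r \<in> carrier R \<Longrightarrow> abelian_group_hom M M (lact M r)"
  by (rule abelian_group_hom_intro) (auto intro: M.abelian_group_axioms lact_closed lact_r_distr)

lemma ract_hom: "s \<in> carrier S \<Longrightarrow> abelian_group_hom M M (\<lambda>m. ract M m s)"
  by (rule abelian_group_hom_intro) (auto intro: M.abelian_group_axioms ract_closed ract_l_distr)

lemma lact_scalar_hom: "m \<in> carrier M \<Longrightarrow> abelian_group_hom R M (\<lambda>r. lact M r m)"
  by (rule abelian_group_hom_intro)
     (auto intro: M.abelian_group_axioms R.abelian_group_axioms lact_closed lact_l_distr)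

lemma ract_scalar_hom: "m \<in> carrier M \<Longrightarrow> abelian_group_hom S M (ract M m)"
  by (rule abelian_group_hom_intro)
     (auto intro: M.abelian_group_axioms S.abelian_group_axioms ract_closed ract_r_distr)

end

lemma bimodule_tensor_pair:
  assumes "bimodule R B M" "bimodule B S N" "T \<subseteq> carrier B"
  shows "tensor_pair T M N"
proof -
  interpret M: bimodule R B M by fact
  interpret N: bimodule B S N by fact
  show ?thesis using assms(3) by unfold_locales (auto intro: M.ract_closed N.lact_closed)
qed

text \<open>The scalars \<open>T\<close> over which the tensor product is formed need not exhaust the ring \<open>B\<close>: the
  canonical coring uses \<open>A \<otimes>\<^sub>T A\<close> for the coinvariants \<open>T\<close>, with the actions of all of \<open>A\<close>.\<close>

locale bimodule_pair = M: bimodule R B M + N: bimodule B S N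
  for R :: "('r, 'x) ring_scheme" and B :: "('b, 'y) ring_scheme" and S :: "('s, 'z) ring_scheme"
    and M :: "('r, 'b, 'm) bimodule" and N :: "('b, 's, 'n) bimodule" +
  fixes T :: "'b set"
  assumes scalars: "T \<subseteq> carrier B"
begin

sublocale tensor_pair T M N
  by (rule bimodule_tensor_pair[OF M.bimodule_axioms N.bimodule_axioms scalars])

lemma lact_right_linear: "r \<in> carrier R \<Longrightarrow> right_linear T M M (lact M r)"
  using scalars unfolding right_linear_def by (auto simp: M.lact_hom M.lact_ract)

lemma ract_left_linear: "s \<in> carrier S \<Longrightarrow> left_linear T N N (\<lambda>n. ract N n s)"
  using scalars unfolding left_linear_def by (auto simp: N.ract_hom N.lact_ract)

lemma id_right_linear: "right_linear T M M (\<lambda>m. m)"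
  unfolding right_linear_def by (auto intro: abelian_group_hom_id M.M.abelian_group_axioms)

lemma id_left_linear: "left_linear T N N (\<lambda>n. n)"
  unfolding left_linear_def by (auto intro: abelian_group_hom_id N.M.abelian_group_axioms)

lemma tensor_lact_hom:
  "r \<in> carrier R \<Longrightarrow> abelian_group_hom (tensor T M N) (tensor T M N) (lact (tensor T M N) r)"
  using tensor_map_hom[OF tensor_pair_axioms tensor_pair_axioms lact_right_linear id_left_linear]
  by (simp add: tensor_def)

lemma tensor_ract_hom:
  "s \<in> carrier S \<Longrightarrow> abelian_group_hom (tensor T M N) (tensor T M N) (\<lambda>u. ract (tensor T M N) u s)"
  using tensor_map_hom[OF tensor_pair_axioms tensor_pair_axioms id_right_linear ract_left_linear]
  by (simp add: tensor_def)

lemma lact_pure: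
  "\<lbrakk>r \<in> carrier R; m \<in> carrier M; n \<in> carrier N\<rbrakk>
    \<Longrightarrow> lact (tensor T M N) r (pure_tensor T M N m n) = pure_tensor T M N (lact M r m) n"
  using tensor_map_pure[OF tensor_pair_axioms tensor_pair_axioms lact_right_linear id_left_linear]
  by (simp add: tensor_def)

lemma ract_pure:
  "\<lbrakk>s \<in> carrier S; m \<in> carrier M; n \<in> carrier N\<rbrakk>
    \<Longrightarrow> ract (tensor T M N) (pure_tensor T M N m n) s = pure_tensor T M N m (ract N n s)"
  using tensor_map_pure[OF tensor_pair_axioms tensor_pair_axioms id_right_linear ract_left_linear]
  by (simp add: tensor_def)

sublocale pure: balanced_map T M N "tensor T M N" "pure_tensor T M N"
  by (rule pure_balanced)

theorem tensor_bimodule: "bimodule R S (tensor T M N)"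
proof -
  let ?T = "tensor T M N"
  let ?p = "pure_tensor T M N"
  note l = abelian_group_hom.hom_closed[OF tensor_lact_hom] and r = abelian_group_hom.hom_closed[OF tensor_ract_hom]
  note closed = M.lact_closed N.ract_closed
  show ?thesis
  proof (intro bimodule.intro bimodule_axioms.intro)
    show "ring R" "ring S" "abelian_group ?T" by unfold_locales
    fix a b u v assume u: "u \<in> carrier ?T"
    {
      assume a: "a \<in> carrier R"
      show "lact ?T a u \<in> carrier ?T" by (rule l[OF a u])
      show "lact ?T a (u \<oplus>\<^bsub>?T\<^esub> v) = lact ?T a u \<oplus>\<^bsub>?T\<^esub> lact ?T a v" if "v \<in> carrier ?T"
        by (rule abelian_group_hom.hom_add[OF tensor_lact_hom[OF a] u that])
      assume b: "b \<in> carrier R"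
      show "lact ?T (a \<oplus>\<^bsub>R\<^esub> b) u = lact ?T a u \<oplus>\<^bsub>?T\<^esub> lact ?T b u"
        by (rule tensor_hom_eqI[OF _ _ _ u, where Y = ?T])
           (auto simp: a b lact_pure closed M.lact_l_distr abelian_group_hom.hom_add[OF pure.hom_left]
             intro!: tensor_lact_hom abelian_group_hom_add)
      show "lact ?T (a \<otimes>\<^bsub>R\<^esub> b) u = lact ?T a (lact ?T b u)"
        by (rule tensor_hom_eqI[OF _ _ _ u, where Y = ?T])
           (auto simp: a b lact_pure closed M.lact_assoc
             intro!: tensor_lact_hom abelian_group_hom_compose[OF tensor_lact_hom tensor_lact_hom])
    next
      show "lact ?T \<one>\<^bsub>R\<^esub> u = u"
        by (rule tensor_hom_eqI[OF tensor_lact_hom abelian_group_hom_id _ u])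
           (auto simp: lact_pure M.lact_one intro: tensor_abelian)
    next
      show "ract ?T u \<one>\<^bsub>S\<^esub> = u"
        by (rule tensor_hom_eqI[OF tensor_ract_hom abelian_group_hom_id _ u])
           (auto simp: ract_pure N.ract_one intro: tensor_abelian)
    }
    {
      fix a b assume a: "a \<in> carrier S"
      show "ract ?T u a \<in> carrier ?T" by (rule r[OF a u])
      show "ract ?T (u \<oplus>\<^bsub>?T\<^esub> v) a = ract ?T u a \<oplus>\<^bsub>?T\<^esub> ract ?T v a" if "v \<in> carrier ?T"
        by (rule abelian_group_hom.hom_add[OF tensor_ract_hom[OF a] u that])
      assume b: "b \<in> carrier S"
      show "ract ?T u (a \<oplus>\<^bsub>S\<^esub> b) = ract ?T u a \<oplus>\<^bsub>?T\<^esub> ract ?T u b"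
        by (rule tensor_hom_eqI[OF _ _ _ u, where Y = ?T])
           (auto simp: a b ract_pure closed N.ract_r_distr abelian_group_hom.hom_add[OF pure.hom_right]
             intro!: tensor_ract_hom abelian_group_hom_add)
      show "ract ?T u (a \<otimes>\<^bsub>S\<^esub> b) = ract ?T (ract ?T u a) b"
        by (rule tensor_hom_eqI[OF _ _ _ u, where Y = ?T])
           (auto simp: a b ract_pure closed N.ract_assoc
             intro!: tensor_ract_hom abelian_group_hom_compose[OF tensor_ract_hom tensor_ract_hom])
    }
    {
      fix a b assume a: "a \<in> carrier R" and b: "b \<in> carrier S"
      show "ract ?T (lact ?T a u) b = lact ?T a (ract ?T u b)"
        by (rule tensor_hom_eqI[OF _ _ _ u, where Y = ?T])
           (auto simp: a b lact_pure ract_pure closed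
             intro!: abelian_group_hom_compose[OF tensor_ract_hom tensor_lact_hom]
               abelian_group_hom_compose[OF tensor_lact_hom tensor_ract_hom])
    }
  qed
qed

end

lemma bimodule_pairI:
  "\<lbrakk>bimodule R B M; bimodule B S N; T \<subseteq> carrier B\<rbrakk> \<Longrightarrow> bimodule_pair R B S M N T"
  by (intro bimodule_pair.intro bimodule_pair_axioms.intro)

lemma regular_bimodule_simps [simp]:
  "carrier (regular_bimodule R) = carrier R" "add (regular_bimodule R) = add R"
  "\<zero>\<^bsub>regular_bimodule R\<^esub> = \<zero>\<^bsub>R\<^esub>"
  "lact (regular_bimodule R) = monoid.mult R" "ract (regular_bimodule R) = monoid.mult R"
  by (simp_all add: regular_bimodule_def)

lemma symmetric_bimodule_simps [simp]:
  "carrier (symmetric_bimodule M) = carrier M" "add (symmetric_bimodule M) = add M"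
  "\<zero>\<^bsub>symmetric_bimodule M\<^esub> = \<zero>\<^bsub>M\<^esub>"
  "lact (symmetric_bimodule M) = smult M" "ract (symmetric_bimodule M) = (\<lambda>m r. r \<odot>\<^bsub>M\<^esub> m)"
  by (simp_all add: symmetric_bimodule_def)

lemma regular_bimodule_is_bimodule:
  assumes "ring R" shows "bimodule R R (regular_bimodule R)"
proof -
  interpret R: ring R by fact
  show ?thesis
  proof (intro bimodule.intro bimodule_axioms.intro)
    show "abelian_group (regular_bimodule R)"
      by (rule abelian_group_cong[OF R.is_abelian_group]) simp_all
  qed (auto simp: R.m_assoc R.l_distr R.r_distr intro: assms)
qed

lemma symmetric_bimodule_is_bimodule:
  assumes "module K M" shows "bimodule K K (symmetric_bimodule M)"
proof -
  interpret module K M by fact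
  show ?thesis
  proof (intro bimodule.intro bimodule_axioms.intro)
    show "abelian_group (symmetric_bimodule M)"
      by (rule abelian_group_cong[OF M.abelian_group_axioms]) simp_all
  qed (auto simp: smult_l_distr smult_r_distr smult_assoc1[symmetric] R.m_comm intro: R.ring_axioms)
qed

locale bimodule_triple = L: bimodule R B L + M: bimodule B C M + N: bimodule C S N
  for R :: "('r, 'x) ring_scheme" and B :: "('b, 'y) ring_scheme" and C :: "('c, 'z) ring_scheme"
    and S :: "('s, 'w) ring_scheme"
    and L :: "('r, 'b, 'l) bimodule" and M :: "('b, 'c, 'm) bimodule" and N :: "('c, 's, 'n) bimodule"
begin

sublocale LM: bimodule_pair R B C L M "carrier B" by unfold_locales simp
sublocale MN: bimodule_pair B C S M N "carrier C" by unfold_locales simp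

sublocale LM_N: bimodule_pair R C S "tensor (carrier B) L M" N "carrier C"
  by (rule bimodule_pairI[OF LM.tensor_bimodule N.bimodule_axioms subset_refl])

sublocale L_MN: bimodule_pair R B S L "tensor (carrier C) M N" "carrier B"
  by (rule bimodule_pairI[OF L.bimodule_axioms MN.tensor_bimodule subset_refl])

abbreviation MN where "MN \<equiv> tensor (carrier C) M N"
abbreviation L_MN where "L_MN \<equiv> tensor (carrier B) L MN"

lemma assoc_inner_balanced:
  assumes n: "n \<in> carrier N"
  shows "balanced_map (carrier B) L M L_MN
    (\<lambda>l m. pure_tensor (carrier B) L MN l (pure_tensor (carrier C) M N m n))"
proof (rule balanced_mapI[OF LM.tensor_pair_axioms L_MN.tensor_abelian])
  fix m assume "m \<in> carrier M"
  then show "abelian_group_hom L L_MN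
      (\<lambda>l. pure_tensor (carrier B) L MN l (pure_tensor (carrier C) M N m n))"
    using n by (intro L_MN.pure.hom_left MN.pure_closed)
next
  fix l assume "l \<in> carrier L"
  then show "abelian_group_hom M L_MN
      (\<lambda>m. pure_tensor (carrier B) L MN l (pure_tensor (carrier C) M N m n))"
    using n by (intro abelian_group_hom_compose[OF L_MN.pure.hom_right MN.pure.hom_left])
next
  fix l b m assume "l \<in> carrier L" "b \<in> carrier B" "m \<in> carrier M"
  then show "pure_tensor (carrier B) L MN (ract L l b) (pure_tensor (carrier C) M N m n)
      = pure_tensor (carrier B) L MN l (pure_tensor (carrier C) M N (lact M b m) n)"
    using n by (simp add: L_MN.pure.balanced MN.pure_closed MN.lact_pure)
qed

lemma assoc_outer_balanced:
  "balanced_map (carrier C) (tensor (carrier B) L M) N L_MN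
    (\<lambda>u n. tensor_lift (add_monoid L_MN)
      (\<lambda>l m. pure_tensor (carrier B) L MN l (pure_tensor (carrier C) M N m n)) u)"
proof (rule balanced_mapI[OF LM_N.tensor_pair_axioms L_MN.tensor_abelian])
  fix n assume "n \<in> carrier N"
  then show "abelian_group_hom (tensor (carrier B) L M) L_MN
      (tensor_lift (add_monoid L_MN)
        (\<lambda>l m. pure_tensor (carrier B) L MN l (pure_tensor (carrier C) M N m n)))"
    by (rule balanced_map.lift_hom[OF assoc_inner_balanced])
next
  fix u assume "u \<in> carrier (tensor (carrier B) L M)"
  then show "abelian_group_hom N L_MN
      (\<lambda>n. tensor_lift (add_monoid L_MN)
        (\<lambda>l m. pure_tensor (carrier B) L MN l (pure_tensor (carrier C) M N m n)) u)"
    by (intro tensor_lift_param_hom[OF N.M.abelian_group_axioms LM.tensor_pair_axioms]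
        assoc_inner_balanced abelian_group_hom_compose[OF L_MN.pure.hom_right MN.pure.hom_right])
next
  fix u c n assume u: "u \<in> carrier (tensor (carrier B) L M)" and c: "c \<in> carrier C" "n \<in> carrier N"
  show "tensor_lift (add_monoid L_MN)
        (\<lambda>l m. pure_tensor (carrier B) L MN l (pure_tensor (carrier C) M N m n))
        (ract (tensor (carrier B) L M) u c)
      = tensor_lift (add_monoid L_MN)
        (\<lambda>l m. pure_tensor (carrier B) L MN l (pure_tensor (carrier C) M N m (lact N c n))) u"
    by (rule LM.tensor_hom_eqI[OF abelian_group_hom_compose[OF
          balanced_map.lift_hom[OF assoc_inner_balanced] LM.tensor_ract_hom]
          balanced_map.lift_hom[OF assoc_inner_balanced] _ u])
       (simp_all add: c balanced_map.lift_pure[OF assoc_inner_balanced] N.lact_closed M.ract_closed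
          LM.ract_pure MN.pure.balanced)
qed

lemma tensor_assoc_hom:
  "abelian_group_hom (tensor (carrier C) (tensor (carrier B) L M) N) L_MN
    (tensor_assoc (carrier B) (carrier C) L M N)"
  unfolding tensor_assoc_def Let_def tensor_lift_tensor_group
  by (rule balanced_map.lift_hom[OF assoc_outer_balanced])

text \<open>Only the second factor is pure here; this form is what allows the first factor to be a
  comultiplied or coacted element.\<close>

lemma tensor_assoc_pure:
  assumes "u \<in> carrier (tensor (carrier B) L M)" "n \<in> carrier N"
  shows "tensor_assoc (carrier B) (carrier C) L M N
      (pure_tensor (carrier C) (tensor (carrier B) L M) N u n)
    = tensor_lift (add_monoid L_MN)
        (\<lambda>l m. pure_tensor (carrier B) L MN l (pure_tensor (carrier C) M N m n)) u"
  unfolding tensor_assoc_def Let_def tensor_lift_tensor_group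
  by (rule balanced_map.lift_pure[OF assoc_outer_balanced assms])

lemma tensor_assoc_pure_pure:
  assumes "l \<in> carrier L" "m \<in> carrier M" "n \<in> carrier N"
  shows "tensor_assoc (carrier B) (carrier C) L M N
      (pure_tensor (carrier C) (tensor (carrier B) L M) N (pure_tensor (carrier B) L M l m) n)
    = pure_tensor (carrier B) L MN l (pure_tensor (carrier C) M N m n)"
  using assms by (simp add: tensor_assoc_pure LM.pure_closed balanced_map.lift_pure[OF assoc_inner_balanced])

end

context bimodule
begin

lemma unit_right_balanced: "balanced_map (carrier S) M (regular_bimodule S) M (ract M)"
proof (rule balanced_mapI)
  have S: "bimodule S S (regular_bimodule S)"
    by (rule regular_bimodule_is_bimodule) (rule S.ring_axioms)
  show "tensor_pair (carrier S) M (regular_bimodule S)"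
    by (rule bimodule_tensor_pair[OF bimodule_axioms S subset_refl])
  show "abelian_group_hom (regular_bimodule S) M (ract M m)" if "m \<in> carrier M" for m
    by (rule abelian_group_hom_intro)
       (use that S in \<open>auto simp: bimodule_def ract_closed ract_r_distr intro: M.abelian_group_axioms\<close>)
qed (auto intro: M.abelian_group_axioms ract_hom simp: ract_assoc)

lemma unit_left_balanced: "balanced_map (carrier R) (regular_bimodule R) M M (lact M)"
proof (rule balanced_mapI)
  have R: "bimodule R R (regular_bimodule R)"
    by (rule regular_bimodule_is_bimodule) (rule R.ring_axioms)
  show "tensor_pair (carrier R) (regular_bimodule R) M"
    by (rule bimodule_tensor_pair[OF R bimodule_axioms subset_refl])
  show "abelian_group_hom (regular_bimodule R) M (\<lambda>r. lact M r m)" if "m \<in> carrier M" for m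
    by (rule abelian_group_hom_intro)
       (use that R in \<open>auto simp: bimodule_def lact_closed lact_l_distr intro: M.abelian_group_axioms\<close>)
qed (auto intro: M.abelian_group_axioms lact_hom simp: lact_assoc)

lemma tensor_unit_right_hom:
  "abelian_group_hom (tensor (carrier S) M (regular_bimodule S)) M (tensor_unit_right M)"
  unfolding tensor_unit_right_def by (rule balanced_map.lift_hom[OF unit_right_balanced])

lemma tensor_unit_right_pure:
  "\<lbrakk>m \<in> carrier M; s \<in> carrier S\<rbrakk>
    \<Longrightarrow> tensor_unit_right M (pure_tensor (carrier S) M (regular_bimodule S) m s) = ract M m s"
  unfolding tensor_unit_right_def by (rule balanced_map.lift_pure[OF unit_right_balanced]) auto

lemma tensor_unit_left_hom:
  "abelian_group_hom (tensor (carrier R) (regular_bimodule R) M) M (tensor_unit_left M)"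
  unfolding tensor_unit_left_def by (rule balanced_map.lift_hom[OF unit_left_balanced])

lemma tensor_unit_left_pure:
  "\<lbrakk>m \<in> carrier M; r \<in> carrier R\<rbrakk>
    \<Longrightarrow> tensor_unit_left M (pure_tensor (carrier R) (regular_bimodule R) M r m) = lact M r m"
  unfolding tensor_unit_left_def by (rule balanced_map.lift_pure[OF unit_left_balanced]) auto

end

lemma bimodule_hom_is_hom:
  assumes "bimodule R S M" "bimodule R S N" "f \<in> bimodule_hom R S M N"
  shows "abelian_group_hom M N f"
    "right_linear (carrier S) M N f" "left_linear (carrier R) M N f"
proof -
  interpret M: bimodule R S M by fact
  interpret N: bimodule R S N by fact
  show f: "abelian_group_hom M N f"
    using assms(3) by (intro abelian_group_hom_intro)
      (auto simp: bimodule_hom_def intro: M.M.abelian_group_axioms N.M.abelian_group_axioms)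
  show "right_linear (carrier S) M N f" "left_linear (carrier R) M N f"
    using f assms(3) by (auto simp: right_linear_def left_linear_def bimodule_hom_def)
qed

section \<open>Galois corings and bijective canonical maps\<close>

lemma bimodule_hom_inverse:
  assumes M: "bimodule R S M" and f: "f \<in> bimodule_hom R S M N" and bij: "bij_betw f (carrier M) (carrier N)"
  shows "the_inv_into (carrier M) f \<in> bimodule_hom R S N M"
proof -
  interpret M: bimodule R S M by fact
  let ?g = "the_inv_into (carrier M) f"
  have inj: "inj_on f (carrier M)" and onto: "f ` carrier M = carrier N"
    using bij by (auto simp: bij_betw_def)
  have g: "?g (f m) = m" if "m \<in> carrier M" for m by (rule the_inv_into_f_f[OF inj that])
  have mem: "?g n \<in> carrier M" "f (?g n) = n" if "n \<in> carrier N" for n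
    using that the_inv_into_into[OF inj _ subset_refl] f_the_inv_into_f[OF inj] onto by auto
  have fh: "f (m \<oplus>\<^bsub>M\<^esub> m') = f m \<oplus>\<^bsub>N\<^esub> f m'" "r \<in> carrier R \<Longrightarrow> f (lact M r m) = lact N r (f m)"
    "s \<in> carrier S \<Longrightarrow> f (ract M m s) = ract N (f m) s" if "m \<in> carrier M" "m' \<in> carrier M" for m m' r s
    using f that by (auto simp: bimodule_hom_def)
  have "?g (n \<oplus>\<^bsub>N\<^esub> n') = ?g n \<oplus>\<^bsub>M\<^esub> ?g n'" if n: "n \<in> carrier N" "n' \<in> carrier N" for n n'
    using g[of "?g n \<oplus>\<^bsub>M\<^esub> ?g n'"] fh(1)[of "?g n" "?g n'"] mem n by simp
  moreover have "?g (lact N r n) = lact M r (?g n)" if n: "n \<in> carrier N" and r: "r \<in> carrier R" for n r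
    using g[of "lact M r (?g n)"] fh(2)[of "?g n" "?g n" r] mem n r M.lact_closed by simp
  moreover have "?g (ract N n s) = ract M (?g n) s" if n: "n \<in> carrier N" and s: "s \<in> carrier S" for n s
    using g[of "ract M (?g n) s"] fh(3)[of "?g n" "?g n" s] mem n s M.ract_closed by simp
  ultimately show ?thesis using mem(1) by (auto simp: bimodule_hom_def)
qed

text \<open>Given a morphism \<open>f\<close> with inverse family \<open>g\<close>, the compatibility of \<open>g\<close> with the
  comultiplications is obtained from that of \<open>f\<close> by applying \<open>g \<otimes> g\<close>, which is inverse to \<open>f \<otimes> f\<close>.\<close>

lemma group_coring_iso_iff_bij:
  assumes G: "group G"
    and C: "\<And>\<alpha>. \<alpha> \<in> carrier G \<Longrightarrow> bimodule A A (C \<alpha>)"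
    and D: "\<And>\<alpha>. \<alpha> \<in> carrier G \<Longrightarrow> bimodule A A (D \<alpha>)"
    and \<Delta>: "\<And>\<alpha> \<beta> c. \<lbrakk>\<alpha> \<in> carrier G; \<beta> \<in> carrier G; c \<in> carrier (C (\<alpha> \<otimes>\<^bsub>G\<^esub> \<beta>))\<rbrakk>
      \<Longrightarrow> \<Delta> \<alpha> \<beta> c \<in> carrier (tensor (carrier A) (C \<alpha>) (C \<beta>))"
    and f: "f \<in> group_coring_hom G A C \<Delta> \<epsilon> D \<Delta>' \<epsilon>'"
  shows "f \<in> group_coring_iso G A C \<Delta> \<epsilon> D \<Delta>' \<epsilon>'
    \<longleftrightarrow> (\<forall>\<alpha>\<in>carrier G. bij_betw (f \<alpha>) (carrier (C \<alpha>)) (carrier (D \<alpha>)))"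
proof
  assume "f \<in> group_coring_iso G A C \<Delta> \<epsilon> D \<Delta>' \<epsilon>'"
  then obtain g where g: "g \<in> group_coring_hom G A D \<Delta>' \<epsilon>' C \<Delta> \<epsilon>"
    and inv: "\<And>\<alpha>. \<alpha> \<in> carrier G \<Longrightarrow>
      (\<forall>c\<in>carrier (C \<alpha>). g \<alpha> (f \<alpha> c) = c) \<and> (\<forall>d\<in>carrier (D \<alpha>). f \<alpha> (g \<alpha> d) = d)"
    unfolding group_coring_iso_def by blast
  show "\<forall>\<alpha>\<in>carrier G. bij_betw (f \<alpha>) (carrier (C \<alpha>)) (carrier (D \<alpha>))"
  proof
    fix \<alpha> assume \<alpha>: "\<alpha> \<in> carrier G"
    have "f \<alpha> \<in> carrier (C \<alpha>) \<rightarrow> carrier (D \<alpha>)" "g \<alpha> \<in> carrier (D \<alpha>) \<rightarrow> carrier (C \<alpha>)"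
      using f g \<alpha> by (auto simp: group_coring_hom_def bimodule_hom_def)
    then show "bij_betw (f \<alpha>) (carrier (C \<alpha>)) (carrier (D \<alpha>))"
      using inv[OF \<alpha>] by (intro bij_betw_byWitness[where f' = "g \<alpha>"]) auto
  qed
next
  assume bij: "\<forall>\<alpha>\<in>carrier G. bij_betw (f \<alpha>) (carrier (C \<alpha>)) (carrier (D \<alpha>))"
  interpret G: group G by fact
  define g where "g \<alpha> = the_inv_into (carrier (C \<alpha>)) (f \<alpha>)" for \<alpha>
  have fh: "f \<alpha> \<in> bimodule_hom A A (C \<alpha>) (D \<alpha>)" if "\<alpha> \<in> carrier G" for \<alpha>
    using f that by (simp add: group_coring_hom_def)
  have gh: "g \<alpha> \<in> bimodule_hom A A (D \<alpha>) (C \<alpha>)" if "\<alpha> \<in> carrier G" for \<alpha>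
    unfolding g_def using bimodule_hom_inverse[OF C[OF that] fh[OF that]] bij that by blast
  have gf: "g \<alpha> (f \<alpha> c) = c" if "\<alpha> \<in> carrier G" "c \<in> carrier (C \<alpha>)" for \<alpha> c
    unfolding g_def using bij that by (intro the_inv_into_f_f) (auto simp: bij_betw_def)
  have fg: "f \<alpha> (g \<alpha> d) = d" if "\<alpha> \<in> carrier G" "d \<in> carrier (D \<alpha>)" for \<alpha> d
    unfolding g_def using bij that by (intro f_the_inv_into_f) (auto simp: bij_betw_def)
  have g_mem: "g \<alpha> d \<in> carrier (C \<alpha>)" if "\<alpha> \<in> carrier G" "d \<in> carrier (D \<alpha>)" for \<alpha> d
    using gh[OF that(1)] that(2) by (auto simp: bimodule_hom_def)
  have comult: "\<Delta> \<alpha> \<beta> (g (\<alpha> \<otimes>\<^bsub>G\<^esub> \<beta>) d) = tensor_map (carrier A) (C \<alpha>) (C \<beta>) (g \<alpha>) (g \<beta>) (\<Delta>' \<alpha> \<beta> d)"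
    if \<alpha>: "\<alpha> \<in> carrier G" and \<beta>: "\<beta> \<in> carrier G" and d: "d \<in> carrier (D (\<alpha> \<otimes>\<^bsub>G\<^esub> \<beta>))" for \<alpha> \<beta> d
  proof -
    let ?c = "g (\<alpha> \<otimes>\<^bsub>G\<^esub> \<beta>) d"
    have c: "?c \<in> carrier (C (\<alpha> \<otimes>\<^bsub>G\<^esub> \<beta>))" using g_mem d \<alpha> \<beta> by simp
    have "\<Delta>' \<alpha> \<beta> d = \<Delta>' \<alpha> \<beta> (f (\<alpha> \<otimes>\<^bsub>G\<^esub> \<beta>) ?c)" using fg d \<alpha> \<beta> by simp
    also have "\<dots> = tensor_map (carrier A) (D \<alpha>) (D \<beta>) (f \<alpha>) (f \<beta>) (\<Delta> \<alpha> \<beta> ?c)"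
      using f \<alpha> \<beta> c by (auto simp: group_coring_hom_def)
    finally show ?thesis
      using tensor_map_inverse[OF bimodule_tensor_pair[OF C[OF \<alpha>] C[OF \<beta>] subset_refl]
          bimodule_tensor_pair[OF D[OF \<alpha>] D[OF \<beta>] subset_refl]
          bimodule_hom_is_hom(2)[OF C[OF \<alpha>] D[OF \<alpha>] fh[OF \<alpha>]]
          bimodule_hom_is_hom(3)[OF C[OF \<beta>] D[OF \<beta>] fh[OF \<beta>]]
          bimodule_hom_is_hom(2)[OF D[OF \<alpha>] C[OF \<alpha>] gh[OF \<alpha>]]
          bimodule_hom_is_hom(3)[OF D[OF \<beta>] C[OF \<beta>] gh[OF \<beta>]]
          gf[OF \<alpha>] gf[OF \<beta>] \<Delta>[OF \<alpha> \<beta> c]]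
      by simp
  qed
  have "\<epsilon> (g \<one>\<^bsub>G\<^esub> d) = \<epsilon>' d" if d: "d \<in> carrier (D \<one>\<^bsub>G\<^esub>)" for d
  proof -
    have "\<epsilon>' (f \<one>\<^bsub>G\<^esub> (g \<one>\<^bsub>G\<^esub> d)) = \<epsilon> (g \<one>\<^bsub>G\<^esub> d)"
      using f g_mem[OF G.one_closed d] by (auto simp: group_coring_hom_def)
    then show ?thesis using fg[OF G.one_closed d] by simp
  qed
  with comult gh have "g \<in> group_coring_hom G A D \<Delta>' \<epsilon>' C \<Delta> \<epsilon>"
    by (auto simp: group_coring_hom_def)
  with f gf fg show "f \<in> group_coring_iso G A C \<Delta> \<epsilon> D \<Delta>' \<epsilon>'"
    unfolding group_coring_iso_def by blast
qed

locale grouplike_coring = group_coring G A C \<Delta> \<epsilon>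
  for G :: "('g, 'x) monoid_scheme" and A :: "('a, 'y) ring_scheme"
    and C :: "'g \<Rightarrow> ('a, 'a, 'c) bimodule"
    and \<Delta> :: "'g \<Rightarrow> 'g \<Rightarrow> 'c \<Rightarrow> ('c \<times> 'c \<Rightarrow>\<^sub>0 int) set"
    and \<epsilon> :: "'c \<Rightarrow> 'a" +
  fixes x :: "'g \<Rightarrow> 'c"
  assumes grouplike: "grouplike_family G A C \<Delta> \<epsilon> x"
begin

abbreviation T where "T \<equiv> coring_coinvariants G A C x"
abbreviation RA where "RA \<equiv> regular_bimodule A"
abbreviation ATA where "ATA \<equiv> tensor T RA RA"
abbreviation t where "t \<equiv> pure_tensor T RA RA"

lemma T_subset: "T \<subseteq> carrier A" by (auto simp: coring_coinvariants_def)

sublocale AT: bimodule_pair A A A RA RA T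
  by (rule bimodule_pairI[OF regular_bimodule_is_bimodule regular_bimodule_is_bimodule T_subset])
     (rule A.ring_axioms)+

lemma x_mem: "\<alpha> \<in> carrier G \<Longrightarrow> x \<alpha> \<in> carrier (C \<alpha>)"
  using grouplike by (simp add: grouplike_family_def)

text \<open>Balancedness over \<open>T\<close> is the definition of the coinvariants: \<open>(a s) x\<^sub>\<alpha> b = a (x\<^sub>\<alpha> s) b\<close>.\<close>

lemma can_balanced:
  assumes \<alpha>: "\<alpha> \<in> carrier G"
  shows "balanced_map T RA RA (C \<alpha>) (\<lambda>a b. ract (C \<alpha>) (lact (C \<alpha>) a (x \<alpha>)) b)"
proof -
  interpret C: bimodule A A "C \<alpha>" by (rule component_bimodule[OF \<alpha>])
  note x = x_mem[OF \<alpha>]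
  show ?thesis
  proof (rule balanced_mapI[OF AT.tensor_pair_axioms C.M.abelian_group_axioms])
    fix b assume "b \<in> carrier RA"
    then show "abelian_group_hom RA (C \<alpha>) (\<lambda>a. ract (C \<alpha>) (lact (C \<alpha>) a (x \<alpha>)) b)"
      using x by (intro abelian_group_hom_compose[OF C.ract_hom]
          abelian_group_hom_change[OF C.lact_scalar_hom]) auto
  next
    fix a assume "a \<in> carrier RA"
    then show "abelian_group_hom RA (C \<alpha>) (ract (C \<alpha>) (lact (C \<alpha>) a (x \<alpha>)))"
      using x by (intro abelian_group_hom_change[OF C.ract_scalar_hom] C.lact_closed) auto
  next
    fix a s b assume "a \<in> carrier RA" "s \<in> T" "b \<in> carrier RA"
    moreover from \<open>s \<in> T\<close> have "s \<in> carrier A" "lact (C \<alpha>) s (x \<alpha>) = ract (C \<alpha>) (x \<alpha>) s"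
      using \<alpha> by (auto simp: coring_coinvariants_def)
    ultimately show "ract (C \<alpha>) (lact (C \<alpha>) (ract RA a s) (x \<alpha>)) b
        = ract (C \<alpha>) (lact (C \<alpha>) a (x \<alpha>)) (lact RA s b)"
      using x by (simp add: C.lact_assoc C.lact_ract C.ract_assoc C.lact_closed C.ract_closed)
  qed
qed

lemma can_hom: "\<alpha> \<in> carrier G \<Longrightarrow> abelian_group_hom ATA (C \<alpha>) (coring_can C x \<alpha>)"
  unfolding coring_can_def by (rule balanced_map.lift_hom[OF can_balanced])

lemma can_pure:
  "\<lbrakk>\<alpha> \<in> carrier G; a \<in> carrier A; b \<in> carrier A\<rbrakk>
    \<Longrightarrow> coring_can C x \<alpha> (t a b) = ract (C \<alpha>) (lact (C \<alpha>) a (x \<alpha>)) b"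
  unfolding coring_can_def by (rule balanced_map.lift_pure[OF can_balanced]) auto

lemma can_bimodule_hom:
  assumes \<alpha>: "\<alpha> \<in> carrier G"
  shows "coring_can C x \<alpha> \<in> bimodule_hom A A ATA (C \<alpha>)"
proof -
  interpret C: bimodule A A "C \<alpha>" by (rule component_bimodule[OF \<alpha>])
  interpret can: abelian_group_hom ATA "C \<alpha>" "coring_can C x \<alpha>" by (rule can_hom[OF \<alpha>])
  note x = x_mem[OF \<alpha>] and ch = can_hom[OF \<alpha>]
  have "coring_can C x \<alpha> (lact ATA r u) = lact (C \<alpha>) r (coring_can C x \<alpha> u)"
    if r: "r \<in> carrier A" and u: "u \<in> carrier ATA" for r u
    by (rule AT.tensor_hom_eqI[OF abelian_group_hom_compose[OF ch AT.tensor_lact_hom]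
          abelian_group_hom_compose[OF C.lact_hom ch] _ u])
       (use r x \<alpha> in \<open>auto simp: AT.lact_pure can_pure C.lact_assoc C.lact_ract C.lact_closed\<close>)
  moreover have "coring_can C x \<alpha> (ract ATA u s) = ract (C \<alpha>) (coring_can C x \<alpha> u) s"
    if s: "s \<in> carrier A" and u: "u \<in> carrier ATA" for s u
    by (rule AT.tensor_hom_eqI[OF abelian_group_hom_compose[OF ch AT.tensor_ract_hom]
          abelian_group_hom_compose[OF C.ract_hom ch] _ u])
       (use s x \<alpha> in \<open>auto simp: AT.ract_pure can_pure C.ract_assoc C.lact_closed\<close>)
  ultimately show ?thesis by (auto simp: bimodule_hom_def)
qed

sublocale ATA2: bimodule_pair A A A ATA ATA "carrier A"
  by (rule bimodule_pairI[OF AT.tensor_bimodule AT.tensor_bimodule subset_refl])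

text \<open>The scalar moves along \<open>(a s \<otimes> 1) \<otimes>\<^sub>A (1 \<otimes> b) = (a \<otimes> 1) s \<otimes>\<^sub>A (1 \<otimes> b)
  = (a \<otimes> 1) \<otimes>\<^sub>A s (1 \<otimes> b) = (a \<otimes> 1) \<otimes>\<^sub>A (1 \<otimes> s b)\<close>.
  The outer steps use balancedness over \<open>T\<close>, the inner one balancedness over \<open>A\<close>.\<close>

lemma canonical_comult_balanced:
  "balanced_map T RA RA (tensor (carrier A) ATA ATA)
    (\<lambda>a b. pure_tensor (carrier A) ATA ATA (t a \<one>\<^bsub>A\<^esub>) (t \<one>\<^bsub>A\<^esub> b))"
proof (rule balanced_mapI[OF AT.tensor_pair_axioms ATA2.tensor_abelian])
  fix b assume "b \<in> carrier RA"
  then show "abelian_group_hom RA (tensor (carrier A) ATA ATA)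
      (\<lambda>a. pure_tensor (carrier A) ATA ATA (t a \<one>\<^bsub>A\<^esub>) (t \<one>\<^bsub>A\<^esub> b))"
    by (intro abelian_group_hom_compose[OF ATA2.pure.hom_left AT.pure.hom_left] AT.pure_closed) auto
next
  fix a assume "a \<in> carrier RA"
  then show "abelian_group_hom RA (tensor (carrier A) ATA ATA)
      (\<lambda>b. pure_tensor (carrier A) ATA ATA (t a \<one>\<^bsub>A\<^esub>) (t \<one>\<^bsub>A\<^esub> b))"
    by (intro abelian_group_hom_compose[OF ATA2.pure.hom_right AT.pure.hom_right] AT.pure_closed) auto
next
  fix a s b assume a: "a \<in> carrier RA" and s: "s \<in> T" and b: "b \<in> carrier RA"
  have sA: "s \<in> carrier A" using s T_subset by blast
  have "t (ract RA a s) \<one>\<^bsub>A\<^esub> = ract ATA (t a \<one>\<^bsub>A\<^esub>) s"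
    using AT.pure.balanced[of a s "\<one>\<^bsub>A\<^esub>"] a s sA by (simp add: AT.ract_pure)
  moreover have "t \<one>\<^bsub>A\<^esub> (lact RA s b) = lact ATA s (t \<one>\<^bsub>A\<^esub> b)"
    using AT.pure.balanced[of "\<one>\<^bsub>A\<^esub>" s b] b s sA by (simp add: AT.lact_pure)
  ultimately show "pure_tensor (carrier A) ATA ATA (t (ract RA a s) \<one>\<^bsub>A\<^esub>) (t \<one>\<^bsub>A\<^esub> b)
      = pure_tensor (carrier A) ATA ATA (t a \<one>\<^bsub>A\<^esub>) (t \<one>\<^bsub>A\<^esub> (lact RA s b))"
    using a b sA by (simp add: ATA2.pure.balanced AT.pure_closed)
qed

lemma canonical_comult_hom:
  "abelian_group_hom ATA (tensor (carrier A) ATA ATA) (canonical_comult A T \<alpha> \<beta>)"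
  unfolding canonical_comult_def canonical_coring_def Let_def tensor_lift_tensor_group
  by (rule balanced_map.lift_hom[OF canonical_comult_balanced])

lemma canonical_comult_pure:
  "\<lbrakk>a \<in> carrier A; b \<in> carrier A\<rbrakk> \<Longrightarrow> canonical_comult A T \<alpha> \<beta> (t a b)
    = pure_tensor (carrier A) ATA ATA (t a \<one>\<^bsub>A\<^esub>) (t \<one>\<^bsub>A\<^esub> b)"
  unfolding canonical_comult_def canonical_coring_def Let_def tensor_lift_tensor_group
  by (rule balanced_map.lift_pure[OF canonical_comult_balanced]) auto

lemma canonical_counit_balanced: "balanced_map T RA RA A (monoid.mult A)"
proof (rule balanced_mapI[OF AT.tensor_pair_axioms A.is_abelian_group])
  show "abelian_group_hom RA A (\<lambda>a. a \<otimes>\<^bsub>A\<^esub> b)" if "b \<in> carrier RA" for b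
    using that by (intro abelian_group_hom_intro AT.M.M.abelian_group_axioms A.is_abelian_group)
      (auto simp: A.l_distr)
  show "abelian_group_hom RA A (\<lambda>b. a \<otimes>\<^bsub>A\<^esub> b)" if "a \<in> carrier RA" for a
    using that by (intro abelian_group_hom_intro AT.M.M.abelian_group_axioms A.is_abelian_group)
      (auto simp: A.r_distr)
  show "ract RA a s \<otimes>\<^bsub>A\<^esub> b = a \<otimes>\<^bsub>A\<^esub> lact RA s b"
    if "a \<in> carrier RA" "s \<in> T" "b \<in> carrier RA" for a s b
    using that T_subset by (auto simp: A.m_assoc)
qed

text \<open>By bilinearity of the structure maps, \<open>\<Delta>(a x\<^sub>\<alpha>\<^sub>\<beta> b) = a (x\<^sub>\<alpha> \<otimes>\<^sub>A x\<^sub>\<beta>) b = (a x\<^sub>\<alpha>) \<otimes>\<^sub>A (x\<^sub>\<beta> b)\<close> and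
  \<open>\<epsilon>(a x\<^sub>e b) = a 1 b\<close>; these are the images of the canonical structure maps of \<open>a \<otimes> b\<close>.\<close>

lemma can_group_coring_hom:
  "coring_can C x \<in> group_coring_hom G A
    (canonical_coring A T) (canonical_comult A T) (canonical_counit A) C \<Delta> \<epsilon>"
proof -
  have comult: "\<Delta> \<alpha> \<beta> (coring_can C x (\<alpha> \<otimes>\<^bsub>G\<^esub> \<beta>) u)
      = tensor_map (carrier A) (C \<alpha>) (C \<beta>) (coring_can C x \<alpha>) (coring_can C x \<beta>)
          (canonical_comult A T \<alpha> \<beta> u)"
    if \<alpha>: "\<alpha> \<in> carrier G" and \<beta>: "\<beta> \<in> carrier G" and u: "u \<in> carrier ATA" for \<alpha> \<beta> u
  proof -
    interpret C\<alpha>: bimodule A A "C \<alpha>" by (rule component_bimodule[OF \<alpha>])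
    interpret C\<beta>: bimodule A A "C \<beta>" by (rule component_bimodule[OF \<beta>])
    interpret CC: bimodule_pair A A A "C \<alpha>" "C \<beta>" "carrier A" by unfold_locales simp
    have \<alpha>\<beta>: "\<alpha> \<otimes>\<^bsub>G\<^esub> \<beta> \<in> carrier G" using \<alpha> \<beta> by simp
    interpret C\<alpha>\<beta>: bimodule A A "C (\<alpha> \<otimes>\<^bsub>G\<^esub> \<beta>)" by (rule component_bimodule[OF \<alpha>\<beta>])
    note \<Delta> = bimodule_hom_is_hom(1)[OF C\<alpha>\<beta>.bimodule_axioms CC.tensor_bimodule comult_hom[OF \<alpha> \<beta>]]
    note tp = ATA2.tensor_pair_axioms CC.tensor_pair_axioms
    note can = bimodule_hom_is_hom(2)[OF AT.tensor_bimodule C\<alpha>.bimodule_axioms can_bimodule_hom[OF \<alpha>]]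
      bimodule_hom_is_hom(3)[OF AT.tensor_bimodule C\<beta>.bimodule_axioms can_bimodule_hom[OF \<beta>]]
    show ?thesis
    proof (rule AT.tensor_hom_eqI[OF abelian_group_hom_compose[OF \<Delta> can_hom[OF \<alpha>\<beta>]]
          abelian_group_hom_compose[OF tensor_map_hom[OF tp can] canonical_comult_hom] _ u])
      fix a b assume "a \<in> carrier RA" "b \<in> carrier RA"
      then have ab: "a \<in> carrier A" "b \<in> carrier A" by simp_all
      have "\<Delta> \<alpha> \<beta> (ract (C (\<alpha> \<otimes>\<^bsub>G\<^esub> \<beta>)) (lact (C (\<alpha> \<otimes>\<^bsub>G\<^esub> \<beta>)) a (x (\<alpha> \<otimes>\<^bsub>G\<^esub> \<beta>))) b)
          = ract (tensor (carrier A) (C \<alpha>) (C \<beta>))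
              (lact (tensor (carrier A) (C \<alpha>) (C \<beta>)) a (\<Delta> \<alpha> \<beta> (x (\<alpha> \<otimes>\<^bsub>G\<^esub> \<beta>)))) b"
        using comult_hom[OF \<alpha> \<beta>] ab x_mem[OF \<alpha>\<beta>] C\<alpha>\<beta>.lact_closed by (auto simp: bimodule_hom_def)
      also have "\<Delta> \<alpha> \<beta> (x (\<alpha> \<otimes>\<^bsub>G\<^esub> \<beta>)) = pure_tensor (carrier A) (C \<alpha>) (C \<beta>) (x \<alpha>) (x \<beta>)"
        using grouplike \<alpha> \<beta> by (simp add: grouplike_family_def)
      finally show "\<Delta> \<alpha> \<beta> (coring_can C x (\<alpha> \<otimes>\<^bsub>G\<^esub> \<beta>) (t a b))
          = tensor_map (carrier A) (C \<alpha>) (C \<beta>) (coring_can C x \<alpha>) (coring_can C x \<beta>)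
              (canonical_comult A T \<alpha> \<beta> (t a b))"
        using ab \<alpha> \<beta> x_mem C\<alpha>.lact_closed C\<beta>.ract_closed
        by (simp add: can_pure \<alpha>\<beta> canonical_comult_pure tensor_map_pure[OF tp can] AT.pure_closed
            CC.lact_pure CC.ract_pure C\<alpha>.ract_one C\<beta>.lact_one)
    qed
  qed
  have counit: "\<epsilon> (coring_can C x \<one>\<^bsub>G\<^esub> u) = canonical_counit A u" if u: "u \<in> carrier ATA" for u
  proof -
    interpret C: bimodule A A "C \<one>\<^bsub>G\<^esub>" by (rule component_bimodule) simp
    note \<epsilon> = bimodule_hom_is_hom(1)[OF C.bimodule_axioms AT.M.bimodule_axioms counit_hom]
    have \<epsilon>': "abelian_group_hom (C \<one>\<^bsub>G\<^esub>) A \<epsilon>"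
      by (rule abelian_group_hom_change[OF \<epsilon>]) simp_all
    have c: "abelian_group_hom ATA A (canonical_counit A)"
      unfolding canonical_counit_def by (rule balanced_map.lift_hom[OF canonical_counit_balanced])
    show ?thesis
    proof (rule AT.tensor_hom_eqI[OF abelian_group_hom_compose[OF \<epsilon>' can_hom] c _ u])
      fix a b assume "a \<in> carrier RA" "b \<in> carrier RA"
      then have ab: "a \<in> carrier A" "b \<in> carrier A" by simp_all
      have "canonical_counit A (t a b) = a \<otimes>\<^bsub>A\<^esub> b"
        unfolding canonical_counit_def
        by (rule balanced_map.lift_pure[OF canonical_counit_balanced]) (simp_all add: ab)
      moreover have "\<epsilon> (ract (C \<one>\<^bsub>G\<^esub>) (lact (C \<one>\<^bsub>G\<^esub>) a (x \<one>\<^bsub>G\<^esub>)) b) = a \<otimes>\<^bsub>A\<^esub> \<epsilon> (x \<one>\<^bsub>G\<^esub>) \<otimes>\<^bsub>A\<^esub> b"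
        using counit_hom ab x_mem C.lact_closed by (auto simp: bimodule_hom_def)
      moreover have "\<epsilon> (x \<one>\<^bsub>G\<^esub>) = \<one>\<^bsub>A\<^esub>" using grouplike by (simp add: grouplike_family_def)
      ultimately show "\<epsilon> (coring_can C x \<one>\<^bsub>G\<^esub> (t a b)) = canonical_counit A (t a b)"
        using ab by (simp add: can_pure)
    qed simp
  qed
  show ?thesis
    using can_bimodule_hom comult counit by (auto simp: group_coring_hom_def canonical_coring_def)
qed

theorem galois_iff_bij_can:
  "galois_group_coring G A C \<Delta> \<epsilon> x
    \<longleftrightarrow> (\<forall>\<alpha>\<in>carrier G. bij_betw (coring_can C x \<alpha>) (carrier ATA) (carrier (C \<alpha>)))"
proof -
  have "coring_can C x \<in> group_coring_iso G A
      (canonical_coring A T) (canonical_comult A T) (canonical_counit A) C \<Delta> \<epsilon>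
    \<longleftrightarrow> (\<forall>\<alpha>\<in>carrier G. bij_betw (coring_can C x \<alpha>) (carrier (canonical_coring A T \<alpha>)) (carrier (C \<alpha>)))"
    using abelian_group_hom.hom_closed[OF canonical_comult_hom]
    by (intro group_coring_iso_iff_bij G.group_axioms component_bimodule can_group_coring_hom)
       (simp_all add: canonical_coring_def AT.tensor_bimodule)
  then show ?thesis
    using group_coring_axioms grouplike
    by (simp add: galois_group_coring_def Let_def canonical_coring_def)
qed

end

section \<open>Tensor products of algebras\<close>

lemma (in k_algebra) mult_left_hom:
  "a \<in> carrier A \<Longrightarrow> abelian_group_hom (symmetric_bimodule A) (symmetric_bimodule A) (\<lambda>b. a \<otimes>\<^bsub>A\<^esub> b)"
  by (rule abelian_group_hom_intro)
     (auto simp: A.r_distr intro: abelian_group_cong[OF A.is_abelian_group])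

lemma (in k_algebra) mult_right_hom:
  "a \<in> carrier A \<Longrightarrow> abelian_group_hom (symmetric_bimodule A) (symmetric_bimodule A) (\<lambda>b. b \<otimes>\<^bsub>A\<^esub> a)"
  by (rule abelian_group_hom_intro)
     (auto simp: A.l_distr intro: abelian_group_cong[OF A.is_abelian_group])

locale k_algebra_pair = M: k_algebra K M + N: k_algebra K N
  for K :: "('k, 'x) ring_scheme" and M :: "('k, 'm) module" and N :: "('k, 'n) module"
begin

abbreviation MN where "MN \<equiv> k_tensor K M N"
abbreviation pr where "pr \<equiv> k_pure_tensor K M N"
abbreviation mul where "mul \<equiv> k_tensor_mult K M N"

sublocale T: bimodule_pair K K K "symmetric_bimodule M" "symmetric_bimodule N" "carrier K"
  by (intro bimodule_pairI symmetric_bimodule_is_bimodule M.module_axioms N.module_axioms subset_refl)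

lemma pr_closed: "\<lbrakk>m \<in> carrier M; n \<in> carrier N\<rbrakk> \<Longrightarrow> pr m n \<in> carrier MN"
  by (rule T.pure_closed) simp_all

lemma pr_balanced:
  "\<lbrakk>k \<in> carrier K; m \<in> carrier M; n \<in> carrier N\<rbrakk> \<Longrightarrow> pr (k \<odot>\<^bsub>M\<^esub> m) n = pr m (k \<odot>\<^bsub>N\<^esub> n)"
  using T.pure.balanced[of m k n] by simp

lemma pr_hom_left: "n \<in> carrier N \<Longrightarrow> abelian_group_hom (symmetric_bimodule M) MN (\<lambda>m. pr m n)"
  by (rule T.pure.hom_left) simp

lemma pr_hom_right: "m \<in> carrier M \<Longrightarrow> abelian_group_hom (symmetric_bimodule N) MN (pr m)"
  by (rule T.pure.hom_right) simp

lemma pr_smult: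
  "\<lbrakk>k \<in> carrier K; m \<in> carrier M; n \<in> carrier N\<rbrakk> \<Longrightarrow> lact MN k (pr m n) = pr (k \<odot>\<^bsub>M\<^esub> m) n"
  by (simp add: T.lact_pure)

lemma hom_eqI:
  assumes "abelian_group_hom MN Y f" "abelian_group_hom MN Y g"
    and "\<And>m n. \<lbrakk>m \<in> carrier M; n \<in> carrier N\<rbrakk> \<Longrightarrow> f (pr m n) = g (pr m n)"
    and "u \<in> carrier MN"
  shows "f u = g u"
  by (rule T.tensor_hom_eqI[OF assms(1,2) _ assms(4)]) (simp add: assms(3))

lemma mul_inner_balanced:
  assumes "m \<in> carrier M" "n \<in> carrier N"
  shows "balanced_map (carrier K) (symmetric_bimodule M) (symmetric_bimodule N) MN
    (\<lambda>m' n'. pr (m \<otimes>\<^bsub>M\<^esub> m') (n \<otimes>\<^bsub>N\<^esub> n'))"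
proof (rule balanced_mapI[OF T.tensor_pair_axioms T.tensor_abelian])
  show "abelian_group_hom (symmetric_bimodule M) MN (\<lambda>m'. pr (m \<otimes>\<^bsub>M\<^esub> m') (n \<otimes>\<^bsub>N\<^esub> n'))"
    if "n' \<in> carrier (symmetric_bimodule N)" for n'
    using that assms by (intro abelian_group_hom_compose[OF pr_hom_left M.mult_left_hom]) auto
  show "abelian_group_hom (symmetric_bimodule N) MN (\<lambda>n'. pr (m \<otimes>\<^bsub>M\<^esub> m') (n \<otimes>\<^bsub>N\<^esub> n'))"
    if "m' \<in> carrier (symmetric_bimodule M)" for m'
    using that assms by (intro abelian_group_hom_compose[OF pr_hom_right N.mult_left_hom]) auto
qed (use assms in \<open>simp add: M.smult_mult_right N.smult_mult_right pr_balanced\<close>)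

lemma mul_outer_balanced:
  assumes v: "v \<in> carrier MN"
  shows "balanced_map (carrier K) (symmetric_bimodule M) (symmetric_bimodule N) MN
    (\<lambda>m n. tensor_lift (add_monoid MN) (\<lambda>m' n'. pr (m \<otimes>\<^bsub>M\<^esub> m') (n \<otimes>\<^bsub>N\<^esub> n')) v)"
proof (rule balanced_mapI[OF T.tensor_pair_axioms T.tensor_abelian])
  show "abelian_group_hom (symmetric_bimodule M) MN
      (\<lambda>m. tensor_lift (add_monoid MN) (\<lambda>m' n'. pr (m \<otimes>\<^bsub>M\<^esub> m') (n \<otimes>\<^bsub>N\<^esub> n')) v)"
    if "n \<in> carrier (symmetric_bimodule N)" for n
    using that by (intro tensor_lift_param_hom[OF T.M.M.abelian_group_axioms T.tensor_pair_axioms _ _ v]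
        mul_inner_balanced abelian_group_hom_compose[OF pr_hom_left M.mult_right_hom]) auto
  show "abelian_group_hom (symmetric_bimodule N) MN
      (\<lambda>n. tensor_lift (add_monoid MN) (\<lambda>m' n'. pr (m \<otimes>\<^bsub>M\<^esub> m') (n \<otimes>\<^bsub>N\<^esub> n')) v)"
    if "m \<in> carrier (symmetric_bimodule M)" for m
    using that by (intro tensor_lift_param_hom[OF T.N.M.abelian_group_axioms T.tensor_pair_axioms _ _ v]
        mul_inner_balanced abelian_group_hom_compose[OF pr_hom_right N.mult_right_hom]) auto
  fix m k n
  assume "m \<in> carrier (symmetric_bimodule M)" "k \<in> carrier K" "n \<in> carrier (symmetric_bimodule N)"
  then show "tensor_lift (add_monoid MN)
      (\<lambda>m' n'. pr (ract (symmetric_bimodule M) m k \<otimes>\<^bsub>M\<^esub> m') (n \<otimes>\<^bsub>N\<^esub> n')) v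
    = tensor_lift (add_monoid MN)
      (\<lambda>m' n'. pr (m \<otimes>\<^bsub>M\<^esub> m') (lact (symmetric_bimodule N) k n \<otimes>\<^bsub>N\<^esub> n')) v"
    by (intro hom_eqI[OF balanced_map.lift_hom[OF mul_inner_balanced]
          balanced_map.lift_hom[OF mul_inner_balanced] _ v])
       (simp_all add: balanced_map.lift_pure[OF mul_inner_balanced] M.smult_mult_left
          N.smult_mult_left pr_balanced)
qed

lemma mul_hom_left: "v \<in> carrier MN \<Longrightarrow> abelian_group_hom MN MN (\<lambda>u. mul u v)"
  unfolding k_tensor_mult_def tensor_lift_tensor_group
  by (rule balanced_map.lift_hom[OF mul_outer_balanced])

lemma mul_pure_left:
  "\<lbrakk>m \<in> carrier M; n \<in> carrier N; v \<in> carrier MN\<rbrakk> \<Longrightarrow> mul (pr m n) v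
    = tensor_lift (add_monoid MN) (\<lambda>m' n'. pr (m \<otimes>\<^bsub>M\<^esub> m') (n \<otimes>\<^bsub>N\<^esub> n')) v"
  unfolding k_tensor_mult_def tensor_lift_tensor_group
  by (rule balanced_map.lift_pure[OF mul_outer_balanced]) simp_all

lemma mul_pure:
  "\<lbrakk>m \<in> carrier M; n \<in> carrier N; m' \<in> carrier M; n' \<in> carrier N\<rbrakk>
    \<Longrightarrow> mul (pr m n) (pr m' n') = pr (m \<otimes>\<^bsub>M\<^esub> m') (n \<otimes>\<^bsub>N\<^esub> n')"
  by (simp add: mul_pure_left pr_closed balanced_map.lift_pure[OF mul_inner_balanced])

lemma mul_closed: "\<lbrakk>u \<in> carrier MN; v \<in> carrier MN\<rbrakk> \<Longrightarrow> mul u v \<in> carrier MN"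
  by (rule abelian_group_hom.hom_closed[OF mul_hom_left])

lemma mul_pure_hom_right:
  assumes "m \<in> carrier M" "n \<in> carrier N"
  shows "abelian_group_hom MN MN (mul (pr m n))"
  by (rule abelian_group_hom_cong[OF balanced_map.lift_hom[OF mul_inner_balanced[OF assms]]])
     (simp add: mul_pure_left assms)

text \<open>The product is a lift in its first factor, where additivity holds by construction. Additivity
  in the second factor is an equation between additive maps of the first, and on pure tensors it is
  the additivity of the inner lift.\<close>

lemma mul_hom_right:
  assumes u: "u \<in> carrier MN" shows "abelian_group_hom MN MN (mul u)"
proof (rule abelian_group_hom_intro[OF T.tensor_abelian T.tensor_abelian])
  show "mul u v \<in> carrier MN" if "v \<in> carrier MN" for v by (rule mul_closed[OF u that])
  fix v w assume vw: "v \<in> carrier MN" "w \<in> carrier MN"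
  show "mul u (v \<oplus>\<^bsub>MN\<^esub> w) = mul u v \<oplus>\<^bsub>MN\<^esub> mul u w"
    by (rule hom_eqI[OF mul_hom_left abelian_group_hom_add[OF mul_hom_left mul_hom_left] _ u])
       (use vw abelian_group_hom.hom_add[OF mul_pure_hom_right] in
         \<open>auto intro: abelian_monoid.a_closed[OF abelian_group.axioms(1)[OF T.tensor_abelian]]\<close>)
qed

lemma mul_smult_right:
  assumes k: "k \<in> carrier K" and u: "u \<in> carrier MN" and v: "v \<in> carrier MN"
  shows "mul u (lact MN k v) = lact MN k (mul u v)"
proof (rule hom_eqI[OF mul_hom_left abelian_group_hom_compose[OF T.tensor_lact_hom mul_hom_left] _ u])
  fix m n assume mn: "m \<in> carrier M" "n \<in> carrier N"
  show "mul (pr m n) (lact MN k v) = lact MN k (mul (pr m n) v)"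
    by (rule hom_eqI[OF abelian_group_hom_compose[OF mul_pure_hom_right T.tensor_lact_hom]
          abelian_group_hom_compose[OF T.tensor_lact_hom mul_pure_hom_right] _ v])
       (use mn k in \<open>auto simp: pr_smult mul_pure M.smult_mult_right\<close>)
qed (use k v abelian_group_hom.hom_closed[OF T.tensor_lact_hom] in auto)

lemma mul_assoc:
  assumes u: "u \<in> carrier MN" and v: "v \<in> carrier MN" and w: "w \<in> carrier MN"
  shows "mul (mul u v) w = mul u (mul v w)"
proof (rule hom_eqI[OF abelian_group_hom_compose[OF mul_hom_left[OF w] mul_hom_left[OF v]]
      mul_hom_left[OF mul_closed[OF v w]] _ u])
  fix m n assume mn: "m \<in> carrier M" "n \<in> carrier N"
  note pmn = pr_closed[OF mn]
  show "mul (mul (pr m n) v) w = mul (pr m n) (mul v w)"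
  proof (rule hom_eqI[OF abelian_group_hom_compose[OF mul_hom_left[OF w] mul_hom_right[OF pmn]]
        abelian_group_hom_compose[OF mul_hom_right[OF pmn] mul_hom_left[OF w]] _ v])
    fix m' n' assume mn': "m' \<in> carrier M" "n' \<in> carrier N"
    note pmn' = pr_closed[OF mn']
    show "mul (mul (pr m n) (pr m' n')) w = mul (pr m n) (mul (pr m' n') w)"
      by (rule hom_eqI[OF mul_hom_right[OF mul_closed[OF pmn pmn']]
            abelian_group_hom_compose[OF mul_hom_right[OF pmn] mul_hom_right[OF pmn']] _ w])
         (use mn mn' in \<open>simp add: mul_pure M.A.m_assoc N.A.m_assoc\<close>)
  qed
qed

lemma one_mul: "u \<in> carrier MN \<Longrightarrow> mul (pr \<one>\<^bsub>M\<^esub> \<one>\<^bsub>N\<^esub>) u = u"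
  by (rule hom_eqI[OF mul_hom_right abelian_group_hom_id])
     (auto simp: mul_pure pr_closed T.tensor_abelian)

lemma mul_one: "u \<in> carrier MN \<Longrightarrow> mul u (pr \<one>\<^bsub>M\<^esub> \<one>\<^bsub>N\<^esub>) = u"
  by (rule hom_eqI[OF mul_hom_left abelian_group_hom_id])
     (auto simp: mul_pure pr_closed T.tensor_abelian)

end

section \<open>The bimodules of the coring of a comodule algebra\<close>

locale hopf_comodule_algebra = Hopf: hopf_group_coalgebra G K H \<Delta> \<epsilon> S
    + Comod: group_comodule_algebra G K H \<Delta> \<epsilon> A \<rho>
  for G :: "('g, 'x) monoid_scheme" and K :: "('k, 'y) ring_scheme"
    and H :: "'g \<Rightarrow> ('k, 'h) module"
    and \<Delta> :: "'g \<Rightarrow> 'g \<Rightarrow> 'h \<Rightarrow> ('h \<times> 'h \<Rightarrow>\<^sub>0 int) set"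
    and \<epsilon> :: "'h \<Rightarrow> 'k"
    and S :: "'g \<Rightarrow> 'h \<Rightarrow> 'h"
    and A :: "('k, 'a) module"
    and \<rho> :: "'g \<Rightarrow> 'a \<Rightarrow> ('a \<times> 'h \<Rightarrow>\<^sub>0 int) set"
begin

abbreviation AH where "AH \<alpha> \<equiv> k_tensor K A (H \<alpha>)"
abbreviation p where "p \<alpha> \<equiv> k_pure_tensor K A (H \<alpha>)"
abbreviation C where "C \<equiv> comodule_coring K H A \<rho>"

lemma H_algebra: "\<alpha> \<in> carrier G \<Longrightarrow> k_algebra K (H \<alpha>)"
  by (rule Hopf.component_algebra)

lemma A_algebra: "k_algebra K A" by (rule Comod.A.k_algebra_axioms)

lemma AH_pair: "\<alpha> \<in> carrier G \<Longrightarrow> k_algebra_pair K A (H \<alpha>)"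
  by (intro k_algebra_pair.intro A_algebra H_algebra)

lemma HH_pair: "\<lbrakk>\<alpha> \<in> carrier G; \<beta> \<in> carrier G\<rbrakk> \<Longrightarrow> k_algebra_pair K (H \<alpha>) (H \<beta>)"
  by (intro k_algebra_pair.intro H_algebra)

lemma C_simps [simp]:
  "carrier (C \<alpha>) = carrier (AH \<alpha>)" "add (C \<alpha>) = add (AH \<alpha>)" "\<zero>\<^bsub>C \<alpha>\<^esub> = \<zero>\<^bsub>AH \<alpha>\<^esub>"
  "ract (C \<alpha>) u a = k_tensor_mult K A (H \<alpha>) u (\<rho> \<alpha> a)"
  by (simp_all add: comodule_coring_def)

end

locale hopf_comodule_algebra_component = hopf_comodule_algebra +
  fixes \<alpha>
  assumes \<alpha>: "\<alpha> \<in> carrier G"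
begin

sublocale AH: k_algebra_pair K A "H \<alpha>" by (rule AH_pair[OF \<alpha>])

abbreviation m where "m \<equiv> k_tensor_mult K A (H \<alpha>)"

lemma rho_hom: "abelian_group_hom (symmetric_bimodule A) (AH \<alpha>) (\<rho> \<alpha>)"
  using bimodule_hom_is_hom(1)[OF AH.T.M.bimodule_axioms AH.T.tensor_bimodule Comod.coact_linear[OF \<alpha>]] .

lemma rho_closed: "a \<in> carrier A \<Longrightarrow> \<rho> \<alpha> a \<in> carrier (AH \<alpha>)"
  using abelian_group_hom.hom_closed[OF rho_hom] by simp

lemma rho_smult: "\<lbrakk>k \<in> carrier K; a \<in> carrier A\<rbrakk> \<Longrightarrow> \<rho> \<alpha> (k \<odot>\<^bsub>A\<^esub> a) = lact (AH \<alpha>) k (\<rho> \<alpha> a)"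
  using Comod.coact_linear[OF \<alpha>] by (auto simp: bimodule_hom_def)

lemma rho_scalar: "k \<in> carrier K \<Longrightarrow> \<rho> \<alpha> (k \<odot>\<^bsub>A\<^esub> \<one>\<^bsub>A\<^esub>) = p \<alpha> (k \<odot>\<^bsub>A\<^esub> \<one>\<^bsub>A\<^esub>) \<one>\<^bsub>H \<alpha>\<^esub>"
  by (simp add: rho_smult Comod.coact_one[OF \<alpha>] AH.pr_smult)

lemma lact_balanced:
  assumes a: "a \<in> carrier A"
  shows "balanced_map (carrier K) (symmetric_bimodule A) (symmetric_bimodule (H \<alpha>)) (AH \<alpha>)
    (\<lambda>b h. p \<alpha> (a \<otimes>\<^bsub>A\<^esub> b) h)"
proof (rule balanced_mapI[OF AH.T.tensor_pair_axioms AH.T.tensor_abelian])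
  show "abelian_group_hom (symmetric_bimodule A) (AH \<alpha>) (\<lambda>b. p \<alpha> (a \<otimes>\<^bsub>A\<^esub> b) h)"
    if "h \<in> carrier (symmetric_bimodule (H \<alpha>))" for h
    using that a by (intro abelian_group_hom_compose[OF AH.pr_hom_left Comod.A.mult_left_hom]) auto
qed (use a in \<open>auto simp: Comod.A.smult_mult_right AH.pr_balanced intro: AH.pr_hom_right\<close>)

lemma C_lact_hom: "a \<in> carrier A \<Longrightarrow> abelian_group_hom (AH \<alpha>) (AH \<alpha>) (lact (C \<alpha>) a)"
  unfolding comodule_coring_def bimodule.simps tensor_lift_tensor_group
  by (rule balanced_map.lift_hom[OF lact_balanced])

lemma C_lact_pure:
  "\<lbrakk>a \<in> carrier A; b \<in> carrier A; h \<in> carrier (H \<alpha>)\<rbrakk>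
    \<Longrightarrow> lact (C \<alpha>) a (p \<alpha> b h) = p \<alpha> (a \<otimes>\<^bsub>A\<^esub> b) h"
  unfolding comodule_coring_def bimodule.simps tensor_lift_tensor_group
  by (rule balanced_map.lift_pure[OF lact_balanced]) simp_all

text \<open>Together with the right action, which is multiplication by \<open>\<rho>\<^sub>\<alpha>(a)\<close>, this reduces the bimodule
  axioms to the ring axioms of \<open>A \<otimes> H\<^sub>\<alpha>\<close> and to \<open>a \<mapsto> a \<otimes> 1\<close> and \<open>\<rho>\<^sub>\<alpha>\<close> being ring homomorphisms.\<close>

lemma C_lact_eq_mul:
  assumes a: "a \<in> carrier A" and u: "u \<in> carrier (AH \<alpha>)"
  shows "lact (C \<alpha>) a u = m (p \<alpha> a \<one>\<^bsub>H \<alpha>\<^esub>) u"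
  by (rule AH.hom_eqI[OF C_lact_hom[OF a] AH.mul_hom_right _ u])
     (use a in \<open>auto simp: C_lact_pure AH.mul_pure AH.pr_closed\<close>)

lemma p_hom_right: "a \<in> carrier A \<Longrightarrow> abelian_group_hom (symmetric_bimodule (H \<alpha>)) (C \<alpha>) (p \<alpha> a)"
  by (rule abelian_group_hom_change[OF AH.pr_hom_right]) simp_all

lemma p_hom_left:
  "h \<in> carrier (H \<alpha>) \<Longrightarrow> abelian_group_hom (symmetric_bimodule A) (C \<alpha>) (\<lambda>a. p \<alpha> a h)"
  by (rule abelian_group_hom_change[OF AH.pr_hom_left]) simp_all

text \<open>On scalars from \<open>K\<close> the right action of \<open>A\<close> is the module structure over \<open>K\<close>, because
  \<open>\<rho>\<^sub>\<alpha>(k 1) = k (1 \<otimes> 1)\<close>. Tensor products over \<open>A\<close> are therefore balanced over \<open>K\<close>.\<close>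

lemma C_ract_scalar:
  assumes "k \<in> carrier K" "a \<in> carrier A" "h \<in> carrier (H \<alpha>)"
  shows "ract (C \<alpha>) (p \<alpha> a h) (k \<odot>\<^bsub>A\<^esub> \<one>\<^bsub>A\<^esub>) = p \<alpha> a (k \<odot>\<^bsub>H \<alpha>\<^esub> h)"
  using assms by (simp add: rho_scalar AH.mul_pure Comod.A.smult_mult_right AH.N.smult_mult_right AH.pr_balanced)

lemma C_bimodule: "bimodule A A (C \<alpha>)"
proof -
  let ?e = "\<lambda>a. p \<alpha> a \<one>\<^bsub>H \<alpha>\<^esub>"
  have e: "?e a \<in> carrier (AH \<alpha>)" if "a \<in> carrier A" for a using that by (simp add: AH.pr_closed)
  have e_add: "?e (a \<oplus>\<^bsub>A\<^esub> b) = ?e a \<oplus>\<^bsub>AH \<alpha>\<^esub> ?e b" if "a \<in> carrier A" "b \<in> carrier A" for a b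
    using abelian_group_hom.hom_add[OF AH.pr_hom_left, of "\<one>\<^bsub>H \<alpha>\<^esub>" a b] that by simp
  have e_mult: "?e (a \<otimes>\<^bsub>A\<^esub> b) = m (?e a) (?e b)" if "a \<in> carrier A" "b \<in> carrier A" for a b
    using that by (simp add: AH.mul_pure)
  have rho_add: "\<rho> \<alpha> (a \<oplus>\<^bsub>A\<^esub> b) = \<rho> \<alpha> a \<oplus>\<^bsub>AH \<alpha>\<^esub> \<rho> \<alpha> b"
    if "a \<in> carrier A" "b \<in> carrier A" for a b
    using abelian_group_hom.hom_add[OF rho_hom, of a b] that by simp
  note l = abelian_group_hom.hom_add[OF AH.mul_hom_left] and r = abelian_group_hom.hom_add[OF AH.mul_hom_right]
  show ?thesis
  proof (intro bimodule.intro bimodule_axioms.intro)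
    show "abelian_group (C \<alpha>)" by (rule abelian_group_cong[OF AH.T.tensor_abelian]) simp_all
  qed (auto simp: C_lact_eq_mul AH.mul_closed e rho_closed e_add e_mult rho_add l r
        AH.mul_assoc AH.one_mul AH.mul_one Comod.coact_one[OF \<alpha>] Comod.coact_mult[OF \<alpha>]
        intro: Comod.A.A.ring_axioms)
qed

end

section \<open>The comultiplication of the coring of a comodule algebra\<close>

locale hopf_comodule_algebra_comult = hopf_comodule_algebra +
  fixes \<alpha> \<beta>
  assumes \<alpha>: "\<alpha> \<in> carrier G" and \<beta>: "\<beta> \<in> carrier G"
begin

lemma \<alpha>\<beta>: "\<alpha> \<otimes>\<^bsub>G\<^esub> \<beta> \<in> carrier G" by (rule Hopf.G.m_closed[OF \<alpha> \<beta>])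

sublocale l: hopf_comodule_algebra_component G K H \<Delta> \<epsilon> S A \<rho> \<alpha> by unfold_locales (rule \<alpha>)
sublocale r: hopf_comodule_algebra_component G K H \<Delta> \<epsilon> S A \<rho> \<beta> by unfold_locales (rule \<beta>)
sublocale lr: hopf_comodule_algebra_component G K H \<Delta> \<epsilon> S A \<rho> "\<alpha> \<otimes>\<^bsub>G\<^esub> \<beta>"
  by unfold_locales (rule \<alpha>\<beta>)
sublocale HH: k_algebra_pair K "H \<alpha>" "H \<beta>" by (rule HH_pair[OF \<alpha> \<beta>])
sublocale CC: bimodule_pair A A A "C \<alpha>" "C \<beta>" "carrier A"
  by (rule bimodule_pairI[OF l.C_bimodule r.C_bimodule subset_refl])
sublocale AHH: bimodule_triple K K K K "symmetric_bimodule A" "symmetric_bimodule (H \<alpha>)"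
    "symmetric_bimodule (H \<beta>)"
  by (intro bimodule_triple.intro symmetric_bimodule_is_bimodule
      Comod.A.module_axioms l.AH.N.module_axioms r.AH.N.module_axioms)

abbreviation HH where "HH \<equiv> k_tensor K (H \<alpha>) (H \<beta>)"
abbreviation q where "q \<equiv> k_pure_tensor K (H \<alpha>) (H \<beta>)"
abbreviation CC where "CC \<equiv> tensor (carrier A) (C \<alpha>) (C \<beta>)"
abbreviation cc where "cc \<equiv> pure_tensor (carrier A) (C \<alpha>) (C \<beta>)"
abbreviation \<delta> where "\<delta> \<equiv> comodule_comult K H \<Delta> A \<rho> \<alpha> \<beta>"

text \<open>The map \<open>h \<otimes> h' \<mapsto> (a \<otimes> h) \<otimes>\<^sub>A (1 \<otimes> h')\<close> from \<open>H\<^sub>\<alpha> \<otimes> H\<^sub>\<beta>\<close>. The comultiplication sends \<open>a \<otimes> h\<close> to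
  \<open>\<Theta> a (\<Delta>\<^sub>\<alpha>\<^sub>,\<^sub>\<beta>(h))\<close>.\<close>

definition \<Theta> where
  "\<Theta> a = tensor_lift (add_monoid CC) (\<lambda>h h'. cc (p \<alpha> a h) (p \<beta> \<one>\<^bsub>A\<^esub> h'))"

lemma Theta_balanced:
  assumes a: "a \<in> carrier A"
  shows "balanced_map (carrier K) (symmetric_bimodule (H \<alpha>)) (symmetric_bimodule (H \<beta>)) CC
    (\<lambda>h h'. cc (p \<alpha> a h) (p \<beta> \<one>\<^bsub>A\<^esub> h'))"
proof (rule balanced_mapI[OF HH.T.tensor_pair_axioms CC.tensor_abelian])
  show "abelian_group_hom (symmetric_bimodule (H \<alpha>)) CC (\<lambda>h. cc (p \<alpha> a h) (p \<beta> \<one>\<^bsub>A\<^esub> h'))"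
    if "h' \<in> carrier (symmetric_bimodule (H \<beta>))" for h'
    by (rule abelian_group_hom_compose[OF CC.pure.hom_left l.p_hom_right[OF a]])
       (use that in \<open>simp add: r.AH.pr_closed\<close>)
  show "abelian_group_hom (symmetric_bimodule (H \<beta>)) CC (\<lambda>h'. cc (p \<alpha> a h) (p \<beta> \<one>\<^bsub>A\<^esub> h'))"
    if "h \<in> carrier (symmetric_bimodule (H \<alpha>))" for h
    by (rule abelian_group_hom_compose[OF CC.pure.hom_right r.p_hom_right])
       (use that a in \<open>simp_all add: l.AH.pr_closed\<close>)
  fix h k h'
  assume "h \<in> carrier (symmetric_bimodule (H \<alpha>))" and k: "k \<in> carrier K"
    and "h' \<in> carrier (symmetric_bimodule (H \<beta>))"
  then have h: "h \<in> carrier (H \<alpha>)" "h' \<in> carrier (H \<beta>)" by simp_all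
  have "cc (p \<alpha> a (k \<odot>\<^bsub>H \<alpha>\<^esub> h)) (p \<beta> \<one>\<^bsub>A\<^esub> h')
      = cc (ract (C \<alpha>) (p \<alpha> a h) (k \<odot>\<^bsub>A\<^esub> \<one>\<^bsub>A\<^esub>)) (p \<beta> \<one>\<^bsub>A\<^esub> h')"
    using a h k by (simp only: l.C_ract_scalar)
  also have "\<dots> = cc (p \<alpha> a h) (lact (C \<beta>) (k \<odot>\<^bsub>A\<^esub> \<one>\<^bsub>A\<^esub>) (p \<beta> \<one>\<^bsub>A\<^esub> h'))"
    by (rule CC.pure.balanced) (use a h k in \<open>simp_all add: l.AH.pr_closed r.AH.pr_closed\<close>)
  also have "lact (C \<beta>) (k \<odot>\<^bsub>A\<^esub> \<one>\<^bsub>A\<^esub>) (p \<beta> \<one>\<^bsub>A\<^esub> h') = p \<beta> \<one>\<^bsub>A\<^esub> (k \<odot>\<^bsub>H \<beta>\<^esub> h')"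
    using h k by (simp add: r.C_lact_pure r.AH.pr_balanced)
  finally show "cc (p \<alpha> a (ract (symmetric_bimodule (H \<alpha>)) h k)) (p \<beta> \<one>\<^bsub>A\<^esub> h')
      = cc (p \<alpha> a h) (p \<beta> \<one>\<^bsub>A\<^esub> (lact (symmetric_bimodule (H \<beta>)) k h'))"
    by simp
qed

lemma Theta_hom: "a \<in> carrier A \<Longrightarrow> abelian_group_hom HH CC (\<Theta> a)"
  unfolding \<Theta>_def by (rule balanced_map.lift_hom[OF Theta_balanced])

lemma Theta_pure:
  "\<lbrakk>a \<in> carrier A; h \<in> carrier (H \<alpha>); h' \<in> carrier (H \<beta>)\<rbrakk>
    \<Longrightarrow> \<Theta> a (q h h') = cc (p \<alpha> a h) (p \<beta> \<one>\<^bsub>A\<^esub> h')"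
  unfolding \<Theta>_def by (rule balanced_map.lift_pure[OF Theta_balanced]) simp_all

lemma Theta_closed: "\<lbrakk>a \<in> carrier A; w \<in> carrier HH\<rbrakk> \<Longrightarrow> \<Theta> a w \<in> carrier CC"
  by (rule abelian_group_hom.hom_closed[OF Theta_hom])

lemma Theta_param_hom:
  "w \<in> carrier HH \<Longrightarrow> abelian_group_hom (symmetric_bimodule A) CC (\<lambda>a. \<Theta> a w)"
  unfolding \<Theta>_def
  by (rule tensor_lift_param_hom[OF l.AH.T.M.M.abelian_group_axioms HH.T.tensor_pair_axioms Theta_balanced
        abelian_group_hom_compose[OF CC.pure.hom_left l.p_hom_left]])
     (simp_all add: r.AH.pr_closed)

lemma Theta_lact:
  assumes a: "a \<in> carrier A" and b: "b \<in> carrier A" and w: "w \<in> carrier HH"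
  shows "\<Theta> (b \<otimes>\<^bsub>A\<^esub> a) w = lact CC b (\<Theta> a w)"
  by (rule HH.hom_eqI[OF Theta_hom abelian_group_hom_compose[OF CC.tensor_lact_hom Theta_hom] _ w])
     (simp_all add: a b Theta_pure CC.lact_pure l.C_lact_pure l.AH.pr_closed r.AH.pr_closed)

lemma Theta_smult:
  assumes a: "a \<in> carrier A" and k: "k \<in> carrier K" and w: "w \<in> carrier HH"
  shows "\<Theta> a (lact HH k w) = \<Theta> (k \<odot>\<^bsub>A\<^esub> a) w"
  by (rule HH.hom_eqI[OF abelian_group_hom_compose[OF Theta_hom HH.T.tensor_lact_hom] Theta_hom _ w])
     (simp_all add: a k Theta_pure HH.pr_smult l.AH.pr_balanced)

lemma Delta_linear:
  "abelian_group_hom (symmetric_bimodule (H (\<alpha> \<otimes>\<^bsub>G\<^esub> \<beta>))) HH (\<Delta> \<alpha> \<beta>)"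
  "right_linear (carrier K) (symmetric_bimodule (H (\<alpha> \<otimes>\<^bsub>G\<^esub> \<beta>))) HH (\<Delta> \<alpha> \<beta>)"
  "left_linear (carrier K) (symmetric_bimodule (H (\<alpha> \<otimes>\<^bsub>G\<^esub> \<beta>))) HH (\<Delta> \<alpha> \<beta>)"
  using bimodule_hom_is_hom[OF lr.AH.T.N.bimodule_axioms HH.T.tensor_bimodule Hopf.comult_hom[OF \<alpha> \<beta>]] .

lemma Delta_closed: "h \<in> carrier (H (\<alpha> \<otimes>\<^bsub>G\<^esub> \<beta>)) \<Longrightarrow> \<Delta> \<alpha> \<beta> h \<in> carrier HH"
  using abelian_group_hom.hom_closed[OF Delta_linear(1)] by simp

lemma comult_balanced:
  "balanced_map (carrier K) (symmetric_bimodule A) (symmetric_bimodule (H (\<alpha> \<otimes>\<^bsub>G\<^esub> \<beta>))) CC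
    (\<lambda>a h. \<Theta> a (\<Delta> \<alpha> \<beta> h))"
proof (rule balanced_mapI[OF lr.AH.T.tensor_pair_axioms CC.tensor_abelian])
  show "abelian_group_hom (symmetric_bimodule A) CC (\<lambda>a. \<Theta> a (\<Delta> \<alpha> \<beta> h))"
    if "h \<in> carrier (symmetric_bimodule (H (\<alpha> \<otimes>\<^bsub>G\<^esub> \<beta>)))" for h
    using that by (simp add: Theta_param_hom Delta_closed)
  show "abelian_group_hom (symmetric_bimodule (H (\<alpha> \<otimes>\<^bsub>G\<^esub> \<beta>))) CC (\<lambda>h. \<Theta> a (\<Delta> \<alpha> \<beta> h))"
    if "a \<in> carrier (symmetric_bimodule A)" for a
    using that by (intro abelian_group_hom_compose[OF Theta_hom Delta_linear(1)]) simp
  show "\<Theta> (ract (symmetric_bimodule A) a k) (\<Delta> \<alpha> \<beta> h)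
      = \<Theta> a (\<Delta> \<alpha> \<beta> (lact (symmetric_bimodule (H (\<alpha> \<otimes>\<^bsub>G\<^esub> \<beta>))) k h))"
    if "a \<in> carrier (symmetric_bimodule A)" "k \<in> carrier K"
      "h \<in> carrier (symmetric_bimodule (H (\<alpha> \<otimes>\<^bsub>G\<^esub> \<beta>)))" for a k h
  proof -
    have "\<Delta> \<alpha> \<beta> (k \<odot>\<^bsub>H (\<alpha> \<otimes>\<^bsub>G\<^esub> \<beta>)\<^esub> h) = lact HH k (\<Delta> \<alpha> \<beta> h)"
      using Delta_linear(3) that by (simp add: left_linear_def)
    then show ?thesis using that by (simp add: Theta_smult Delta_closed)
  qed
qed

lemma comult_eq: "\<delta> = tensor_lift (add_monoid CC) (\<lambda>a h. \<Theta> a (\<Delta> \<alpha> \<beta> h))"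
  unfolding comodule_comult_def Let_def tensor_lift_tensor_group \<Theta>_def ..

lemma comult_hom: "abelian_group_hom (AH (\<alpha> \<otimes>\<^bsub>G\<^esub> \<beta>)) CC \<delta>"
  unfolding comult_eq by (rule balanced_map.lift_hom[OF comult_balanced])

lemma comult_pure:
  "\<lbrakk>a \<in> carrier A; h \<in> carrier (H (\<alpha> \<otimes>\<^bsub>G\<^esub> \<beta>))\<rbrakk>
    \<Longrightarrow> \<delta> (p (\<alpha> \<otimes>\<^bsub>G\<^esub> \<beta>) a h) = \<Theta> a (\<Delta> \<alpha> \<beta> h)"
  unfolding comult_eq by (rule balanced_map.lift_pure[OF comult_balanced]) simp_all

lemma comult_lact:
  assumes b: "b \<in> carrier A" and u: "u \<in> carrier (AH (\<alpha> \<otimes>\<^bsub>G\<^esub> \<beta>))"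
  shows "\<delta> (lact (C (\<alpha> \<otimes>\<^bsub>G\<^esub> \<beta>)) b u) = lact CC b (\<delta> u)"
  by (rule lr.AH.hom_eqI[OF abelian_group_hom_compose[OF comult_hom lr.C_lact_hom]
        abelian_group_hom_compose[OF CC.tensor_lact_hom comult_hom] _ u])
     (simp_all add: b lr.C_lact_pure comult_pure Theta_lact Delta_closed)

abbreviation AHH where "AHH \<equiv> tensor (carrier K) (symmetric_bimodule A) HH"

text \<open>The map \<open>b \<otimes> z \<mapsto> \<Theta> (a b) (v z)\<close> from \<open>A \<otimes> (H\<^sub>\<alpha> \<otimes> H\<^sub>\<beta>)\<close>. For \<open>v = \<Delta>(h)\<close> its value at
  \<open>(A \<otimes> \<Delta>)(w)\<close> is \<open>\<Delta>((a \<otimes> h) w)\<close>. The coassociativity of the coaction is an equation in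
  \<open>A \<otimes> (H\<^sub>\<alpha> \<otimes> H\<^sub>\<beta>)\<close>, and \<open>\<Phi>\<close> transports it to \<open>C\<^sub>\<alpha> \<otimes>\<^sub>A C\<^sub>\<beta>\<close>.\<close>

definition \<Phi> where
  "\<Phi> a v = tensor_lift (add_monoid CC) (\<lambda>b z. \<Theta> (a \<otimes>\<^bsub>A\<^esub> b) (k_tensor_mult K (H \<alpha>) (H \<beta>) v z))"

lemma Phi_balanced:
  assumes a: "a \<in> carrier A" and v: "v \<in> carrier HH"
  shows "balanced_map (carrier K) (symmetric_bimodule A) HH CC
    (\<lambda>b z. \<Theta> (a \<otimes>\<^bsub>A\<^esub> b) (k_tensor_mult K (H \<alpha>) (H \<beta>) v z))"
proof (rule balanced_mapI[OF AHH.L_MN.tensor_pair_axioms CC.tensor_abelian])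
  show "abelian_group_hom (symmetric_bimodule A) CC
      (\<lambda>b. \<Theta> (a \<otimes>\<^bsub>A\<^esub> b) (k_tensor_mult K (H \<alpha>) (H \<beta>) v z))" if "z \<in> carrier HH" for z
    by (rule abelian_group_hom_compose[OF Theta_param_hom Comod.A.mult_left_hom[OF a]])
       (rule HH.mul_closed[OF v that])
  show "abelian_group_hom HH CC (\<lambda>z. \<Theta> (a \<otimes>\<^bsub>A\<^esub> b) (k_tensor_mult K (H \<alpha>) (H \<beta>) v z))"
    if "b \<in> carrier (symmetric_bimodule A)" for b
    by (rule abelian_group_hom_compose[OF Theta_hom HH.mul_hom_right[OF v]]) (use a that in simp)
qed (use a v in \<open>simp add: Comod.A.smult_mult_right HH.mul_smult_right Theta_smult HH.mul_closed\<close>)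

lemma Phi_hom: "\<lbrakk>a \<in> carrier A; v \<in> carrier HH\<rbrakk> \<Longrightarrow> abelian_group_hom AHH CC (\<Phi> a v)"
  unfolding \<Phi>_def by (rule balanced_map.lift_hom[OF Phi_balanced])

lemma Phi_pure:
  "\<lbrakk>a \<in> carrier A; v \<in> carrier HH; b \<in> carrier A; z \<in> carrier HH\<rbrakk>
    \<Longrightarrow> \<Phi> a v (pure_tensor (carrier K) (symmetric_bimodule A) HH b z)
      = \<Theta> (a \<otimes>\<^bsub>A\<^esub> b) (k_tensor_mult K (H \<alpha>) (H \<beta>) v z)"
  unfolding \<Phi>_def by (rule balanced_map.lift_pure[OF Phi_balanced]) simp_all

lemma Phi_param_hom:
  assumes a: "a \<in> carrier A" and u: "u \<in> carrier AHH"
  shows "abelian_group_hom HH CC (\<lambda>v. \<Phi> a v u)"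
  unfolding \<Phi>_def
  by (rule tensor_lift_param_hom[OF HH.T.tensor_abelian AHH.L_MN.tensor_pair_axioms Phi_balanced
        abelian_group_hom_compose[OF Theta_hom HH.mul_hom_left] u])
     (use a in simp_all)

abbreviation id_Delta where "id_Delta \<equiv> tensor_map (carrier K) (symmetric_bimodule A) HH (\<lambda>a. a) (\<Delta> \<alpha> \<beta>)"
abbreviation rho_id where
  "rho_id \<equiv> tensor_map (carrier K) (AH \<alpha>) (symmetric_bimodule (H \<beta>)) (\<rho> \<alpha>) (\<lambda>h. h)"
abbreviation assoc where
  "assoc \<equiv> tensor_assoc (carrier K) (carrier K)
    (symmetric_bimodule A) (symmetric_bimodule (H \<alpha>)) (symmetric_bimodule (H \<beta>))"

lemma comult_mul:
  assumes a: "a \<in> carrier A" and h: "h \<in> carrier (H (\<alpha> \<otimes>\<^bsub>G\<^esub> \<beta>))"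
    and w: "w \<in> carrier (AH (\<alpha> \<otimes>\<^bsub>G\<^esub> \<beta>))"
  shows "\<delta> (k_tensor_mult K A (H (\<alpha> \<otimes>\<^bsub>G\<^esub> \<beta>)) (p (\<alpha> \<otimes>\<^bsub>G\<^esub> \<beta>) a h) w) = \<Phi> a (\<Delta> \<alpha> \<beta> h) (id_Delta w)"
proof -
  note tm = lr.AH.T.tensor_pair_axioms AHH.L_MN.tensor_pair_axioms
    AHH.L_MN.id_right_linear Delta_linear(3)
  show ?thesis
    by (rule lr.AH.hom_eqI[OF abelian_group_hom_compose[OF comult_hom lr.AH.mul_hom_right]
          abelian_group_hom_compose[OF Phi_hom tensor_map_hom[OF tm]] _ w])
       (use a h in \<open>simp_all add: lr.AH.pr_closed lr.AH.mul_pure comult_pure Delta_closed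
          tensor_map_pure[OF tm] Phi_pure Hopf.comult_mult[OF \<alpha> \<beta>]\<close>)
qed

text \<open>The arbitrary tensor \<open>z\<close> stands for \<open>\<rho>\<^sub>\<alpha>(b)\<close>, the arbitrary tensor \<open>w\<close> in the lemma after it
  for \<open>\<rho>\<^sub>\<beta>(s)\<close>.\<close>

lemma Phi_assoc_pure:
  assumes a: "a \<in> carrier A" and h: "h \<in> carrier (H \<alpha>)" "h' \<in> carrier (H \<beta>)"
    and z: "z \<in> carrier (AH \<alpha>)" and g: "g \<in> carrier (H \<beta>)"
  shows "\<Phi> a (q h h') (assoc (pure_tensor (carrier K) (AH \<alpha>) (symmetric_bimodule (H \<beta>)) z g))
    = cc (k_tensor_mult K A (H \<alpha>) (p \<alpha> a h) z) (p \<beta> \<one>\<^bsub>A\<^esub> (h' \<otimes>\<^bsub>H \<beta>\<^esub> g))"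
proof -
  have p: "p \<alpha> a h \<in> carrier (AH \<alpha>)" "p \<beta> \<one>\<^bsub>A\<^esub> (h' \<otimes>\<^bsub>H \<beta>\<^esub> g) \<in> carrier (C \<beta>)" "q h h' \<in> carrier HH"
    using a h g by (simp_all add: l.AH.pr_closed r.AH.pr_closed HH.pr_closed)
  have g': "g \<in> carrier (symmetric_bimodule (H \<beta>))" using g by simp
  have hom: "abelian_group_hom (AH \<alpha>) CC (\<lambda>z. cc z (p \<beta> \<one>\<^bsub>A\<^esub> (h' \<otimes>\<^bsub>H \<beta>\<^esub> g)))"
    by (rule abelian_group_hom_change[OF CC.pure.hom_left[OF p(2)]]) simp_all
  show ?thesis
    by (rule l.AH.hom_eqI[OF abelian_group_hom_compose[OF Phi_hom[OF a p(3)]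
            abelian_group_hom_compose[OF AHH.tensor_assoc_hom AHH.LM_N.pure.hom_left[OF g']]]
          abelian_group_hom_compose[OF hom l.AH.mul_hom_right[OF p(1)]] _ z])
       (use a h g p in \<open>simp add: AHH.tensor_assoc_pure_pure Phi_pure HH.pr_closed HH.mul_pure
          Theta_pure l.AH.mul_pure\<close>)
qed

lemma Phi_assoc_coact:
  assumes a: "a \<in> carrier A" and h: "h \<in> carrier (H \<alpha>)" "h' \<in> carrier (H \<beta>)"
    and w: "w \<in> carrier (AH \<beta>)"
  shows "\<Phi> a (q h h') (assoc (rho_id w))
    = cc (p \<alpha> a h) (k_tensor_mult K A (H \<beta>) (p \<beta> \<one>\<^bsub>A\<^esub> h') w)"
proof -
  have p: "p \<alpha> a h \<in> carrier (C \<alpha>)" "p \<beta> \<one>\<^bsub>A\<^esub> h' \<in> carrier (AH \<beta>)" "q h h' \<in> carrier HH"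
    using a h by (simp_all add: l.AH.pr_closed r.AH.pr_closed HH.pr_closed)
  have "right_linear (carrier K) (symmetric_bimodule A) (AH \<alpha>) (\<rho> \<alpha>)"
    by (rule bimodule_hom_is_hom(2)[OF l.AH.T.M.bimodule_axioms l.AH.T.tensor_bimodule
          Comod.coact_linear[OF \<alpha>]])
  note tm = r.AH.T.tensor_pair_axioms AHH.LM_N.tensor_pair_axioms this AHH.LM_N.id_left_linear
  have hom: "abelian_group_hom (AH \<beta>) CC (cc (p \<alpha> a h))"
    by (rule abelian_group_hom_change[OF CC.pure.hom_right[OF p(1)]]) simp_all
  show ?thesis
  proof (rule r.AH.hom_eqI[OF abelian_group_hom_compose[OF Phi_hom[OF a p(3)]
            abelian_group_hom_compose[OF AHH.tensor_assoc_hom tensor_map_hom[OF tm]]]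
          abelian_group_hom_compose[OF hom r.AH.mul_hom_right[OF p(2)]] _ w])
    fix b g assume b: "b \<in> carrier A" and g: "g \<in> carrier (H \<beta>)"
    \<comment> \<open>The factor \<open>\<rho>\<^sub>\<alpha>(b)\<close> is the right action of \<open>b\<close> and moves across the tensor product over \<open>A\<close>.\<close>
    have "cc (k_tensor_mult K A (H \<alpha>) (p \<alpha> a h) (\<rho> \<alpha> b)) (p \<beta> \<one>\<^bsub>A\<^esub> (h' \<otimes>\<^bsub>H \<beta>\<^esub> g))
        = cc (p \<alpha> a h) (lact (C \<beta>) b (p \<beta> \<one>\<^bsub>A\<^esub> (h' \<otimes>\<^bsub>H \<beta>\<^esub> g)))"
      using CC.pure.balanced[of "p \<alpha> a h" b "p \<beta> \<one>\<^bsub>A\<^esub> (h' \<otimes>\<^bsub>H \<beta>\<^esub> g)"] p b h g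
      by (simp add: r.AH.pr_closed)
    then show "\<Phi> a (q h h') (assoc (rho_id (p \<beta> b g)))
        = cc (p \<alpha> a h) (k_tensor_mult K A (H \<beta>) (p \<beta> \<one>\<^bsub>A\<^esub> h') (p \<beta> b g))"
      using a h b g
      by (simp add: tensor_map_pure[OF tm] Phi_assoc_pure l.rho_closed r.C_lact_pure r.AH.mul_pure)
  qed
qed

text \<open>In \<open>\<Delta>((a \<otimes> h) s) = \<Phi> a (\<Delta>(h)) ((A \<otimes> \<Delta>)(\<rho>\<^sub>\<alpha>\<^sub>\<beta>(s)))\<close> the coassociativity of the coaction replaces the
  last argument by the coaction applied twice. One coaction then acts on the left tensor factor, from
  which it is moved across, and the other remains as the right action on the right factor.\<close>

lemma comult_ract:
  assumes s: "s \<in> carrier A" and u: "u \<in> carrier (AH (\<alpha> \<otimes>\<^bsub>G\<^esub> \<beta>))"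
  shows "\<delta> (ract (C (\<alpha> \<otimes>\<^bsub>G\<^esub> \<beta>)) u s) = ract CC (\<delta> u) s"
proof -
  have rhos: "\<rho> (\<alpha> \<otimes>\<^bsub>G\<^esub> \<beta>) s \<in> carrier (AH (\<alpha> \<otimes>\<^bsub>G\<^esub> \<beta>))" "\<rho> \<beta> s \<in> carrier (AH \<beta>)"
    by (rule lr.rho_closed[OF s], rule r.rho_closed[OF s])
  note tm = lr.AH.T.tensor_pair_axioms AHH.L_MN.tensor_pair_axioms
    AHH.L_MN.id_right_linear Delta_linear(3)
  have mem: "id_Delta (\<rho> (\<alpha> \<otimes>\<^bsub>G\<^esub> \<beta>) s) \<in> carrier AHH"
    by (rule abelian_group_hom.hom_closed[OF tensor_map_hom[OF tm] rhos(1)])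
  have coassoc: "id_Delta (\<rho> (\<alpha> \<otimes>\<^bsub>G\<^esub> \<beta>) s) = assoc (rho_id (\<rho> \<beta> s))"
    by (rule Comod.coact_coassoc[OF \<alpha> \<beta> s])
  have key: "\<Phi> a v (id_Delta (\<rho> (\<alpha> \<otimes>\<^bsub>G\<^esub> \<beta>) s)) = ract CC (\<Theta> a v) s"
    if a: "a \<in> carrier A" and v: "v \<in> carrier HH" for a v
    by (rule HH.hom_eqI[OF Phi_param_hom[OF a mem]
          abelian_group_hom_compose[OF CC.tensor_ract_hom[OF s] Theta_hom[OF a]] _ v])
       (simp add: a coassoc Phi_assoc_coact rhos Theta_pure CC.ract_pure s l.AH.pr_closed r.AH.pr_closed)
  have ract_hom: "abelian_group_hom (AH (\<alpha> \<otimes>\<^bsub>G\<^esub> \<beta>)) (AH (\<alpha> \<otimes>\<^bsub>G\<^esub> \<beta>)) (\<lambda>u. ract (C (\<alpha> \<otimes>\<^bsub>G\<^esub> \<beta>)) u s)"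
    by (simp add: lr.AH.mul_hom_left rhos)
  show ?thesis
    by (rule lr.AH.hom_eqI[OF abelian_group_hom_compose[OF comult_hom ract_hom]
          abelian_group_hom_compose[OF CC.tensor_ract_hom[OF s] comult_hom] _ u])
       (simp add: comult_mul rhos key Delta_closed comult_pure)
qed

lemma comult_bimodule_hom: "\<delta> \<in> bimodule_hom A A (C (\<alpha> \<otimes>\<^bsub>G\<^esub> \<beta>)) CC"
  using abelian_group_hom.hom_closed[OF comult_hom] abelian_group_hom.hom_add[OF comult_hom]
    comult_lact comult_ract
  by (auto simp: bimodule_hom_def)

lemma comult_grouplike:
  "\<delta> (comodule_grouplike K H A (\<alpha> \<otimes>\<^bsub>G\<^esub> \<beta>)) = cc (comodule_grouplike K H A \<alpha>) (comodule_grouplike K H A \<beta>)"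
  by (simp add: comodule_grouplike_def comult_pure Hopf.comult_one[OF \<alpha> \<beta>] Theta_pure)

end

section \<open>Coassociativity\<close>

locale hopf_comodule_algebra_triple = hopf_comodule_algebra +
  fixes \<alpha> \<beta> \<gamma>
  assumes \<alpha>: "\<alpha> \<in> carrier G" and \<beta>: "\<beta> \<in> carrier G" and \<gamma>: "\<gamma> \<in> carrier G"
begin

sublocale ab: hopf_comodule_algebra_comult G K H \<Delta> \<epsilon> S A \<rho> \<alpha> \<beta>
  by unfold_locales (rule \<alpha>, rule \<beta>)
sublocale bc: hopf_comodule_algebra_comult G K H \<Delta> \<epsilon> S A \<rho> \<beta> \<gamma>
  by unfold_locales (rule \<beta>, rule \<gamma>)
sublocale ab_c: hopf_comodule_algebra_comult G K H \<Delta> \<epsilon> S A \<rho> "\<alpha> \<otimes>\<^bsub>G\<^esub> \<beta>" \<gamma>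
  by unfold_locales (rule ab.\<alpha>\<beta>, rule \<gamma>)
sublocale a_bc: hopf_comodule_algebra_comult G K H \<Delta> \<epsilon> S A \<rho> \<alpha> "\<beta> \<otimes>\<^bsub>G\<^esub> \<gamma>"
  by unfold_locales (rule \<alpha>, rule bc.\<alpha>\<beta>)

sublocale CCC: bimodule_triple A A A A "C \<alpha>" "C \<beta>" "C \<gamma>"
  by (intro bimodule_triple.intro ab.l.C_bimodule ab.r.C_bimodule bc.r.C_bimodule)
sublocale HHH: bimodule_triple K K K K "symmetric_bimodule (H \<alpha>)" "symmetric_bimodule (H \<beta>)"
    "symmetric_bimodule (H \<gamma>)"
  by (intro bimodule_triple.intro ab.l.AH.T.N.bimodule_axioms ab.r.AH.T.N.bimodule_axioms
      bc.r.AH.T.N.bimodule_axioms)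

abbreviation C_CC where "C_CC \<equiv> tensor (carrier A) (C \<alpha>) bc.CC"
abbreviation c_cc where "c_cc \<equiv> pure_tensor (carrier A) (C \<alpha>) bc.CC"
abbreviation H_HH where "H_HH \<equiv> tensor (carrier K) (symmetric_bimodule (H \<alpha>)) bc.HH"
abbreviation C_assoc where
  "C_assoc \<equiv> tensor_assoc (carrier A) (carrier A) (C \<alpha>) (C \<beta>) (C \<gamma>)"
abbreviation H_assoc where
  "H_assoc \<equiv> tensor_assoc (carrier K) (carrier K) (symmetric_bimodule (H \<alpha>))
    (symmetric_bimodule (H \<beta>)) (symmetric_bimodule (H \<gamma>))"

text \<open>The map \<open>h \<otimes> z \<mapsto> (a \<otimes> h) \<otimes>\<^sub>A \<Theta> 1 z\<close> from \<open>H\<^sub>\<alpha> \<otimes> (H\<^sub>\<beta> \<otimes> H\<^sub>\<gamma>)\<close>. Both iterated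
  comultiplications of \<open>a \<otimes> h\<close> are the images under \<open>\<Xi> a\<close> of those of \<open>h\<close>.\<close>

definition \<Xi> where
  "\<Xi> a = tensor_lift (add_monoid C_CC) (\<lambda>h z. c_cc (p \<alpha> a h) (bc.\<Theta> \<one>\<^bsub>A\<^esub> z))"

lemma Xi_balanced:
  assumes a: "a \<in> carrier A"
  shows "balanced_map (carrier K) (symmetric_bimodule (H \<alpha>)) bc.HH C_CC
    (\<lambda>h z. c_cc (p \<alpha> a h) (bc.\<Theta> \<one>\<^bsub>A\<^esub> z))"
proof (rule balanced_mapI[OF HHH.L_MN.tensor_pair_axioms CCC.L_MN.tensor_abelian])
  show "abelian_group_hom (symmetric_bimodule (H \<alpha>)) C_CC (\<lambda>h. c_cc (p \<alpha> a h) (bc.\<Theta> \<one>\<^bsub>A\<^esub> z))"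
    if "z \<in> carrier bc.HH" for z
    by (rule abelian_group_hom_compose[OF CCC.L_MN.pure.hom_left ab.l.p_hom_right[OF a]])
       (use that in \<open>simp add: bc.Theta_closed\<close>)
  show "abelian_group_hom bc.HH C_CC (\<lambda>z. c_cc (p \<alpha> a h) (bc.\<Theta> \<one>\<^bsub>A\<^esub> z))"
    if "h \<in> carrier (symmetric_bimodule (H \<alpha>))" for h
    by (rule abelian_group_hom_compose[OF CCC.L_MN.pure.hom_right bc.Theta_hom])
       (use a that in \<open>simp_all add: ab.l.AH.pr_closed\<close>)
  fix h k z
  assume "h \<in> carrier (symmetric_bimodule (H \<alpha>))" and k: "k \<in> carrier K" and z: "z \<in> carrier bc.HH"
  then have h: "h \<in> carrier (H \<alpha>)" by simp
  have "c_cc (p \<alpha> a (k \<odot>\<^bsub>H \<alpha>\<^esub> h)) (bc.\<Theta> \<one>\<^bsub>A\<^esub> z)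
      = c_cc (ract (C \<alpha>) (p \<alpha> a h) (k \<odot>\<^bsub>A\<^esub> \<one>\<^bsub>A\<^esub>)) (bc.\<Theta> \<one>\<^bsub>A\<^esub> z)"
    using a h k by (simp only: ab.l.C_ract_scalar)
  also have "\<dots> = c_cc (p \<alpha> a h) (lact bc.CC (k \<odot>\<^bsub>A\<^esub> \<one>\<^bsub>A\<^esub>) (bc.\<Theta> \<one>\<^bsub>A\<^esub> z))"
    by (rule CCC.L_MN.pure.balanced) (use a h k z in \<open>simp_all add: ab.l.AH.pr_closed bc.Theta_closed\<close>)
  also have "lact bc.CC (k \<odot>\<^bsub>A\<^esub> \<one>\<^bsub>A\<^esub>) (bc.\<Theta> \<one>\<^bsub>A\<^esub> z) = bc.\<Theta> \<one>\<^bsub>A\<^esub> (lact bc.HH k z)"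
    using bc.Theta_lact[of "\<one>\<^bsub>A\<^esub>" "k \<odot>\<^bsub>A\<^esub> \<one>\<^bsub>A\<^esub>" z] k z by (simp add: bc.Theta_smult)
  finally show "c_cc (p \<alpha> a (ract (symmetric_bimodule (H \<alpha>)) h k)) (bc.\<Theta> \<one>\<^bsub>A\<^esub> z)
      = c_cc (p \<alpha> a h) (bc.\<Theta> \<one>\<^bsub>A\<^esub> (lact bc.HH k z))"
    by simp
qed

lemma Xi_hom: "a \<in> carrier A \<Longrightarrow> abelian_group_hom H_HH C_CC (\<Xi> a)"
  unfolding \<Xi>_def by (rule balanced_map.lift_hom[OF Xi_balanced])

lemma Xi_pure:
  "\<lbrakk>a \<in> carrier A; h \<in> carrier (H \<alpha>); z \<in> carrier bc.HH\<rbrakk>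
    \<Longrightarrow> \<Xi> a (pure_tensor (carrier K) (symmetric_bimodule (H \<alpha>)) bc.HH h z)
      = c_cc (p \<alpha> a h) (bc.\<Theta> \<one>\<^bsub>A\<^esub> z)"
  unfolding \<Xi>_def by (rule balanced_map.lift_pure[OF Xi_balanced]) simp_all

lemma index_assoc: "\<alpha> \<otimes>\<^bsub>G\<^esub> \<beta> \<otimes>\<^bsub>G\<^esub> \<gamma> = \<alpha> \<otimes>\<^bsub>G\<^esub> (\<beta> \<otimes>\<^bsub>G\<^esub> \<gamma>)"
  by (rule Hopf.G.m_assoc[OF \<alpha> \<beta> \<gamma>])

text \<open>The tensor \<open>y\<close> stands for a value of \<open>\<Delta>\<^sub>\<alpha>\<^sub>,\<^sub>\<beta>\<close>.\<close>

lemma Xi_assoc_pure: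
  assumes a: "a \<in> carrier A" and y: "y \<in> carrier ab.HH" and h: "h \<in> carrier (H \<gamma>)"
  shows "C_assoc (pure_tensor (carrier A) ab.CC (C \<gamma>) (ab.\<Theta> a y) (p \<gamma> \<one>\<^bsub>A\<^esub> h))
    = \<Xi> a (H_assoc (pure_tensor (carrier K) ab.HH (symmetric_bimodule (H \<gamma>)) y h))"
proof -
  have h': "h \<in> carrier (symmetric_bimodule (H \<gamma>))" "p \<gamma> \<one>\<^bsub>A\<^esub> h \<in> carrier (C \<gamma>)"
    using h by (simp_all add: bc.r.AH.pr_closed)
  show ?thesis
    by (rule ab.HH.hom_eqI[OF
          abelian_group_hom_compose[OF CCC.tensor_assoc_hom
            abelian_group_hom_compose[OF CCC.LM_N.pure.hom_left[OF h'(2)] ab.Theta_hom[OF a]]]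
          abelian_group_hom_compose[OF Xi_hom[OF a]
            abelian_group_hom_compose[OF HHH.tensor_assoc_hom HHH.LM_N.pure.hom_left[OF h'(1)]]] _ y])
       (use a h h'(2) in \<open>simp add: ab.Theta_pure CCC.tensor_assoc_pure_pure HHH.tensor_assoc_pure_pure
          Xi_pure bc.Theta_pure bc.HH.pr_closed ab.l.AH.pr_closed ab.r.AH.pr_closed\<close>)
qed

lemma comult_coassoc:
  assumes c: "c \<in> carrier (AH (\<alpha> \<otimes>\<^bsub>G\<^esub> \<beta> \<otimes>\<^bsub>G\<^esub> \<gamma>))"
  shows "C_assoc (tensor_map (carrier A) ab.CC (C \<gamma>) ab.\<delta> (\<lambda>c. c) (ab_c.\<delta> c))
    = tensor_map (carrier A) (C \<alpha>) bc.CC (\<lambda>c. c) bc.\<delta> (a_bc.\<delta> c)"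
proof -
  note d_lin = bimodule_hom_is_hom[OF ab.lr.C_bimodule ab.CC.tensor_bimodule ab.comult_bimodule_hom]
    bimodule_hom_is_hom[OF bc.lr.C_bimodule bc.CC.tensor_bimodule bc.comult_bimodule_hom]
  note tC1 = ab_c.CC.tensor_pair_axioms CCC.LM_N.tensor_pair_axioms d_lin(2) CCC.LM_N.id_left_linear
  note tC2 = a_bc.CC.tensor_pair_axioms CCC.L_MN.tensor_pair_axioms CCC.L_MN.id_right_linear d_lin(6)
  note tH1 = ab_c.HH.T.tensor_pair_axioms HHH.LM_N.tensor_pair_axioms ab.Delta_linear(2)
    HHH.LM_N.id_left_linear
  note tH2 = a_bc.HH.T.tensor_pair_axioms HHH.L_MN.tensor_pair_axioms HHH.L_MN.id_right_linear
    bc.Delta_linear(3)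
  have left: "C_assoc (tensor_map (carrier A) ab.CC (C \<gamma>) ab.\<delta> (\<lambda>c. c) (ab_c.\<Theta> a v))
      = \<Xi> a (H_assoc (tensor_map (carrier K) ab.HH (symmetric_bimodule (H \<gamma>)) (\<Delta> \<alpha> \<beta>) (\<lambda>h. h) v))"
    if a: "a \<in> carrier A" and v: "v \<in> carrier ab_c.HH" for a v
    by (rule ab_c.HH.hom_eqI[OF
          abelian_group_hom_compose[OF CCC.tensor_assoc_hom
            abelian_group_hom_compose[OF tensor_map_hom[OF tC1] ab_c.Theta_hom[OF a]]]
          abelian_group_hom_compose[OF Xi_hom[OF a]
            abelian_group_hom_compose[OF HHH.tensor_assoc_hom tensor_map_hom[OF tH1]]] _ v])
       (simp add: a ab_c.Theta_pure tensor_map_pure[OF tC1] tensor_map_pure[OF tH1] ab.lr.AH.pr_closed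
          bc.r.AH.pr_closed ab.comult_pure Xi_assoc_pure ab.Delta_closed)
  have right: "tensor_map (carrier A) (C \<alpha>) bc.CC (\<lambda>c. c) bc.\<delta> (a_bc.\<Theta> a v)
      = \<Xi> a (tensor_map (carrier K) (symmetric_bimodule (H \<alpha>)) bc.HH (\<lambda>h. h) (\<Delta> \<beta> \<gamma>) v)"
    if a: "a \<in> carrier A" and v: "v \<in> carrier a_bc.HH" for a v
    by (rule a_bc.HH.hom_eqI[OF
          abelian_group_hom_compose[OF tensor_map_hom[OF tC2] a_bc.Theta_hom[OF a]]
          abelian_group_hom_compose[OF Xi_hom[OF a] tensor_map_hom[OF tH2]] _ v])
       (simp add: a a_bc.Theta_pure tensor_map_pure[OF tC2] tensor_map_pure[OF tH2] ab.l.AH.pr_closed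
          bc.lr.AH.pr_closed bc.comult_pure Xi_pure bc.Delta_closed)
  \<comment> \<open>The two iterated comultiplications start from \<open>(\<alpha> \<beta>) \<gamma>\<close> and from \<open>\<alpha> (\<beta> \<gamma>)\<close>; the index must agree syntactically.\<close>
  note a_bc_comult = a_bc.comult_hom[folded index_assoc] a_bc.comult_pure[folded index_assoc]
    a_bc.Delta_closed[folded index_assoc]
  show ?thesis
    by (rule ab_c.lr.AH.hom_eqI[OF
          abelian_group_hom_compose[OF CCC.tensor_assoc_hom
            abelian_group_hom_compose[OF tensor_map_hom[OF tC1] ab_c.comult_hom]]
          abelian_group_hom_compose[OF tensor_map_hom[OF tC2] a_bc_comult(1)] _ c])
       (simp add: ab_c.comult_pure a_bc_comult(2,3) ab_c.Delta_closed left right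
          Hopf.coassoc[OF \<alpha> \<beta> \<gamma>])
qed

end

context hopf_comodule_algebra
begin

lemma comult_locale:
  "\<lbrakk>\<alpha> \<in> carrier G; \<beta> \<in> carrier G\<rbrakk> \<Longrightarrow> hopf_comodule_algebra_comult G K H \<Delta> \<epsilon> S A \<rho> \<alpha> \<beta>"
  by unfold_locales

lemma component_locale:
  "\<alpha> \<in> carrier G \<Longrightarrow> hopf_comodule_algebra_component G K H \<Delta> \<epsilon> S A \<rho> \<alpha>"
  by unfold_locales

lemma triple_locale:
  "\<lbrakk>\<alpha> \<in> carrier G; \<beta> \<in> carrier G; \<gamma> \<in> carrier G\<rbrakk>
    \<Longrightarrow> hopf_comodule_algebra_triple G K H \<Delta> \<epsilon> S A \<rho> \<alpha> \<beta> \<gamma>"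
  by unfold_locales

section \<open>The counit\<close>

abbreviation RA where "RA \<equiv> regular_bimodule A"
abbreviation RK where "RK \<equiv> regular_bimodule K"

sublocale e: hopf_comodule_algebra_component G K H \<Delta> \<epsilon> S A \<rho> "\<one>\<^bsub>G\<^esub>"
  by (rule component_locale) simp

lemma RA_bimodule: "bimodule A A RA"
  by (rule regular_bimodule_is_bimodule[OF Comod.A.A.ring_axioms])

lemma eps_linear:
  "abelian_group_hom (symmetric_bimodule (H \<one>\<^bsub>G\<^esub>)) RK \<epsilon>"
  "right_linear (carrier K) (symmetric_bimodule (H \<one>\<^bsub>G\<^esub>)) RK \<epsilon>"
  "left_linear (carrier K) (symmetric_bimodule (H \<one>\<^bsub>G\<^esub>)) RK \<epsilon>"
  using bimodule_hom_is_hom[OF e.AH.T.N.bimodule_axioms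
      regular_bimodule_is_bimodule[OF Hopf.K.ring_axioms] Hopf.counit_hom] .

lemma eps_closed: "h \<in> carrier (H \<one>\<^bsub>G\<^esub>) \<Longrightarrow> \<epsilon> h \<in> carrier K"
  using abelian_group_hom.hom_closed[OF eps_linear(1)] by simp

lemma eps_smult:
  "\<lbrakk>k \<in> carrier K; h \<in> carrier (H \<one>\<^bsub>G\<^esub>)\<rbrakk> \<Longrightarrow> \<epsilon> (k \<odot>\<^bsub>H \<one>\<^bsub>G\<^esub>\<^esub> h) = k \<otimes>\<^bsub>K\<^esub> \<epsilon> h"
  using eps_linear(3) by (simp add: left_linear_def)

lemma counit_balanced:
  "balanced_map (carrier K) (symmetric_bimodule A) (symmetric_bimodule (H \<one>\<^bsub>G\<^esub>)) A
    (\<lambda>a h. \<epsilon> h \<odot>\<^bsub>A\<^esub> a)"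
proof (rule balanced_mapI[OF e.AH.T.tensor_pair_axioms Comod.A.A.is_abelian_group])
  show "abelian_group_hom (symmetric_bimodule A) A (\<lambda>a. \<epsilon> h \<odot>\<^bsub>A\<^esub> a)"
    if "h \<in> carrier (symmetric_bimodule (H \<one>\<^bsub>G\<^esub>))" for h
    using that by (intro abelian_group_hom_change[OF e.AH.T.M.lact_hom[simplified]])
      (auto simp: eps_closed)
  show "abelian_group_hom (symmetric_bimodule (H \<one>\<^bsub>G\<^esub>)) A (\<lambda>h. \<epsilon> h \<odot>\<^bsub>A\<^esub> a)"
    if a: "a \<in> carrier (symmetric_bimodule A)" for a
  proof (rule abelian_group_hom_compose[OF _ eps_linear(1)])
    show "abelian_group_hom RK A (\<lambda>k. k \<odot>\<^bsub>A\<^esub> a)"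
      by (rule abelian_group_hom_change[OF e.AH.T.M.lact_scalar_hom[OF a,
              unfolded symmetric_bimodule_simps]]) simp_all
  qed
qed (simp add: eps_smult eps_closed Comod.A.smult_assoc1[symmetric] Hopf.K.m_comm)

lemma counit_add_hom: "abelian_group_hom (AH \<one>\<^bsub>G\<^esub>) A (comodule_counit \<epsilon> A)"
  unfolding comodule_counit_def by (rule balanced_map.lift_hom[OF counit_balanced])

lemma counit_pure:
  "\<lbrakk>a \<in> carrier A; h \<in> carrier (H \<one>\<^bsub>G\<^esub>)\<rbrakk>
    \<Longrightarrow> comodule_counit \<epsilon> A (p \<one>\<^bsub>G\<^esub> a h) = \<epsilon> h \<odot>\<^bsub>A\<^esub> a"
  unfolding comodule_counit_def by (rule balanced_map.lift_pure[OF counit_balanced]) simp_all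

lemma A_mult_hom:
  "a \<in> carrier A \<Longrightarrow> abelian_group_hom A A (\<lambda>b. a \<otimes>\<^bsub>A\<^esub> b)"
  "a \<in> carrier A \<Longrightarrow> abelian_group_hom A A (\<lambda>b. b \<otimes>\<^bsub>A\<^esub> a)"
  by (auto intro: abelian_group_hom_change[OF Comod.A.mult_left_hom]
      abelian_group_hom_change[OF Comod.A.mult_right_hom])

lemma counit_lact:
  assumes b: "b \<in> carrier A" and u: "u \<in> carrier (AH \<one>\<^bsub>G\<^esub>)"
  shows "comodule_counit \<epsilon> A (lact (C \<one>\<^bsub>G\<^esub>) b u) = b \<otimes>\<^bsub>A\<^esub> comodule_counit \<epsilon> A u"
  by (rule e.AH.hom_eqI[OF abelian_group_hom_compose[OF counit_add_hom e.C_lact_hom[OF b]]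
        abelian_group_hom_compose[OF A_mult_hom(1)[OF b] counit_add_hom] _ u])
     (simp add: b e.C_lact_pure counit_pure eps_closed Comod.A.smult_mult_right)

text \<open>For \<open>w = \<rho>\<^sub>e(b)\<close> the last factor is \<open>b\<close> by the counit law of the coaction, which gives the right
  linearity of the counit.\<close>

lemma counit_mul:
  assumes a: "a \<in> carrier A" and h: "h \<in> carrier (H \<one>\<^bsub>G\<^esub>)" and w: "w \<in> carrier (AH \<one>\<^bsub>G\<^esub>)"
  shows "comodule_counit \<epsilon> A (k_tensor_mult K A (H \<one>\<^bsub>G\<^esub>) (p \<one>\<^bsub>G\<^esub> a h) w)
    = (\<epsilon> h \<odot>\<^bsub>A\<^esub> a) \<otimes>\<^bsub>A\<^esub> tensor_unit_right (symmetric_bimodule A)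
        (tensor_map (carrier K) (symmetric_bimodule A) RK (\<lambda>a. a) \<epsilon> w)"
proof -
  have ha: "\<epsilon> h \<odot>\<^bsub>A\<^esub> a \<in> carrier A" using a h by (simp add: eps_closed)
  note tm = e.AH.T.tensor_pair_axioms balanced_map.axioms(1)[OF e.AH.T.M.unit_right_balanced]
    e.AH.T.id_right_linear eps_linear(3)
  have unit: "abelian_group_hom (tensor (carrier K) (symmetric_bimodule A) RK) A
      (tensor_unit_right (symmetric_bimodule A))"
    by (rule abelian_group_hom_change[OF e.AH.T.M.tensor_unit_right_hom]) simp_all
  show ?thesis
  proof (rule e.AH.hom_eqI[OF abelian_group_hom_compose[OF counit_add_hom
          e.AH.mul_hom_right[OF e.AH.pr_closed[OF a h]]]
        abelian_group_hom_compose[OF A_mult_hom(1)[OF ha]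
          abelian_group_hom_compose[OF unit tensor_map_hom[OF tm]]] _ w])
    fix b g assume b: "b \<in> carrier A" and g: "g \<in> carrier (H \<one>\<^bsub>G\<^esub>)"
    show "comodule_counit \<epsilon> A (k_tensor_mult K A (H \<one>\<^bsub>G\<^esub>) (p \<one>\<^bsub>G\<^esub> a h) (p \<one>\<^bsub>G\<^esub> b g))
      = (\<epsilon> h \<odot>\<^bsub>A\<^esub> a) \<otimes>\<^bsub>A\<^esub> tensor_unit_right (symmetric_bimodule A)
          (tensor_map (carrier K) (symmetric_bimodule A) RK (\<lambda>a. a) \<epsilon> (p \<one>\<^bsub>G\<^esub> b g))"
      using a h b g
      by (simp add: e.AH.mul_pure counit_pure Hopf.counit_mult tensor_map_pure[OF tm] eps_closed
          e.AH.T.M.tensor_unit_right_pure Comod.A.smult_mult_left Comod.A.smult_mult_right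
          Comod.A.smult_assoc1[symmetric] Hopf.K.m_comm)
  qed
qed

lemma counit_ract:
  assumes b: "b \<in> carrier A" and u: "u \<in> carrier (AH \<one>\<^bsub>G\<^esub>)"
  shows "comodule_counit \<epsilon> A (ract (C \<one>\<^bsub>G\<^esub>) u b) = comodule_counit \<epsilon> A u \<otimes>\<^bsub>A\<^esub> b"
proof -
  have "abelian_group_hom (AH \<one>\<^bsub>G\<^esub>) (AH \<one>\<^bsub>G\<^esub>) (\<lambda>u. ract (C \<one>\<^bsub>G\<^esub>) u b)"
    using b by (simp add: e.AH.mul_hom_left e.rho_closed)
  then show ?thesis
    by (rule e.AH.hom_eqI[OF abelian_group_hom_compose[OF counit_add_hom]
          abelian_group_hom_compose[OF A_mult_hom(2)[OF b] counit_add_hom] _ u])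
       (simp add: b counit_mul counit_pure e.rho_closed Comod.coact_counit)
qed

lemma counit_bimodule_hom: "comodule_counit \<epsilon> A \<in> bimodule_hom A A (C \<one>\<^bsub>G\<^esub>) RA"
  using abelian_group_hom.hom_closed[OF counit_add_hom] abelian_group_hom.hom_add[OF counit_add_hom]
    counit_lact counit_ract
  by (auto simp: bimodule_hom_def)

lemma counit_linear:
  "right_linear (carrier A) (C \<one>\<^bsub>G\<^esub>) RA (comodule_counit \<epsilon> A)"
  "left_linear (carrier A) (C \<one>\<^bsub>G\<^esub>) RA (comodule_counit \<epsilon> A)"
  using bimodule_hom_is_hom(2,3)[OF e.C_bimodule RA_bimodule counit_bimodule_hom] .

text \<open>The right action of \<open>\<epsilon>(h') 1\<close> on \<open>a \<otimes> h\<close> is \<open>a \<otimes> \<epsilon>(h') h\<close>, so the left-hand side for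
  \<open>c = a \<otimes> h\<close> is \<open>a\<close> tensored with the corresponding expression in \<open>H\<close>.\<close>

lemma comult_counit_right:
  assumes \<alpha>: "\<alpha> \<in> carrier G" and c: "c \<in> carrier (AH \<alpha>)"
  shows "tensor_unit_right (C \<alpha>) (tensor_map (carrier A) (C \<alpha>) RA (\<lambda>c. c) (comodule_counit \<epsilon> A)
      (comodule_comult K H \<Delta> A \<rho> \<alpha> \<one>\<^bsub>G\<^esub> c)) = c"
proof -
  interpret \<delta>: hopf_comodule_algebra_comult G K H \<Delta> \<epsilon> S A \<rho> \<alpha> "\<one>\<^bsub>G\<^esub>"
    by (rule comult_locale[OF \<alpha>]) simp
  have index: "\<alpha> \<otimes>\<^bsub>G\<^esub> \<one>\<^bsub>G\<^esub> = \<alpha>" using \<alpha> by simp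
  note tC = \<delta>.CC.tensor_pair_axioms balanced_map.axioms(1)[OF \<delta>.CC.M.unit_right_balanced]
    \<delta>.CC.id_right_linear counit_linear(2)
  note tH = \<delta>.HH.T.tensor_pair_axioms balanced_map.axioms(1)[OF \<delta>.l.AH.T.N.unit_right_balanced]
    \<delta>.HH.T.id_right_linear eps_linear(3)
  have unit: "abelian_group_hom (tensor (carrier A) (C \<alpha>) RA) (AH \<alpha>) (tensor_unit_right (C \<alpha>))"
    by (rule abelian_group_hom_change[OF \<delta>.CC.M.tensor_unit_right_hom]) simp_all
  have scalar: "k_tensor_mult K A (H \<alpha>) (p \<alpha> a h) (\<rho> \<alpha> (k \<odot>\<^bsub>A\<^esub> \<one>\<^bsub>A\<^esub>)) = p \<alpha> a (k \<odot>\<^bsub>H \<alpha>\<^esub> h)"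
    if "k \<in> carrier K" "a \<in> carrier A" "h \<in> carrier (H \<alpha>)" for k a h
    using \<delta>.l.C_ract_scalar[OF that] by simp
  have key: "tensor_unit_right (C \<alpha>)
        (tensor_map (carrier A) (C \<alpha>) RA (\<lambda>c. c) (comodule_counit \<epsilon> A) (\<delta>.\<Theta> a v))
      = p \<alpha> a (tensor_unit_right (symmetric_bimodule (H \<alpha>))
          (tensor_map (carrier K) (symmetric_bimodule (H \<alpha>)) RK (\<lambda>h. h) \<epsilon> v))"
    if a: "a \<in> carrier A" and v: "v \<in> carrier \<delta>.HH" for a v
    by (rule \<delta>.HH.hom_eqI[OF
          abelian_group_hom_compose[OF unit
            abelian_group_hom_compose[OF tensor_map_hom[OF tC] \<delta>.Theta_hom[OF a]]]
          abelian_group_hom_compose[OF \<delta>.l.AH.pr_hom_right[OF a]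
            abelian_group_hom_compose[OF \<delta>.l.AH.T.N.tensor_unit_right_hom tensor_map_hom[OF tH]]] _ v])
       (simp add: a \<delta>.Theta_pure tensor_map_pure[OF tC] tensor_map_pure[OF tH] \<delta>.l.AH.pr_closed
          e.AH.pr_closed counit_pure \<delta>.CC.M.tensor_unit_right_pure eps_closed scalar
          \<delta>.l.AH.T.N.tensor_unit_right_pure)
  show ?thesis
    by (rule \<delta>.l.AH.hom_eqI[OF
          abelian_group_hom_compose[OF unit
            abelian_group_hom_compose[OF tensor_map_hom[OF tC] \<delta>.comult_hom[unfolded index]]]
          abelian_group_hom_id[OF \<delta>.l.AH.T.tensor_abelian] _ c])
       (simp add: \<delta>.comult_pure[unfolded index] key \<delta>.Delta_closed[unfolded index]
          Hopf.counit_right[OF \<alpha>])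
qed

lemma comult_counit_left:
  assumes \<alpha>: "\<alpha> \<in> carrier G" and c: "c \<in> carrier (AH \<alpha>)"
  shows "tensor_unit_left (C \<alpha>) (tensor_map (carrier A) RA (C \<alpha>) (comodule_counit \<epsilon> A) (\<lambda>c. c)
      (comodule_comult K H \<Delta> A \<rho> \<one>\<^bsub>G\<^esub> \<alpha> c)) = c"
proof -
  interpret \<delta>: hopf_comodule_algebra_comult G K H \<Delta> \<epsilon> S A \<rho> "\<one>\<^bsub>G\<^esub>" \<alpha>
    by (rule comult_locale[OF _ \<alpha>]) simp
  have index: "\<one>\<^bsub>G\<^esub> \<otimes>\<^bsub>G\<^esub> \<alpha> = \<alpha>" using \<alpha> by simp
  note tC = \<delta>.CC.tensor_pair_axioms balanced_map.axioms(1)[OF \<delta>.CC.N.unit_left_balanced]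
    counit_linear(1) \<delta>.CC.id_left_linear
  note tH = \<delta>.HH.T.tensor_pair_axioms balanced_map.axioms(1)[OF \<delta>.r.AH.T.N.unit_left_balanced]
    eps_linear(2) \<delta>.HH.T.id_left_linear
  have unit: "abelian_group_hom (tensor (carrier A) RA (C \<alpha>)) (AH \<alpha>) (tensor_unit_left (C \<alpha>))"
    by (rule abelian_group_hom_change[OF \<delta>.CC.N.tensor_unit_left_hom]) simp_all
  have key: "tensor_unit_left (C \<alpha>)
        (tensor_map (carrier A) RA (C \<alpha>) (comodule_counit \<epsilon> A) (\<lambda>c. c) (\<delta>.\<Theta> a v))
      = p \<alpha> a (tensor_unit_left (symmetric_bimodule (H \<alpha>))
          (tensor_map (carrier K) RK (symmetric_bimodule (H \<alpha>)) \<epsilon> (\<lambda>h. h) v))"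
    if a: "a \<in> carrier A" and v: "v \<in> carrier \<delta>.HH" for a v
    by (rule \<delta>.HH.hom_eqI[OF
          abelian_group_hom_compose[OF unit
            abelian_group_hom_compose[OF tensor_map_hom[OF tC] \<delta>.Theta_hom[OF a]]]
          abelian_group_hom_compose[OF \<delta>.r.AH.pr_hom_right[OF a]
            abelian_group_hom_compose[OF \<delta>.r.AH.T.N.tensor_unit_left_hom tensor_map_hom[OF tH]]] _ v])
       (simp add: a \<delta>.Theta_pure tensor_map_pure[OF tC] tensor_map_pure[OF tH] \<delta>.r.AH.pr_closed
          e.AH.pr_closed counit_pure \<delta>.CC.N.tensor_unit_left_pure eps_closed \<delta>.r.C_lact_pure
          \<delta>.r.AH.T.N.tensor_unit_left_pure \<delta>.r.AH.pr_balanced)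
  show ?thesis
    by (rule \<delta>.r.AH.hom_eqI[OF
          abelian_group_hom_compose[OF unit
            abelian_group_hom_compose[OF tensor_map_hom[OF tC] \<delta>.comult_hom[unfolded index]]]
          abelian_group_hom_id[OF \<delta>.r.AH.T.tensor_abelian] _ c])
       (simp add: \<delta>.comult_pure[unfolded index] key \<delta>.Delta_closed[unfolded index]
          Hopf.counit_left[OF \<alpha>])
qed

section \<open>Galois corings and Hopf-Galois extensions\<close>

theorem comodule_group_coring:
  "group_coring G A C (comodule_comult K H \<Delta> A \<rho>) (comodule_counit \<epsilon> A)"
proof (intro group_coring.intro group_coring_axioms.intro)
  show "group G" by (rule Hopf.G.group_axioms)
  show "ring A" by (rule Comod.A.A.ring_axioms)
  show "bimodule A A (C \<alpha>)" if "\<alpha> \<in> carrier G" for \<alpha>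
    by (rule hopf_comodule_algebra_component.C_bimodule[OF component_locale[OF that]])
  show "comodule_comult K H \<Delta> A \<rho> \<alpha> \<beta>
      \<in> bimodule_hom A A (C (\<alpha> \<otimes>\<^bsub>G\<^esub> \<beta>)) (tensor (carrier A) (C \<alpha>) (C \<beta>))"
    if "\<alpha> \<in> carrier G" "\<beta> \<in> carrier G" for \<alpha> \<beta>
    by (rule hopf_comodule_algebra_comult.comult_bimodule_hom[OF comult_locale[OF that]])
  show "comodule_counit \<epsilon> A \<in> bimodule_hom A A (C \<one>\<^bsub>G\<^esub>) RA" by (rule counit_bimodule_hom)
qed (simp_all only: C_simps hopf_comodule_algebra_triple.comult_coassoc[OF triple_locale]
      comult_counit_right comult_counit_left)

lemma comodule_grouplike_family:
  "grouplike_family G A C (comodule_comult K H \<Delta> A \<rho>) (comodule_counit \<epsilon> A)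
    (comodule_grouplike K H A)"
  unfolding grouplike_family_def
proof (intro conjI ballI)
  show "comodule_grouplike K H A \<alpha> \<in> carrier (C \<alpha>)" if "\<alpha> \<in> carrier G" for \<alpha>
  proof -
    interpret hopf_comodule_algebra_component G K H \<Delta> \<epsilon> S A \<rho> \<alpha> by (rule component_locale[OF that])
    show ?thesis by (simp add: comodule_grouplike_def AH.pr_closed)
  qed
  show "comodule_counit \<epsilon> A (comodule_grouplike K H A \<one>\<^bsub>G\<^esub>) = \<one>\<^bsub>A\<^esub>"
    by (simp add: comodule_grouplike_def counit_pure Hopf.counit_one)
qed (rule hopf_comodule_algebra_comult.comult_grouplike[OF comult_locale])

sublocale coring: grouplike_coring G A C "comodule_comult K H \<Delta> A \<rho>" "comodule_counit \<epsilon> A"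
    "comodule_grouplike K H A"
  by (intro grouplike_coring.intro grouplike_coring_axioms.intro comodule_group_coring
      comodule_grouplike_family)

lemma coinvariants_eq:
  "comodule_coinvariants G K H A \<rho> = coring_coinvariants G A C (comodule_grouplike K H A)"
proof -
  have "(\<rho> \<alpha> a = p \<alpha> a \<one>\<^bsub>H \<alpha>\<^esub>)
      = (lact (C \<alpha>) a (comodule_grouplike K H A \<alpha>) = ract (C \<alpha>) (comodule_grouplike K H A \<alpha>) a)"
    if "\<alpha> \<in> carrier G" "a \<in> carrier A" for \<alpha> a
  proof -
    interpret hopf_comodule_algebra_component G K H \<Delta> \<epsilon> S A \<rho> \<alpha>
      by (rule component_locale[OF that(1)])
    show ?thesis
      using that(2) by (auto simp: comodule_grouplike_def C_lact_pure AH.one_mul rho_closed)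
  qed
  then show ?thesis
    unfolding comodule_coinvariants_def coring_coinvariants_def by blast
qed

text \<open>Both maps are lifts: one of \<open>(a, b) \<mapsto> a \<rho>\<^sub>\<alpha>(b)\<close>, the other of
  \<open>(a, b) \<mapsto> (a \<otimes> 1) \<rho>\<^sub>\<alpha>(b)\<close>. The inner lift in the definition of \<^const>\<open>hopf_galois_can\<close> is literally the left action of the coring.\<close>

lemma hopf_galois_can_eq:
  assumes \<alpha>: "\<alpha> \<in> carrier G" and u: "u \<in> carrier coring.ATA"
  shows "hopf_galois_can K H A \<rho> \<alpha> u = coring_can C (comodule_grouplike K H A) \<alpha> u"
proof -
  interpret hopf_comodule_algebra_component G K H \<Delta> \<epsilon> S A \<rho> \<alpha> by (rule component_locale[OF \<alpha>])
  have eq: "lact (C \<alpha>) a (\<rho> \<alpha> b) = ract (C \<alpha>) (lact (C \<alpha>) a (comodule_grouplike K H A \<alpha>)) b"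
    if "a \<in> carrier A" "b \<in> carrier A" for a b
    using that by (simp add: comodule_grouplike_def C_lact_eq_mul rho_closed AH.pr_closed AH.mul_one)
  have lift: "hopf_galois_can K H A \<rho> \<alpha>
      = tensor_lift (add_monoid (C \<alpha>)) (\<lambda>a b. lact (C \<alpha>) a (\<rho> \<alpha> b))"
    unfolding hopf_galois_can_def comodule_coring_def bimodule.simps
    by (intro ext tensor_lift_cong_group) (simp_all add: tensor_simps)
  have bal: "balanced_map coring.T RA RA (C \<alpha>) (\<lambda>a b. lact (C \<alpha>) a (\<rho> \<alpha> b))"
    by (rule balanced_map_cong[OF coring.can_balanced[OF \<alpha>]]) (simp_all add: eq del: C_simps)
  show ?thesis
    unfolding lift
    by (rule coring.AT.tensor_hom_eqI[OF balanced_map.lift_hom[OF bal] coring.can_hom[OF \<alpha>] _ u])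
       (simp add: balanced_map.lift_pure[OF bal] coring.can_pure[OF \<alpha>] eq del: C_simps)
qed

theorem galois_iff_hopf_galois:
  "galois_group_coring G A C (comodule_comult K H \<Delta> A \<rho>) (comodule_counit \<epsilon> A) (comodule_grouplike K H A)
    \<longleftrightarrow> hopf_galois_extension G K H A \<rho>"
  unfolding coring.galois_iff_bij_can hopf_galois_extension_def coinvariants_eq C_simps
  using hopf_galois_can_eq by (intro ball_cong bij_betw_cong) auto

end

theorem proposition10p2:
  fixes G :: "('g, 'x) monoid_scheme" and K :: "('k, 'y) ring_scheme"
    and H :: "'g \<Rightarrow> ('k, 'h) module"
    and \<Delta> :: "'g \<Rightarrow> 'g \<Rightarrow> 'h \<Rightarrow> ('h \<times> 'h \<Rightarrow>\<^sub>0 int) set"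
    and \<epsilon> :: "'h \<Rightarrow> 'k"
    and S :: "'g \<Rightarrow> 'h \<Rightarrow> 'h"
    and A :: "('k, 'a) module"
    and \<rho> :: "'g \<Rightarrow> 'a \<Rightarrow> ('a \<times> 'h \<Rightarrow>\<^sub>0 int) set"
  assumes "hopf_group_coalgebra G K H \<Delta> \<epsilon> S"
    and "group_comodule_algebra G K H \<Delta> \<epsilon> A \<rho>"
  shows "comodule_coinvariants G K H A \<rho>
      = coring_coinvariants G A (comodule_coring K H A \<rho>) (comodule_grouplike K H A)
    \<and> (galois_group_coring G A (comodule_coring K H A \<rho>) (comodule_comult K H \<Delta> A \<rho>)
          (comodule_counit \<epsilon> A) (comodule_grouplike K H A)
        \<longleftrightarrow> hopf_galois_extension G K H A \<rho>)"
proof -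
  have h: "hopf_comodule_algebra G K H \<Delta> \<epsilon> S A \<rho>"
    using assms by (rule hopf_comodule_algebra.intro)
  show ?thesis
    using hopf_comodule_algebra.coinvariants_eq[OF h]
      hopf_comodule_algebra.galois_iff_hopf_galois[OF h] by (rule conjI)
qed

end
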